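(* Assume (Y1) and let $f \in L^{\frac{2d}{d+2}}(U)$. Then there exists a unique weak solution $u\in H^{1,2}_0(U)$ to $$-\mathrm{div}(A \nabla u) + \langle \mathbf{H}, \nabla u \rangle + c u = f \text{ in } U, \qquad u=0 \text{ on } \partial U,$$ i.e. a unique $u \in H^{1,2}_0(U)$ with $\int_U \left( \langle A \nabla u, \nabla \psi \rangle + \langle \mathbf{H}, \nabla u \rangle \psi + cu \psi \right) dx = \int_U f \psi \, dx$ for all $\psi \in C_0^{\infty}(U)$.
   Context: Condition (Y1): $U$ is a bounded open subset of $\mathbb{R}^d$ with $d \geq 3$, $\mathbf{H} \in L^d(U, \mathbb{R}^d)$, $c \in L^{\frac{d}{2}}(U)$ with $c \geq 0$ in $U$, and $A = (a_{ij})_{1 \leq i,j \leq d}$ is a (possibly non-symmetric) matrix of measurable functions on $\mathbb{R}^d$ for which there exist constants $M>0$, $\lambda>0$ with $\langle A(x) \xi, \xi \rangle \geq \lambda \| \xi \|^2$ and $\max_{i,j} |a_{ij}(x)| \leq M$ for a.e. $x \in \mathbb{R}^d$ and all $\xi \in \mathbb{R}^d$. *)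

theory Defs
  imports "HOL-Analysis.Analysis"
begin

definition Lp_on :: "real \<Rightarrow> (real^'n) set \<Rightarrow> (real^'n \<Rightarrow> 'b::euclidean_space) \<Rightarrow> bool"
  where "Lp_on p U f \<longleftrightarrow>
    set_borel_measurable lebesgue U f \<and>
    (\<integral>\<^sup>+ x \<in> U. ennreal (norm (f x) powr p) \<partial>lebesgue) < \<infinity>"

fun iter_deriv :: "(real^'n) list \<Rightarrow> (real^'n \<Rightarrow> real) \<Rightarrow> (real^'n \<Rightarrow> real)" where
  "iter_deriv [] f = f"
| "iter_deriv (v # vs) f = (\<lambda>x. frechet_derivative (iter_deriv vs f) (at x) v)"

definition smooth_fun :: "(real^'n \<Rightarrow> real) \<Rightarrow> bool"
  where "smooth_fun f \<longleftrightarrow> (\<forall>vs x. iter_deriv vs f differentiable (at x))"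

definition test_fun :: "(real^'n) set \<Rightarrow> (real^'n \<Rightarrow> real) \<Rightarrow> bool"
  where "test_fun U \<psi> \<longleftrightarrow> smooth_fun \<psi> \<and>
     compact (closure {x. \<psi> x \<noteq> 0}) \<and> closure {x. \<psi> x \<noteq> 0} \<subseteq> U"

definition pderiv_i :: "'n \<Rightarrow> (real^'n \<Rightarrow> real) \<Rightarrow> real^'n \<Rightarrow> real"
  where "pderiv_i i f x = frechet_derivative f (at x) (axis i 1)"

definition grad :: "(real^'n \<Rightarrow> real) \<Rightarrow> real^'n \<Rightarrow> real^'n"
  where "grad f x = (\<chi> i. pderiv_i i f x)"

definition is_weak_grad :: "(real^'n) set \<Rightarrow> (real^'n \<Rightarrow> real) \<Rightarrow> (real^'n \<Rightarrow> real^'n) \<Rightarrow> bool"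
  where "is_weak_grad U u G \<longleftrightarrow>
    (\<forall>\<psi>. test_fun U \<psi> \<longrightarrow> (\<forall>i.
       (LINT x:U|lebesgue. u x * pderiv_i i \<psi> x) = - (LINT x:U|lebesgue. G x $ i * \<psi> x)))"

definition H12_grad :: "(real^'n) set \<Rightarrow> (real^'n \<Rightarrow> real) \<Rightarrow> (real^'n \<Rightarrow> real^'n) \<Rightarrow> bool"
  where "H12_grad U u G \<longleftrightarrow> Lp_on 2 U u \<and> Lp_on 2 U G \<and> is_weak_grad U u G"

definition H120_grad :: "(real^'n) set \<Rightarrow> (real^'n \<Rightarrow> real) \<Rightarrow> (real^'n \<Rightarrow> real^'n) \<Rightarrow> bool"
  where "H120_grad U u G \<longleftrightarrow> H12_grad U u G \<and>
    (\<exists>\<phi>. (\<forall>k. test_fun U (\<phi> k)) \<and>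
       ((\<lambda>k. \<integral>\<^sup>+ x \<in> U. ennreal ((u x - \<phi> k x)\<^sup>2) \<partial>lebesgue) \<longlonglongrightarrow> 0) \<and>
       ((\<lambda>k. \<integral>\<^sup>+ x \<in> U. ennreal ((norm (G x - grad (\<phi> k) x))\<^sup>2) \<partial>lebesgue) \<longlonglongrightarrow> 0))"

definition weak_eqn :: "(real^'n) set \<Rightarrow> (real^'n \<Rightarrow> real^'n^'n) \<Rightarrow> (real^'n \<Rightarrow> real^'n)
    \<Rightarrow> (real^'n \<Rightarrow> real) \<Rightarrow> (real^'n \<Rightarrow> real) \<Rightarrow> (real^'n \<Rightarrow> real) \<Rightarrow> (real^'n \<Rightarrow> real^'n) \<Rightarrow> bool"
  where "weak_eqn U A H c f u G \<longleftrightarrow>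
    (\<forall>\<psi>. test_fun U \<psi> \<longrightarrow>
       (LINT x:U|lebesgue. (A x *v G x) \<bullet> grad \<psi> x + (H x \<bullet> G x) * \<psi> x + c x * u x * \<psi> x)
       = (LINT x:U|lebesgue. f x * \<psi> x))"

end

theory Submission
  imports Defs
begin

text \<open>
  On the pre-Hilbert space of test functions with the Dirichlet inner product, the bilinear form of
  the problem is connected to the inner product by the segment \<open>(1 - t) \<langle>\<cdot>,\<cdot>\<rangle> + t B\<close>. If these forms are
  stable uniformly in \<open>t\<close>, the method of continuity shows that \<open>B\<close> has dense range; approximate solutions
  then form a Cauchy sequence whose limit is the solution. Stability of \<open>B\<close> also gives uniqueness.

  Stability is an a priori estimate in the style of Bottaro and Marina. Although the drift is not small
  in \<open>L\<^sup>d\<close>, the range of a test function \<open>\<phi>\<close> can be cut into finitely many level strips on each of which the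
  drift is so small in \<open>L\<^sup>d\<close> that, by Hoelder's and Sobolev's inequalities, testing with \<open>max 0 (\<phi> - k)\<close> lets
  the ellipticity absorb it; the number of strips depends only on the drift. The truncations are
  limits of polynomials of \<open>\<phi>\<close>, which are again test functions. The strips can be chosen because
  \<open>\<nabla>\<phi> = 0\<close> almost everywhere on each level set.
\<close>

section \<open>Hoelder's inequality\<close>

text \<open>For a drift in \<open>L^d\<close> the product of drift, gradient and test function sits
  exactly at Hoelder's borderline \<open>1/d + 1/2 + 1/ps = 1\<close>, with \<open>ps\<close> the
  Sobolev exponent. The a priori estimate bounds the form from below, which yields uniqueness but
  says nothing about the range; no corresponding estimate is derived for the adjoint, so solvability
  has to be carried over from the inner product. Stability uniform in \<open>t\<close> costs nothing
  extra: along the segment the ellipticity is at least \<open>min 1 lam\<close>, the drift is at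
  most \<open>norm (H x)\<close> pointwise, and the zero-order term has the good sign. The estimate
  is therefore stated for arbitrary fields \<open>W\<close> and \<open>w\<close> that satisfy these
  inequalities along the function at hand, and one constant serves every \<open>t\<close>. Elements
  of the Sobolev space enter only at the end, as L2 limits of test functions, so that space is never
  built as a Hilbert space.\<close>

text \<open>In contrast to \<open>powr\<close>, the exponent \<open>0\<close> gives \<open>1\<close> at every base, so that Hoelder's inequality may
  have vanishing weights.\<close>

definition epow :: "ennreal \<Rightarrow> real \<Rightarrow> ennreal" where
  "epow a p = (if p = 0 then 1 else if a = top then top else ennreal (enn2real a powr p))"

lemma epow_0 [simp]: "epow a 0 = 1"
  by (simp add: epow_def)

lemma epow_zero: "0 < p \<Longrightarrow> epow 0 p = 0"
  by (simp add: epow_def)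

lemma epow_top: "0 < p \<Longrightarrow> epow top p = top"
  by (simp add: epow_def)

lemma epow_ennreal: "0 \<le> x \<Longrightarrow> 0 < p \<Longrightarrow> epow (ennreal x) p = ennreal (x powr p)"
  by (simp add: epow_def)

lemma epow_nonzero: "a \<noteq> 0 \<Longrightarrow> epow a p \<noteq> 0"
  by (auto simp: epow_def enn2real_eq_0_iff)

lemma epow_add:
  assumes "0 \<le> p" "0 \<le> q"
  shows "epow a (p + q) = epow a p * epow a q"
proof (cases "p = 0 \<or> q = 0")
  case False
  then have "p > 0" "q > 0" using assms by auto
  then show ?thesis by (auto simp: epow_def powr_add ennreal_mult ennreal_top_mult)
qed auto

lemma epow_mono:
  assumes "a \<le> b" "0 \<le> p"
  shows "epow a p \<le> epow b p"
proof (cases "p = 0 \<or> b = top")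
  case False
  then have "a \<noteq> top" using assms by (auto simp: top_unique)
  then show ?thesis
    using False assms by (auto simp: epow_def less_top intro!: ennreal_leI powr_mono2 enn2real_mono)
qed (use assms in \<open>auto simp: epow_def\<close>)

lemma epow_prod_const: "finite B \<Longrightarrow> 0 \<le> p \<Longrightarrow> (\<Prod>b\<in>B. epow a p) = epow a (real (card B) * p)"
  by (induction B rule: finite_induct) (auto simp: epow_add algebra_simps)

lemma borel_measurable_epow [measurable]:
  assumes [measurable]: "f \<in> borel_measurable M"
  shows "(\<lambda>x. epow (f x) p) \<in> borel_measurable M"
  unfolding epow_def by measurable

text \<open>Jensen's inequality for \<open>exp\<close> at the points \<open>ln (a j)\<close>; a
  vanishing \<open>a j\<close> has no logarithm, but makes the left side zero.\<close>

lemma weighted_AM_GM: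
  fixes a w :: "'i \<Rightarrow> real"
  assumes J: "finite J" and a: "\<And>j. j \<in> J \<Longrightarrow> 0 \<le> a j" and w: "\<And>j. j \<in> J \<Longrightarrow> 0 \<le> w j"
    and sum: "sum w J = 1"
  shows "(\<Prod>j\<in>J. a j powr w j) \<le> (\<Sum>j\<in>J. w j * a j)"
proof (cases "\<exists>j\<in>J. a j = 0")
  case True
  then have "(\<Prod>j\<in>J. a j powr w j) = 0" using J by (auto intro!: prod_zero)
  also have "\<dots> \<le> (\<Sum>j\<in>J. w j * a j)" using a w by (intro sum_nonneg) auto
  finally show ?thesis .
next
  case False
  then have pos: "a j > 0" if "j \<in> J" for j using a that by (metis less_eq_real_def)
  have "(\<Prod>j\<in>J. a j powr w j) = (\<Prod>j\<in>J. exp (w j * ln (a j)))"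
    using False by (intro prod.cong) (auto simp: powr_def)
  also have "\<dots> = exp (\<Sum>j\<in>J. w j *\<^sub>R ln (a j))" by (simp add: exp_sum J)
  also have "\<dots> \<le> (\<Sum>j\<in>J. w j * exp (ln (a j)))"
    using J sum w by (intro convex_on_sum[where C = UNIV]) (auto intro: exp_convex)
  also have "\<dots> = (\<Sum>j\<in>J. w j * a j)" using pos by simp
  finally show ?thesis .
qed

text \<open>Weighted AM-GM for the ratios \<open>f j / I j\<close>, with the factors
  \<open>I j\<close> pulled out. When \<open>I j\<close> is the integral of \<open>f j\<close>,
  integrating the last sum gives the sum of the weights, hence Hoelder's inequality.\<close>

lemma epow_prod_le:
  fixes f I :: "'i \<Rightarrow> ennreal"
  assumes J: "finite J" and w: "\<And>j. j \<in> J \<Longrightarrow> 0 < w j" and sum: "sum w J = 1"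
    and I: "\<And>j. j \<in> J \<Longrightarrow> I j \<noteq> 0" "\<And>j. j \<in> J \<Longrightarrow> I j \<noteq> top"
  shows "(\<Prod>j\<in>J. epow (f j) (w j)) \<le> (\<Prod>j\<in>J. epow (I j) (w j)) * (\<Sum>j\<in>J. ennreal (w j) * (f j / I j))"
proof (cases "\<exists>j\<in>J. f j = top")
  case True
  then obtain k where k: "k \<in> J" "f k = top" by auto
  have "f k / I k = top" using k I by (simp add: ennreal_top_divide)
  then have "ennreal (w k) * (f k / I k) = top" using w[OF k(1)] by (simp add: ennreal_mult_top)
  then have "(\<Sum>j\<in>J. ennreal (w j) * (f j / I j)) = top" using k J by (simp add: sum.remove[of J k])
  moreover have "(\<Prod>j\<in>J. epow (I j) (w j)) \<noteq> 0" using J I epow_nonzero by (simp add: prod_zero_iff)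
  ultimately show ?thesis by (auto simp: ennreal_mult_top)
next
  case False
  define x where "x j = enn2real (f j)" for j
  define y where "y j = enn2real (I j)" for j
  have x: "0 \<le> x j" "f j = ennreal (x j)" if "j \<in> J" for j
    using False that by (auto simp: x_def less_top)
  have y: "0 < y j" "I j = ennreal (y j)" if "j \<in> J" for j
    using I that by (auto simp: y_def less_top enn2real_positive_iff zero_less_iff_neq_zero)
  have "(\<Prod>j\<in>J. epow (f j) (w j)) = ennreal (\<Prod>j\<in>J. x j powr w j)"
    using x w J by (subst prod_ennreal[symmetric]) (auto simp: epow_ennreal intro!: prod.cong)
  also have "(\<Prod>j\<in>J. x j powr w j) = (\<Prod>j\<in>J. y j powr w j * (x j / y j) powr w j)"
    using x y by (intro prod.cong refl) (subst powr_mult[symmetric], auto simp: less_imp_neq[symmetric])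
  also have "\<dots> = (\<Prod>j\<in>J. y j powr w j) * (\<Prod>j\<in>J. (x j / y j) powr w j)"
    by (rule prod.distrib)
  also have "ennreal \<dots> \<le> ennreal ((\<Prod>j\<in>J. y j powr w j) * (\<Sum>j\<in>J. w j * (x j / y j)))"
    using x y w J sum
    by (intro ennreal_leI mult_left_mono weighted_AM_GM prod_nonneg) (auto simp: less_imp_le)
  also have "\<dots> = ennreal (\<Prod>j\<in>J. y j powr w j) * ennreal (\<Sum>j\<in>J. w j * (x j / y j))"
    by (rule ennreal_mult) (auto intro!: prod_nonneg sum_nonneg simp: x y w less_imp_le)
  also have "ennreal (\<Prod>j\<in>J. y j powr w j) = (\<Prod>j\<in>J. epow (I j) (w j))"
    using y w J by (subst prod_ennreal[symmetric]) (auto simp: epow_ennreal less_imp_le intro!: prod.cong)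
  also have "ennreal (\<Sum>j\<in>J. w j * (x j / y j)) = (\<Sum>j\<in>J. ennreal (w j) * (f j / I j))"
    using x y w by (subst sum_ennreal[symmetric])
       (auto simp: divide_ennreal ennreal_mult[symmetric] less_imp_le intro!: sum.cong)
  finally show ?thesis .
qed

theorem Holder_nn_integral:
  fixes f :: "'i \<Rightarrow> 'a \<Rightarrow> ennreal"
  assumes J: "finite J" and w: "\<And>j. j \<in> J \<Longrightarrow> 0 \<le> w j" and sum: "sum w J = 1"
    and meas: "\<And>j. j \<in> J \<Longrightarrow> f j \<in> borel_measurable M"
  shows "(\<integral>\<^sup>+x. (\<Prod>j\<in>J. epow (f j x) (w j)) \<partial>M) \<le> (\<Prod>j\<in>J. epow (\<integral>\<^sup>+x. f j x \<partial>M) (w j))"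
proof -
  \<comment> \<open>Indices of weight zero give the factor 1 on both sides and are dropped, so that
    \<open>epow_zero\<close>, \<open>epow_top\<close> and \<open>epow_prod_le\<close> apply to the
    rest.\<close>
  define K where "K = {j \<in> J. w j \<noteq> 0}"
  have K: "finite K" "\<And>j. j \<in> K \<Longrightarrow> 0 < w j" "K \<subseteq> J" using J w by (auto simp: K_def less_le)
  have sumK: "sum w K = 1"
    using sum J by (subst sum.mono_neutral_left[of J K w]) (auto simp: K_def)
  have red: "(\<Prod>j\<in>J. epow (g j) (w j)) = (\<Prod>j\<in>K. epow (g j) (w j))" for g :: "'i \<Rightarrow> ennreal"
    using J by (intro prod.mono_neutral_right) (auto simp: K_def)
  have m [measurable]: "\<And>j. j \<in> K \<Longrightarrow> f j \<in> borel_measurable M" using meas K by auto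
  define I where "I j = (\<integral>\<^sup>+x. f j x \<partial>M)" for j
  have "(\<integral>\<^sup>+x. (\<Prod>j\<in>K. epow (f j x) (w j)) \<partial>M) \<le> (\<Prod>j\<in>K. epow (I j) (w j))"
  \<comment> \<open>Zero integrals come before infinite ones: a vanishing integral makes the
    integrand zero almost everywhere, whereas an infinite one makes the bound infinite only if no
    other factor is zero.\<close>
  proof (cases "\<exists>j\<in>K. I j = 0")
    case True
    then obtain k where k: "k \<in> K" "I k = 0" by auto
    have "AE x in M. f k x = 0" using k by (simp add: I_def nn_integral_0_iff_AE)
    then have "AE x in M. (\<Prod>j\<in>K. epow (f j x) (w j)) = 0"
      by eventually_elim (use k K in \<open>auto intro!: prod_zero bexI[of _ k] simp: epow_zero\<close>)
    then have "(\<integral>\<^sup>+x. (\<Prod>j\<in>K. epow (f j x) (w j)) \<partial>M) = (\<integral>\<^sup>+x. 0 \<partial>M)"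
      by (rule nn_integral_cong_AE)
    then show ?thesis by simp
  next
    case nz: False
    show ?thesis
    proof (cases "\<exists>j\<in>K. I j = top")
      case True
      then obtain k where k: "k \<in> K" "I k = top" by auto
      have "(\<Prod>j\<in>K. epow (I j) (w j)) = epow (I k) (w k) * (\<Prod>j\<in>K - {k}. epow (I j) (w j))"
        using K k by (simp add: prod.remove)
      moreover have "(\<Prod>j\<in>K - {k}. epow (I j) (w j)) \<noteq> 0"
        using K nz epow_nonzero by (auto simp: prod_zero_iff)
      ultimately show ?thesis using k K by (simp add: epow_top ennreal_top_mult)
    next
      case False
      let ?P = "\<Prod>j\<in>K. epow (I j) (w j)"
      have "(\<integral>\<^sup>+x. (\<Prod>j\<in>K. epow (f j x) (w j)) \<partial>M)
          \<le> (\<integral>\<^sup>+x. ?P * (\<Sum>j\<in>K. ennreal (w j) * (f j x / I j)) \<partial>M)"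
        using K sumK nz False by (intro nn_integral_mono epow_prod_le) auto
      also have "\<dots> = ?P * (\<Sum>j\<in>K. ennreal (w j) * (I j / I j))"
        by (simp add: nn_integral_cmult nn_integral_sum nn_integral_divide I_def)
      also have "(\<Sum>j\<in>K. ennreal (w j) * (I j / I j)) = (\<Sum>j\<in>K. ennreal (w j))"
        using nz False by (intro sum.cong) (auto simp: ennreal_divide_self less_top zero_less_iff_neq_zero)
      also have "\<dots> = 1" using sumK K by (subst sum_ennreal) (auto simp: less_imp_le)
      finally show ?thesis by simp
    qed
  qed
  then show ?thesis by (simp add: red I_def)
qed

section \<open>The grid-lines inequality\<close>

text \<open>The induction integrates out one direction at a time by Hoelder's
  inequality and replaces \<open>f\<close> by its marginal.\<close>

lemma nn_integral_grid_lines: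
  fixes f :: "('i \<Rightarrow> real) \<Rightarrow> ennreal"
  assumes "finite s" "0 \<le> p" "(real (card s) - 1) * p \<le> 1"
    and "f \<in> borel_measurable (Pi\<^sub>M s (\<lambda>_. lborel))"
  shows "(\<integral>\<^sup>+x. epow (f x) (1 - (real (card s) - 1) * p) *
            (\<Prod>i\<in>s. epow (\<integral>\<^sup>+t. f (x(i := t)) \<partial>lborel) p) \<partial>Pi\<^sub>M s (\<lambda>_. lborel))
         \<le> epow (\<integral>\<^sup>+x. f x \<partial>Pi\<^sub>M s (\<lambda>_. lborel)) (1 + p)"
  using assms
proof (induction s arbitrary: f rule: finite_induct)
  case empty
  interpret product_sigma_finite "\<lambda>_::'i. lborel :: real measure" by standard
  show ?case using empty by (simp add: PiM_empty nn_integral_count_space_finite)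
next
  case (insert i s)
  interpret product_sigma_finite "\<lambda>_::'i. lborel :: real measure" by standard
  note [measurable] = insert.prems(3)
  note fin = \<open>finite s\<close> and i = \<open>i \<notin> s\<close>
  let ?P = "Pi\<^sub>M s (\<lambda>_. lborel :: real measure)"
  let ?Q = "Pi\<^sub>M (insert i s) (\<lambda>_. lborel :: real measure)"
  define g where "g x = (\<integral>\<^sup>+t. f (x(i := t)) \<partial>lborel)" for x
  define h where "h j x = (\<integral>\<^sup>+t. f (x(j := t)) \<partial>lborel)" for j x
  have card: "real (card (insert i s)) - 1 = real (card s)" using fin i by simp
  have p: "0 \<le> p" "real (card s) * p \<le> 1" using insert.prems card by auto
  have upd: "(\<lambda>(x, t). x(i := t)) \<in> measurable (?P \<Otimes>\<^sub>M lborel) ?Q" by measurable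
  have g [measurable]: "g \<in> borel_measurable ?P"
    unfolding g_def by measurable
  have updj: "(\<lambda>(x, t). x(j := t)) \<in> measurable (?Q \<Otimes>\<^sub>M lborel) ?Q" if "j \<in> insert i s" for j
    by (rule measurable_PiM_single') (use that in \<open>auto simp: space_PiM space_pair_measure PiE_iff extensional_def split: if_splits\<close>)
  have h [measurable]: "h j \<in> borel_measurable ?Q" if "j \<in> insert i s" for j
  proof -
    have "(\<lambda>(x, t). f (x(j := t))) \<in> borel_measurable (?Q \<Otimes>\<^sub>M lborel)"
      using measurable_compose[OF updj[OF that] insert.prems(3)] by (simp add: case_prod_beta' fun_upd_def)
    then show ?thesis unfolding h_def by measurable
  qed
  let ?w = "1 - real (card s) * p"
  \<comment> \<open>For fixed \<open>x\<close> the line integral in direction \<open>i\<close> is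
    constant in \<open>t\<close>; the other factors carry the weight \<open>1 - card s * p\<close>
    once and \<open>p\<close> for each \<open>j\<close> in \<open>s\<close>, adding up to 1, so
    Hoelder's inequality in the single variable \<open>t\<close> applies.\<close>
  have inner: "(\<integral>\<^sup>+t. epow (f (x(i := t))) ?w * (\<Prod>j\<in>insert i s. epow (h j (x(i := t))) p) \<partial>lborel)
      \<le> epow (g x) (1 - (real (card s) - 1) * p) * (\<Prod>j\<in>s. epow (\<integral>\<^sup>+t. g (x(j := t)) \<partial>lborel) p)"
    if x: "x \<in> space ?P" for x
  proof -
    have mx: "(\<lambda>t. x(i := t)) \<in> measurable lborel ?Q"
      using measurable_component_update[OF x i] by simp
    have [measurable]: "(\<lambda>t. f (x(i := t))) \<in> borel_measurable lborel"
      using measurable_compose[OF mx insert.prems(3)] by (simp add: fun_upd_def)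
    have hm [measurable]: "(\<lambda>t. h j (x(i := t))) \<in> borel_measurable lborel" if "j \<in> s" for j
      using measurable_compose[OF mx h[of j]] that by (simp add: fun_upd_def)
    define F where "F j t = (if j = i then f (x(i := t)) else h j (x(i := t)))" for j t
    have Fm: "F j \<in> borel_measurable lborel" if "j \<in> insert i s" for j
      using that hm[of j] by (cases "j = i") (auto simp: F_def[abs_def])
    have Fi: "(\<integral>\<^sup>+t. F i t \<partial>lborel) = g x" unfolding F_def g_def by simp
    define w where "w j = (if j = i then ?w else p)" for j
    have ws: "sum w (insert i s) = 1"
    proof -
      have "sum w s = (\<Sum>j\<in>s. p)" using i by (intro sum.cong) (auto simp: w_def)
      then show ?thesis using fin i by (simp add: w_def)
    qed
    have prodF: "(\<Prod>j\<in>insert i s. epow (G j) (w j)) = epow (G i) ?w * (\<Prod>j\<in>s. epow (G j) p)" for G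
    proof -
      have "(\<Prod>j\<in>s. epow (G j) (w j)) = (\<Prod>j\<in>s. epow (G j) p)" using i by (intro prod.cong) (auto simp: w_def)
      then show ?thesis using fin i by (simp add: w_def)
    qed
    \<comment> \<open>Tonelli: integrating the line integral in direction \<open>j\<close> over
      \<open>t\<close> gives the line integral of the marginal \<open>g\<close>.\<close>
    have swap: "(\<integral>\<^sup>+t. h j (x(i := t)) \<partial>lborel) = (\<integral>\<^sup>+t. g (x(j := t)) \<partial>lborel)" if j: "j \<in> s" for j
    proof -
      have ij: "i \<noteq> j" using i j by auto
      have "(\<lambda>(t, r). (x(i := t))(j := r)) \<in> measurable (lborel \<Otimes>\<^sub>M lborel) ?Q"
      proof (rule measurable_PiM_single')
        fix k assume "k \<in> insert i s"
        show "(\<lambda>\<omega>. (case \<omega> of (t, r) \<Rightarrow> x(i := t, j := r)) k) \<in> measurable (lborel \<Otimes>\<^sub>M lborel) lborel"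
          by (cases "k = j"; cases "k = i") (auto simp: case_prod_beta')
      qed (use x j in \<open>auto simp: space_PiM PiE_iff extensional_def split: if_splits\<close>)
      from measurable_compose[OF this insert.prems(3)]
      have m: "(\<lambda>(t, r). f ((x(i := t))(j := r))) \<in> borel_measurable (lborel \<Otimes>\<^sub>M lborel)"
        by (simp add: case_prod_beta' fun_upd_def)
      have "(\<integral>\<^sup>+t. h j (x(i := t)) \<partial>lborel) = (\<integral>\<^sup>+t. \<integral>\<^sup>+r. f ((x(i := t))(j := r)) \<partial>lborel \<partial>lborel)"
        by (simp add: h_def)
      also have "\<dots> = (\<integral>\<^sup>+r. \<integral>\<^sup>+t. f ((x(i := t))(j := r)) \<partial>lborel \<partial>lborel)"
        using m by (rule lborel_pair.Fubini'[symmetric])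
      also have "\<dots> = (\<integral>\<^sup>+r. g (x(j := r)) \<partial>lborel)"
        using ij by (simp add: g_def fun_upd_twist)
      finally show ?thesis .
    qed
    have hi: "h i (x(i := t)) = g x" for t by (simp add: h_def g_def)
    have "(\<integral>\<^sup>+t. epow (f (x(i := t))) ?w * (\<Prod>j\<in>insert i s. epow (h j (x(i := t))) p) \<partial>lborel)
        = (\<integral>\<^sup>+t. epow (g x) p * (\<Prod>j\<in>insert i s. epow (F j t) (w j)) \<partial>lborel)"
    proof (rule nn_integral_cong)
      fix t
      have "(\<Prod>j\<in>s. epow (F j t) p) = (\<Prod>j\<in>s. epow (h j (x(i := t))) p)"
        using i by (intro prod.cong) (auto simp: F_def)
      then show "epow (f (x(i := t))) ?w * (\<Prod>j\<in>insert i s. epow (h j (x(i := t))) p)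
         = epow (g x) p * (\<Prod>j\<in>insert i s. epow (F j t) (w j))"
        unfolding prodF using fin i by (simp add: hi F_def mult_ac)
    qed
    also have "\<dots> = epow (g x) p * (\<integral>\<^sup>+t. (\<Prod>j\<in>insert i s. epow (F j t) (w j)) \<partial>lborel)"
      by (intro nn_integral_cmult borel_measurable_prod_ennreal borel_measurable_epow Fm)
    also have "\<dots> \<le> epow (g x) p * (\<Prod>j\<in>insert i s. epow (\<integral>\<^sup>+t. F j t \<partial>lborel) (w j))"
      using fin p ws i by (intro mult_left_mono Holder_nn_integral Fm) (auto simp: w_def)
    also have "\<dots> = epow (g x) p * (epow (g x) ?w * (\<Prod>j\<in>s. epow (\<integral>\<^sup>+t. F j t \<partial>lborel) p))"
      by (simp only: prodF Fi)
    also have "(\<Prod>j\<in>s. epow (\<integral>\<^sup>+t. F j t \<partial>lborel) p) = (\<Prod>j\<in>s. epow (\<integral>\<^sup>+t. g (x(j := t)) \<partial>lborel) p)"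
    proof (rule prod.cong)
      fix j assume j: "j \<in> s"
      then have "F j = (\<lambda>t. h j (x(i := t)))" using i by (auto simp: F_def fun_eq_iff)
      then show "epow (\<integral>\<^sup>+t. F j t \<partial>lborel) p = epow (\<integral>\<^sup>+t. g (x(j := t)) \<partial>lborel) p"
        using swap[OF j] by simp
    qed simp
    also have "epow (g x) p * (epow (g x) ?w * (\<Prod>j\<in>s. epow (\<integral>\<^sup>+t. g (x(j := t)) \<partial>lborel) p))
        = epow (g x) (p + ?w) * (\<Prod>j\<in>s. epow (\<integral>\<^sup>+t. g (x(j := t)) \<partial>lborel) p)"
      using p by (subst epow_add) (auto simp: mult_ac)
    \<comment> \<open>The constant factor \<open>epow (g x) p\<close> raises the exponent of
      \<open>g x\<close> to exactly the one that the induction hypothesis for \<open>s\<close> asks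
      for.\<close>
    also have "p + ?w = 1 - (real (card s) - 1) * p" by (simp add: algebra_simps)
    finally show ?thesis .
  qed
  have "(\<integral>\<^sup>+x. epow (f x) (1 - (real (card (insert i s)) - 1) * p) *
            (\<Prod>j\<in>insert i s. epow (\<integral>\<^sup>+t. f (x(j := t)) \<partial>lborel) p) \<partial>?Q)
      = (\<integral>\<^sup>+x. epow (f x) ?w * (\<Prod>j\<in>insert i s. epow (h j x) p) \<partial>?Q)"
    by (simp only: card h_def)
  also have "\<dots> = (\<integral>\<^sup>+x. \<integral>\<^sup>+t. epow (f (x(i := t))) ?w * (\<Prod>j\<in>insert i s. epow (h j (x(i := t))) p) \<partial>lborel \<partial>?P)"
    by (rule product_nn_integral_insert[OF fin i]) measurable
  also have "\<dots> \<le> (\<integral>\<^sup>+x. epow (g x) (1 - (real (card s) - 1) * p) * (\<Prod>j\<in>s. epow (\<integral>\<^sup>+t. g (x(j := t)) \<partial>lborel) p) \<partial>?P)"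
    by (rule nn_integral_mono) (rule inner)
  also have "\<dots> \<le> epow (\<integral>\<^sup>+x. g x \<partial>?P) (1 + p)"
    by (rule insert.IH) (use p g in \<open>auto simp: algebra_simps\<close>)
  also have "(\<integral>\<^sup>+x. g x \<partial>?P) = (\<integral>\<^sup>+x. f x \<partial>?Q)"
    unfolding g_def by (rule product_nn_integral_insert[OF fin i, symmetric]) (rule insert.prems(3))
  finally show ?case .
qed

text \<open>With \<open>d\<close> the dimension, the choice \<open>p = 1 / (d - 1)\<close> makes the
  exponent of the function itself vanish in the grid-lines inequality and leaves the product of the
  \<open>d\<close> line integrals; since \<open>d * p = 1 + p\<close>, the power of \<open>V\<close>
  splits into one factor per direction.\<close>

lemma nn_integral_grid_lines_lborel:
  fixes F V :: "'a::euclidean_space \<Rightarrow> ennreal"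
  assumes F: "F \<in> borel_measurable borel" and V: "V \<in> borel_measurable borel" and dim: "2 \<le> DIM('a)"
    and le: "\<And>x b. b \<in> Basis \<Longrightarrow> V x \<le> (\<integral>\<^sup>+t. F (x + t *\<^sub>R b) \<partial>lborel)"
  shows "(\<integral>\<^sup>+x. epow (V x) (real DIM('a) / (real DIM('a) - 1)) \<partial>lborel)
           \<le> epow (\<integral>\<^sup>+x. F x \<partial>lborel) (real DIM('a) / (real DIM('a) - 1))"
proof -
  interpret product_sigma_finite "\<lambda>_::'a. lborel :: real measure" by standard
  note [measurable] = F V
  let ?d = "real DIM('a)"
  let ?P = "Pi\<^sub>M (Basis :: 'a set) (\<lambda>_. lborel :: real measure)"
  define p where "p = 1 / (?d - 1)"
  have p: "0 < p" "(?d - 1) * p = 1" using dim by (auto simp: p_def)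
  define E where "E x = (\<Sum>b\<in>Basis. x b *\<^sub>R b)" for x :: "'a \<Rightarrow> real"
  have E [measurable]: "E \<in> measurable ?P borel" unfolding E_def by measurable
  have tr: "(\<integral>\<^sup>+x. G x \<partial>lborel) = (\<integral>\<^sup>+x. G (E x) \<partial>?P)" if "G \<in> borel_measurable borel" for G :: "'a \<Rightarrow> ennreal"
    using that by (subst lborel_eq) (simp add: nn_integral_distr E_def[symmetric])
  have Eupd: "E (x(b := t)) = E x + (t - x b) *\<^sub>R b" if b: "b \<in> Basis" for x b t
  proof -
    have "E (x(b := t)) = t *\<^sub>R b + (\<Sum>c\<in>Basis - {b}. x c *\<^sub>R c)"
      using b by (simp add: E_def sum.remove[of _ b])
    moreover have "E x = x b *\<^sub>R b + (\<Sum>c\<in>Basis - {b}. x c *\<^sub>R c)"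
      using b by (simp add: E_def sum.remove[of _ b])
    ultimately show ?thesis by (simp add: algebra_simps)
  qed
  have line: "(\<integral>\<^sup>+t. F (E (x(b := t))) \<partial>lborel) = (\<integral>\<^sup>+t. F (E x + t *\<^sub>R b) \<partial>lborel)" if b: "b \<in> Basis" for x b
    using nn_integral_real_affine[of "\<lambda>t. F (E (x(b := t)))" 1 "x b"] b by (simp add: Eupd)
  have e: "?d / (?d - 1) = 1 + p" "?d * p = 1 + p"
    using dim by (auto simp: p_def field_simps of_nat_diff)
  have "(\<integral>\<^sup>+x. epow (V x) (real DIM('a) / (real DIM('a) - 1)) \<partial>lborel)
      = (\<integral>\<^sup>+x. epow (V x) (1 + p) \<partial>lborel)"
    by (simp only: e)
  also have "\<dots> = (\<integral>\<^sup>+x. epow (V (E x)) (1 + p) \<partial>?P)"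
    by (rule tr) measurable
  also have "\<dots> = (\<integral>\<^sup>+x. (\<Prod>b\<in>(Basis :: 'a set). epow (V (E x)) p) \<partial>?P)"
    using p by (subst epow_prod_const) (auto simp: e)
  also have "\<dots> \<le> (\<integral>\<^sup>+x. (\<Prod>b\<in>(Basis :: 'a set). epow (\<integral>\<^sup>+t. F (E (x(b := t))) \<partial>lborel) p) \<partial>?P)"
    using le p by (intro nn_integral_mono prod_mono_ennreal) (auto simp: line intro!: epow_mono)
  also have "\<dots> = (\<integral>\<^sup>+x. epow (F (E x)) (1 - (?d - 1) * p) *
      (\<Prod>b\<in>(Basis :: 'a set). epow (\<integral>\<^sup>+t. F (E (x(b := t))) \<partial>lborel) p) \<partial>?P)"
    using p by simp
  also have "\<dots> \<le> epow (\<integral>\<^sup>+x. F (E x) \<partial>?P) (1 + p)"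
    using p by (intro nn_integral_grid_lines) auto
  also have "(\<integral>\<^sup>+x. F (E x) \<partial>?P) = (\<integral>\<^sup>+x. F x \<partial>lborel)" by (rule tr[symmetric]) measurable
  finally show ?thesis by (simp only: e)
qed

section \<open>Test functions\<close>

lemma frechet_derivative_lin:
  fixes f g :: "'a::real_normed_vector \<Rightarrow> real"
  assumes "f differentiable (at x)" "g differentiable (at x)"
  shows "frechet_derivative (\<lambda>x. f x + r * g x) (at x) v
          = frechet_derivative f (at x) v + r * frechet_derivative g (at x) v"
proof -
  have "((\<lambda>x. f x + r * g x) has_derivative
      (\<lambda>v. frechet_derivative f (at x) v + r * frechet_derivative g (at x) v)) (at x)"
    using assms unfolding frechet_derivative_works by (auto intro!: derivative_eq_intros)
  from fun_cong[OF frechet_derivative_at[OF this], of v] show ?thesis by simp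
qed

text \<open>The factor 1 gives the right side the shape \<open>f + r * g\<close>, on which
  \<open>iter_deriv_lin\<close> works.\<close>

lemma frechet_derivative_mult:
  fixes f g :: "'a::real_normed_vector \<Rightarrow> real"
  assumes "f differentiable (at x)" "g differentiable (at x)"
  shows "frechet_derivative (\<lambda>x. f x * g x) (at x) v
          = f x * frechet_derivative g (at x) v + 1 * (frechet_derivative f (at x) v * g x)"
proof -
  have "((\<lambda>x. f x * g x) has_derivative
      (\<lambda>v. f x * frechet_derivative g (at x) v + 1 * (frechet_derivative f (at x) v * g x))) (at x)"
    using assms unfolding frechet_derivative_works by (auto intro!: derivative_eq_intros)
  from fun_cong[OF frechet_derivative_at[OF this], of v] show ?thesis by simp
qed

lemma differentiable_lin:
  fixes f g :: "'a::real_normed_vector \<Rightarrow> real"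
  assumes "f differentiable (at x)" "g differentiable (at x)"
  shows "(\<lambda>x. f x + r * g x) differentiable (at x)"
  using assms by (intro derivative_intros) auto

lemma iter_deriv_append: "iter_deriv (vs @ ws) f = iter_deriv vs (iter_deriv ws f)"
  by (induction vs) auto

text \<open>Differentiability is assumed only up to orders below \<open>n\<close>, so the lemma can
  be used inside an induction on the order, before smoothness is known.\<close>

lemma iter_deriv_lin:
  assumes "\<And>vs x. length vs < n \<Longrightarrow> iter_deriv vs f differentiable (at x)"
    and "\<And>vs x. length vs < n \<Longrightarrow> iter_deriv vs g differentiable (at x)"
    and "length vs \<le> n"
  shows "iter_deriv vs (\<lambda>x. f x + r * g x) = (\<lambda>x. iter_deriv vs f x + r * iter_deriv vs g x)"
  using assms(3)
proof (induction vs)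
  case (Cons v vs)
  then show ?case using assms(1,2) by (auto simp: frechet_derivative_lin)
qed simp

lemma smooth_fun_differentiable: "smooth_fun f \<Longrightarrow> f differentiable (at x)"
  unfolding smooth_fun_def by (metis iter_deriv.simps(1))

lemma smooth_fun_deriv: "smooth_fun f \<Longrightarrow> smooth_fun (\<lambda>x. frechet_derivative f (at x) v)"
  unfolding smooth_fun_def
proof (intro allI)
  fix vs x assume "\<forall>vs x. iter_deriv vs f differentiable (at x)"
  moreover have "iter_deriv vs (\<lambda>x. frechet_derivative f (at x) v) = iter_deriv (vs @ [v]) f"
    by (simp add: iter_deriv_append)
  ultimately show "iter_deriv vs (\<lambda>x. frechet_derivative f (at x) v) differentiable (at x)" by simp
qed

lemma smooth_fun_lin:
  assumes "smooth_fun f" "smooth_fun g"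
  shows "smooth_fun (\<lambda>x. f x + r * g x)"
  unfolding smooth_fun_def
proof (intro allI)
  fix vs x
  have "iter_deriv vs (\<lambda>x. f x + r * g x) = (\<lambda>x. iter_deriv vs f x + r * iter_deriv vs g x)"
    using assms by (intro iter_deriv_lin[of "length vs"]) (auto simp: smooth_fun_def)
  then show "iter_deriv vs (\<lambda>x. f x + r * g x) differentiable (at x)"
    using assms by (simp add: smooth_fun_def differentiable_lin)
qed

text \<open>Induction on the order for all pairs of smooth functions at once: the innermost
  derivative, the last entry of the list, turns the product into a sum of two products with one
  derivative fewer to take.\<close>

lemma smooth_fun_mult:
  assumes "smooth_fun f" "smooth_fun g"
  shows "smooth_fun (\<lambda>x. f x * g x)"
proof -
  have "iter_deriv vs (\<lambda>x. f x * g x) differentiable (at x)"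
    if "smooth_fun f" "smooth_fun g" "length vs \<le> n" for n f g vs x
    using that
  proof (induction n arbitrary: f g vs x)
    case 0
    then show ?case using smooth_fun_differentiable by (auto intro!: differentiable_mult)
  next
    case (Suc n)
    show ?case
    proof (cases vs rule: rev_cases)
      case Nil
      then show ?thesis using Suc.prems smooth_fun_differentiable by (auto intro!: differentiable_mult)
    next
      case (snoc ws v)
      let ?f = "\<lambda>x. frechet_derivative f (at x) v" and ?g = "\<lambda>x. frechet_derivative g (at x) v"
      have ws: "length ws \<le> n" using snoc Suc.prems by simp
      have IH: "iter_deriv us (\<lambda>x. f x * ?g x) differentiable (at x)"
        "iter_deriv us (\<lambda>x. ?f x * g x) differentiable (at x)" if "length us \<le> n" for us x
        using Suc.IH[OF _ _ that] Suc.prems smooth_fun_deriv by blast+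
      have "iter_deriv vs (\<lambda>x. f x * g x) = iter_deriv ws (\<lambda>x. f x * ?g x + 1 * (?f x * g x))"
        using Suc.prems by (simp add: snoc iter_deriv_append frechet_derivative_mult smooth_fun_differentiable)
      also have "\<dots> = (\<lambda>x. iter_deriv ws (\<lambda>x. f x * ?g x) x + 1 * iter_deriv ws (\<lambda>x. ?f x * g x) x)"
        using ws IH by (intro iter_deriv_lin[of n]) auto
      finally show ?thesis using IH[OF ws] by (simp only: differentiable_lin)
    qed
  qed
  then show ?thesis using assms unfolding smooth_fun_def by blast
qed

lemma smooth_fun_const: "smooth_fun (\<lambda>_::real^'n. c)"
proof -
  have "\<exists>k. iter_deriv vs (\<lambda>_. c) = (\<lambda>_::real^'n. k)" for vs
    by (induction vs) auto
  then have "iter_deriv vs (\<lambda>_. c) differentiable (at x)" for vs and x :: "real^'n"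
    by (metis differentiable_const)
  then show ?thesis by (simp add: smooth_fun_def)
qed

lemma smooth_fun_continuous: "smooth_fun f \<Longrightarrow> continuous_on S f"
  by (intro continuous_at_imp_continuous_on ballI differentiable_imp_continuous_within smooth_fun_differentiable)

section \<open>Closure properties of test functions\<close>

lemma test_fun_smooth: "test_fun U \<psi> \<Longrightarrow> smooth_fun \<psi>"
  by (simp add: test_fun_def)

lemma test_funI:
  assumes "smooth_fun \<psi>" "compact K" "K \<subseteq> U" "\<And>x. x \<notin> K \<Longrightarrow> \<psi> x = 0"
  shows "test_fun U \<psi>"
proof -
  have "closure {x. \<psi> x \<noteq> 0} \<subseteq> K"
    using assms by (intro closure_minimal) (auto simp: compact_imp_closed)
  moreover from this have "compact (closure {x. \<psi> x \<noteq> 0})"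
    using assms(2) by (meson bounded_subset closed_closure compact_eq_bounded_closed)
  ultimately show ?thesis using assms unfolding test_fun_def by blast
qed

lemma test_funE:
  assumes "test_fun U \<psi>"
  obtains K where "compact K" "K \<subseteq> U" "\<And>x. x \<notin> K \<Longrightarrow> \<psi> x = 0"
    "\<And>x v. x \<notin> K \<Longrightarrow> frechet_derivative \<psi> (at x) v = 0"
proof
  let ?K = "closure {x. \<psi> x \<noteq> 0}"
  show "compact ?K" "?K \<subseteq> U" using assms by (auto simp: test_fun_def)
  show z: "\<psi> x = 0" if "x \<notin> ?K" for x
    using that closure_subset[of "{x. \<psi> x \<noteq> 0}"] by blast
  show "frechet_derivative \<psi> (at x) v = 0" if "x \<notin> ?K" for x v
  proof -
    have "((\<lambda>_. 0) has_derivative (\<lambda>_. 0)) (at x)" by simp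
    then have "(\<psi> has_derivative (\<lambda>_. 0)) (at x)"
    proof (rule has_derivative_transform_within_open)
      show "open (- ?K)" "x \<in> - ?K" using that by auto
      show "0 = \<psi> y" if "y \<in> - ?K" for y using z[of y] that by simp
    qed
    from fun_cong[OF frechet_derivative_at[OF this], of v] show ?thesis by simp
  qed
qed

lemma test_fun_lin:
  assumes "test_fun U f" "test_fun U g"
  shows "test_fun U (\<lambda>x. f x + r * g x)"
proof -
  obtain K where K: "compact K" "K \<subseteq> U" "\<And>x. x \<notin> K \<Longrightarrow> f x = 0" by (rule test_funE[OF assms(1)]) (rule that)
  obtain L where L: "compact L" "L \<subseteq> U" "\<And>x. x \<notin> L \<Longrightarrow> g x = 0" by (rule test_funE[OF assms(2)]) (rule that)
  show ?thesis
    using K L smooth_fun_lin[OF test_fun_smooth[OF assms(1)] test_fun_smooth[OF assms(2)]]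
    by (intro test_funI[of _ "K \<union> L"]) auto
qed

lemma test_fun_mult_smooth:
  assumes "test_fun U f" "smooth_fun g"
  shows "test_fun U (\<lambda>x. f x * g x)"
proof -
  obtain K where K: "compact K" "K \<subseteq> U" "\<And>x. x \<notin> K \<Longrightarrow> f x = 0" by (rule test_funE[OF assms(1)]) (rule that)
  show ?thesis
    using K smooth_fun_mult[OF test_fun_smooth[OF assms(1)] assms(2)]
    by (intro test_funI[of _ K]) auto
qed

lemma test_fun_mult: "test_fun U f \<Longrightarrow> test_fun U g \<Longrightarrow> test_fun U (\<lambda>x. f x * g x)"
  by (intro test_fun_mult_smooth test_fun_smooth)

lemma test_fun_zero: "test_fun U (\<lambda>_. 0)"
  using smooth_fun_const by (intro test_funI[of _ "{}"]) auto

lemma test_fun_scale: "test_fun U f \<Longrightarrow> test_fun U (\<lambda>x. r * f x)"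
  using test_fun_lin[OF test_fun_zero, of U f r] by simp

lemma test_fun_pderiv:
  assumes "test_fun U f"
  shows "test_fun U (pderiv_i i f)"
proof -
  obtain K where K: "compact K" "K \<subseteq> U" "\<And>x v. x \<notin> K \<Longrightarrow> frechet_derivative f (at x) v = 0"
    by (rule test_funE[OF assms]) (rule that)
  have "smooth_fun (pderiv_i i f)"
    using smooth_fun_deriv[OF test_fun_smooth[OF assms], of "axis i 1"] by (simp add: pderiv_i_def[abs_def])
  then show ?thesis by (rule test_funI[of _ K]) (use K in \<open>auto simp: pderiv_i_def\<close>)
qed

text \<open>Powers start at 1: without a constant term the polynomial vanishes wherever
  \<open>f\<close> does, so the compact support survives.\<close>

lemma test_fun_poly:
  fixes c :: "nat \<Rightarrow> real"
  assumes "test_fun U f"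
  shows "test_fun U (\<lambda>x. \<Sum>i\<le>n. c i * f x ^ Suc i)"
proof -
  have pow: "test_fun U (\<lambda>x. f x ^ Suc i)" for i
    using assms by (induction i) (simp_all add: test_fun_mult)
  show ?thesis
  proof (induction n)
    case 0
    show ?case using test_fun_scale[OF pow, of "c 0" 0] by simp
  next
    case (Suc n)
    show ?case using test_fun_lin[OF Suc pow, of "c (Suc n)" "Suc n"] by simp
  qed
qed

section \<open>Gradients of test functions\<close>

lemma test_fun_has_derivative:
  assumes "test_fun U f"
  shows "(f has_derivative (\<lambda>h. grad f x \<bullet> h)) (at x)"
proof -
  have d: "(f has_derivative frechet_derivative f (at x)) (at x)"
    using smooth_fun_differentiable[OF test_fun_smooth[OF assms]] by (simp add: frechet_derivative_works)
  then have lin: "linear (frechet_derivative f (at x))" by (rule has_derivative_linear)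
  have "frechet_derivative f (at x) h = grad f x \<bullet> h" for h
  proof -
    have "frechet_derivative f (at x) h = frechet_derivative f (at x) (\<Sum>i\<in>UNIV. h $ i *\<^sub>R axis i 1)"
      by (simp add: basis_expansion scalar_mult_eq_scaleR[symmetric])
    also have "\<dots> = (\<Sum>i\<in>UNIV. h $ i * grad f x $ i)"
      using lin by (simp add: linear_sum linear_scale grad_def pderiv_i_def)
    finally show ?thesis by (simp add: inner_vec_def mult.commute)
  qed
  then have "frechet_derivative f (at x) = (\<lambda>h. grad f x \<bullet> h)" by auto
  with d show ?thesis by simp
qed

lemma grad_eqI:
  assumes "(f has_derivative (\<lambda>h. w \<bullet> h)) (at x)"
  shows "grad f x = w"
  using frechet_derivative_at[OF assms, symmetric]
  by (simp add: grad_def pderiv_i_def inner_axis vec_eq_iff)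

lemma grad_lin:
  assumes "test_fun U f" "test_fun U g"
  shows "grad (\<lambda>x. f x + r * g x) x = grad f x + r *\<^sub>R grad g x"
  using has_derivative_add[OF test_fun_has_derivative[OF assms(1), of x]
      has_derivative_mult_right[OF test_fun_has_derivative[OF assms(2), of x], of r]]
  by (intro grad_eqI) (simp add: inner_add_left)

lemma grad_zero: "grad (\<lambda>_. 0) x = 0"
  by (rule grad_eqI) simp

lemma grad_compose:
  assumes "test_fun U f" "(T has_real_derivative D) (at (f x))"
  shows "grad (\<lambda>x. T (f x)) x = D *\<^sub>R grad f x"
proof (rule grad_eqI)
  have "(T has_derivative (\<lambda>h. D * h)) (at (f x))" using assms(2) by (simp add: has_field_derivative_def)
  from has_derivative_compose[OF test_fun_has_derivative[OF assms(1)] this]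
  show "((\<lambda>x. T (f x)) has_derivative (\<lambda>h. (D *\<^sub>R grad f x) \<bullet> h)) (at x)" by simp
qed

lemma test_fun_outside: "test_fun U f \<Longrightarrow> x \<notin> U \<Longrightarrow> f x = 0"
  by (erule test_funE) (metis subsetD)

lemma grad_outside: "test_fun U f \<Longrightarrow> x \<notin> U \<Longrightarrow> grad f x = 0"
  using test_fun_outside[OF test_fun_pderiv, of U f x] by (simp add: grad_def vec_eq_iff)

lemma test_fun_continuous: "test_fun U f \<Longrightarrow> continuous_on S f"
  by (intro smooth_fun_continuous test_fun_smooth)

lemma grad_continuous: "test_fun U f \<Longrightarrow> continuous_on S (grad f)"
  unfolding grad_def[abs_def]
  by (rule continuous_on_vec_lambda) (rule test_fun_continuous[OF test_fun_pderiv])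

lemma test_fun_measurable: "test_fun U f \<Longrightarrow> f \<in> borel_measurable borel"
  by (intro borel_measurable_continuous_onI test_fun_continuous)

lemma grad_measurable: "test_fun U f \<Longrightarrow> grad f \<in> borel_measurable borel"
  by (intro borel_measurable_continuous_onI grad_continuous)

section \<open>Bounds, integrability and integration by parts\<close>

lemma integrable_continuous_compact_support:
  fixes g :: "'a::euclidean_space \<Rightarrow> 'b::{banach, second_countable_topology}"
  assumes "continuous_on UNIV g" "compact K" "\<And>x. x \<notin> K \<Longrightarrow> g x = 0"
  shows "integrable lborel g"
proof -
  have "integrable lborel (\<lambda>x. indicator K x *\<^sub>R g x)"
    using assms by (intro borel_integrable_compact) (auto intro: continuous_on_subset)
  also have "(\<lambda>x. indicator K x *\<^sub>R g x) = g" using assms by (auto simp: fun_eq_iff indicator_def)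
  finally show ?thesis .
qed

lemma test_fun_integrable:
  assumes "test_fun U f" shows "integrable lborel f"
proof -
  obtain K where "compact K" "\<And>x. x \<notin> K \<Longrightarrow> f x = 0" by (rule test_funE[OF assms]) (rule that)
  then show ?thesis using integrable_continuous_compact_support[OF test_fun_continuous[OF assms]] by blast
qed

lemma test_fun_bounded:
  assumes "test_fun U f" obtains B where "0 < B" "\<And>x. \<bar>f x\<bar> \<le> B"
proof -
  obtain K where K: "compact K" "\<And>x. x \<notin> K \<Longrightarrow> f x = 0" by (rule test_funE[OF assms]) (rule that)
  have "bounded (f ` K)"
    using K test_fun_continuous[OF assms] by (intro compact_imp_bounded compact_continuous_image)
  then obtain B where "0 < B" "\<And>x. x \<in> K \<Longrightarrow> \<bar>f x\<bar> \<le> B" by (auto simp: bounded_pos)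
  then have "0 < B" "\<bar>f x\<bar> \<le> B" for x using K by (cases "x \<in> K"; simp)+
  then show ?thesis by (rule that)
qed

lemma grad_bounded:
  assumes "test_fun U f" obtains B where "0 < B" "\<And>x. norm (grad f x) \<le> B"
proof -
  obtain K where K: "compact K" "\<And>x v. x \<notin> K \<Longrightarrow> frechet_derivative f (at x) v = 0"
    by (rule test_funE[OF assms]) (rule that)
  have z: "grad f x = 0" if "x \<notin> K" for x using K that by (simp add: grad_def pderiv_i_def vec_eq_iff)
  have "bounded (grad f ` K)"
    using K grad_continuous[OF assms] by (intro compact_imp_bounded compact_continuous_image)
  then obtain B where "0 < B" "\<And>x. x \<in> K \<Longrightarrow> norm (grad f x) \<le> B" by (auto simp: bounded_pos)
  then have "0 < B" "norm (grad f x) \<le> B" for x using z by (cases "x \<in> K"; simp)+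
  then show ?thesis by (rule that)
qed

lemma test_fun_lipschitz:
  assumes "test_fun U f" "\<And>x. norm (grad f x) \<le> B"
  shows "\<bar>f x - f y\<bar> \<le> B * norm (x - y)"
proof -
  have "norm (f x - f y) \<le> B * norm (x - y)"
  proof (rule differentiable_bound[of UNIV f "\<lambda>x h. grad f x \<bullet> h" B x y])
    fix z
    show "(f has_derivative (\<lambda>h. grad f z \<bullet> h)) (at z within UNIV)"
      using test_fun_has_derivative[OF assms(1)] by simp
    show "onorm (\<lambda>h. grad f z \<bullet> h) \<le> B"
    proof (rule onorm_le)
      fix h
      have "norm (grad f z \<bullet> h) \<le> norm (grad f z) * norm h" using Cauchy_Schwarz_ineq2 by simp
      also have "\<dots> \<le> B * norm h" using assms(2) by (intro mult_right_mono) auto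
      finally show "norm (grad f z \<bullet> h) \<le> B * norm h" .
    qed
  qed auto
  then show ?thesis by simp
qed

text \<open>By translation invariance the difference quotients have integral zero.\<close>

lemma integral_pderiv_eq_0:
  assumes f: "test_fun U f"
  shows "(\<integral>x. pderiv_i i f x \<partial>lborel) = 0"
proof -
  let ?e = "axis i 1 :: real^'a"
  obtain K where K: "compact K" "\<And>x. x \<notin> K \<Longrightarrow> f x = 0" by (rule test_funE[OF f]) (rule that)
  obtain R where R: "\<And>x. x \<in> K \<Longrightarrow> norm x \<le> R" using compact_imp_bounded[OF K(1)] by (auto simp: bounded_iff)
  obtain B where B: "0 < B" "\<And>x. norm (grad f x) \<le> B" by (rule grad_bounded[OF f]) (rule that)
  define h where "h n = 1 / real (Suc n)" for n
  have h: "0 < h n" "h n \<le> 1" for n by (auto simp: h_def)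
  have h0: "h \<longlonglongrightarrow> 0" unfolding h_def by (rule LIMSEQ_Suc[OF lim_1_over_n])
  define q where "q n x = (f (h n *\<^sub>R ?e + x) - f x) / h n" for n x
  have meas [measurable]: "f \<in> borel_measurable borel" using test_fun_measurable[OF f] .
  have pm [measurable]: "pderiv_i i f \<in> borel_measurable borel"
    using test_fun_measurable[OF test_fun_pderiv[OF f]] .
  have int: "integrable lborel f" using test_fun_integrable[OF f] .
  have tr: "integrable lborel (\<lambda>x. f (c + x))" "(\<integral>x. f (c + x) \<partial>lborel) = (\<integral>x. f x \<partial>lborel)" for c
  proof -
    have "integrable (distr lborel borel ((+) c)) f" using int by (simp add: lborel_distr_plus)
    then show "integrable lborel (\<lambda>x. f (c + x))" by (simp add: integrable_distr_eq)
    have "(\<integral>x. f x \<partial>lborel) = (\<integral>x. f x \<partial>distr lborel borel ((+) c))" by (simp add: lborel_distr_plus)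
    also have "\<dots> = (\<integral>x. f (c + x) \<partial>lborel)" by (simp add: integral_distr)
    finally show "(\<integral>x. f (c + x) \<partial>lborel) = (\<integral>x. f x \<partial>lborel)" by simp
  qed
  have q0: "(\<integral>x. q n x \<partial>lborel) = 0" for n
    using tr int by (simp add: q_def)
  have "(\<lambda>n. \<integral>x. q n x \<partial>lborel) \<longlonglongrightarrow> (\<integral>x. pderiv_i i f x \<partial>lborel)"
  \<comment> \<open>The quotients are bounded by the Lipschitz constant \<open>B\<close>; the steps
    are at most 1, so the quotients vanish outside the ball of radius \<open>R + 1\<close>.\<close>
  proof (rule integral_dominated_convergence[where w = "\<lambda>x. indicator (cball 0 (R + 1)) x *\<^sub>R B"])
    show "integrable lborel (\<lambda>x. indicator (cball 0 (R + 1)) x *\<^sub>R B :: real)"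
      by (intro borel_integrable_compact) auto
    show "AE x in lborel. (\<lambda>n. q n x) \<longlonglongrightarrow> pderiv_i i f x"
    proof (rule AE_I2)
      fix x
      have "((\<lambda>t. f (x + t *\<^sub>R ?e)) has_derivative (\<lambda>t. grad f x \<bullet> (t *\<^sub>R ?e))) (at 0)"
        by (rule has_derivative_compose[of "\<lambda>t. x + t *\<^sub>R ?e" _ 0 UNIV f])
          (auto intro!: derivative_eq_intros test_fun_has_derivative[OF f])
      moreover have "grad f x \<bullet> ?e = pderiv_i i f x" by (simp add: grad_def inner_axis)
      ultimately have "((\<lambda>t. f (x + t *\<^sub>R ?e)) has_real_derivative pderiv_i i f x) (at 0)"
        by (simp add: has_field_derivative_def mult_commute_abs)
      then have lim: "((\<lambda>t. (f (x + t *\<^sub>R ?e) - f x) / t) \<longlongrightarrow> pderiv_i i f x) (at 0)"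
        by (simp add: DERIV_def)
      have "filterlim h (at 0) sequentially"
        using h0 h by (simp add: filterlim_at less_imp_neq[symmetric])
      from filterlim_compose[OF lim this] show "(\<lambda>n. q n x) \<longlonglongrightarrow> pderiv_i i f x"
        by (simp add: q_def add.commute)
    qed
    fix n
    show "AE x in lborel. norm (q n x) \<le> indicator (cball 0 (R + 1)) x *\<^sub>R B"
    proof (rule AE_I2)
      fix x
      show "norm (q n x) \<le> indicator (cball 0 (R + 1)) x *\<^sub>R B"
      proof (cases "norm x \<le> R + 1")
        case True
        have "\<bar>f (h n *\<^sub>R ?e + x) - f x\<bar> \<le> B * norm (h n *\<^sub>R ?e + x - x)"
          by (rule test_fun_lipschitz[OF f B(2)])
        then show ?thesis using True h[of n] by (simp add: q_def field_simps)
      next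
        case False
        have "norm x \<le> norm (h n *\<^sub>R ?e + x) + norm (h n *\<^sub>R ?e)"
          using norm_triangle_ineq4[of "h n *\<^sub>R ?e + x" "h n *\<^sub>R ?e"] by simp
        then have "norm (h n *\<^sub>R ?e + x) > R" using False h[of n] by simp
        then have "f (h n *\<^sub>R ?e + x) = 0" "f x = 0" using K R False by force+
        then show ?thesis by (simp add: q_def B less_imp_le)
      qed
    qed
  qed (simp_all add: q_def[abs_def])
  then have "(\<lambda>n::nat. 0) \<longlonglongrightarrow> (\<integral>x. pderiv_i i f x \<partial>lborel)" by (simp only: q0)
  then show ?thesis by (simp add: tendsto_const_iff)
qed

lemma integral_pderiv_by_parts:
  assumes f: "test_fun U f" and g: "test_fun U g"
  shows "(\<integral>x. f x * pderiv_i i g x \<partial>lborel) = - (\<integral>x. pderiv_i i f x * g x \<partial>lborel)"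
proof -
  have "pderiv_i i (\<lambda>x. f x * g x) x = f x * pderiv_i i g x + pderiv_i i f x * g x" for x
    using frechet_derivative_mult[of f x g] f g
    by (simp add: pderiv_i_def test_fun_smooth smooth_fun_differentiable)
  moreover have "integrable lborel (\<lambda>x. f x * pderiv_i i g x)" "integrable lborel (\<lambda>x. pderiv_i i f x * g x)"
    using f g by (auto intro!: test_fun_integrable test_fun_mult test_fun_pderiv)
  ultimately show ?thesis
    using integral_pderiv_eq_0[OF test_fun_mult[OF f g], of i] by simp
qed

section \<open>Sobolev's inequality\<close>

lemma max_powr_has_derivative:
  fixes \<gamma> :: real
  assumes \<gamma>: "1 < \<gamma>"
  shows "((\<lambda>s. max 0 s powr \<gamma>) has_real_derivative \<gamma> * max 0 s powr (\<gamma> - 1)) (at s)"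
proof -
  consider "s > 0" | "s < 0" | "s = 0" by linarith
  then show ?thesis
  proof cases
    case 1
    have "((\<lambda>s. s powr \<gamma>) has_real_derivative \<gamma> * s powr (\<gamma> - 1)) (at s)"
      by (rule has_real_derivative_powr[OF 1])
    then have "((\<lambda>s. max 0 s powr \<gamma>) has_real_derivative \<gamma> * s powr (\<gamma> - 1)) (at s)"
      by (rule has_field_derivative_transform_within_open[of _ _ _ "{0<..}"]) (use 1 in auto)
    then show ?thesis using 1 by simp
  next
    case 2
    have "((\<lambda>s. 0) has_real_derivative 0) (at s)" by simp
    then have "((\<lambda>s. max 0 s powr \<gamma>) has_real_derivative 0) (at s)"
      by (rule has_field_derivative_transform_within_open[of _ _ _ "{..<0}"]) (use 2 in auto)
    then show ?thesis using 2 by simp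
  next
    \<comment> \<open>At the kink the difference quotient equals
      \<open>max 0 h powr (\<gamma> - 1)\<close>, which tends to 0 because
      \<open>1 < \<gamma>\<close>.\<close>
    case 3
    have "((\<lambda>h. max 0 h powr (\<gamma> - 1)) \<longlongrightarrow> max 0 0 powr (\<gamma> - 1)) (at 0)"
      using \<gamma> by (intro tendsto_powr' tendsto_intros) auto
    then have "((\<lambda>h. max 0 h powr (\<gamma> - 1)) \<longlongrightarrow> 0) (at 0)" by simp
    moreover have "max 0 h powr (\<gamma> - 1) = (max 0 (0 + h) powr \<gamma> - max 0 0 powr \<gamma>) / h" if "h \<noteq> 0" for h :: real
      using that by (cases "h > 0") (auto simp: powr_diff max_def)
    ultimately have "((\<lambda>h. (max 0 (0 + h) powr \<gamma> - max 0 0 powr \<gamma>) / h) \<longlongrightarrow> 0) (at 0)"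
      by (metis (mono_tags, lifting) Lim_cong_within UNIV_I)
    then show ?thesis using 3 by (simp add: DERIV_def)
  qed
qed

lemma max_powr_continuous:
  fixes p :: real
  assumes "0 < p"
  shows "continuous_on S (\<lambda>s. max 0 s powr p)"
  using assms by (intro continuous_on_powr' continuous_intros) auto

text \<open>With real upper bounds in place of the integrals, all later constants are plain real
  numbers.\<close>

lemma Holder_powr2:
  fixes f g :: "'a \<Rightarrow> real"
  assumes [measurable]: "f \<in> borel_measurable M" "g \<in> borel_measurable M"
    and pos: "\<And>x. 0 \<le> f x" "\<And>x. 0 \<le> g x" "0 \<le> F" "0 \<le> G" "0 < p" "0 < q"
    and conj: "1 / p + 1 / q = 1"
    and F: "(\<integral>\<^sup>+x. ennreal (f x powr p) \<partial>M) \<le> ennreal F"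
    and G: "(\<integral>\<^sup>+x. ennreal (g x powr q) \<partial>M) \<le> ennreal G"
  shows "(\<integral>\<^sup>+x. ennreal (f x * g x) \<partial>M) \<le> ennreal (F powr (1 / p) * G powr (1 / q))"
proof -
  define \<phi> where "\<phi> b = (\<lambda>x. ennreal (if b then f x powr p else g x powr q))" for b
  define w where "w b = (if b then 1 / p else 1 / q)" for b
  have "(\<integral>\<^sup>+x. (\<Prod>b\<in>UNIV. epow (\<phi> b x) (w b)) \<partial>M) \<le> (\<Prod>b\<in>UNIV. epow (\<integral>\<^sup>+x. \<phi> b x \<partial>M) (w b))"
    using pos conj by (intro Holder_nn_integral) (auto simp: \<phi>_def w_def UNIV_bool)
  also have "\<dots> \<le> epow (ennreal F) (1 / p) * epow (ennreal G) (1 / q)"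
    using pos F G by (auto simp: \<phi>_def w_def UNIV_bool mult.commute intro!: mult_mono epow_mono)
  also have "\<dots> = ennreal (F powr (1 / p) * G powr (1 / q))"
    using pos by (simp add: epow_ennreal ennreal_mult)
  also have "(\<integral>\<^sup>+x. (\<Prod>b\<in>UNIV. epow (\<phi> b x) (w b)) \<partial>M) = (\<integral>\<^sup>+x. ennreal (f x * g x) \<partial>M)"
    using pos by (intro nn_integral_cong) (simp add: \<phi>_def w_def UNIV_bool epow_ennreal powr_powr ennreal_mult mult.commute)
  finally show ?thesis .
qed

lemma Holder_powr3:
  fixes f g h :: "'a \<Rightarrow> real"
  assumes [measurable]: "f \<in> borel_measurable M" "g \<in> borel_measurable M" "h \<in> borel_measurable M"
    and pos: "\<And>x. 0 \<le> f x" "\<And>x. 0 \<le> g x" "\<And>x. 0 \<le> h x" "0 \<le> F" "0 \<le> G" "0 \<le> H"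
      "0 < p" "0 < q" "0 < r"
    and conj: "1 / p + 1 / q + 1 / r = 1"
    and F: "(\<integral>\<^sup>+x. ennreal (f x powr p) \<partial>M) \<le> ennreal F"
    and G: "(\<integral>\<^sup>+x. ennreal (g x powr q) \<partial>M) \<le> ennreal G"
    and H: "(\<integral>\<^sup>+x. ennreal (h x powr r) \<partial>M) \<le> ennreal H"
  shows "(\<integral>\<^sup>+x. ennreal (f x * g x * h x) \<partial>M) \<le> ennreal (F powr (1 / p) * G powr (1 / q) * H powr (1 / r))"
proof -
  \<comment> \<open>The exponent for the product \<open>f * g\<close>: two functions are combined
    first, and the pair \<open>s\<close>, \<open>r\<close> is again conjugate.\<close>
  define s where "s = 1 / (1 / p + 1 / q)"
  have s: "0 < s" "1 / s + 1 / r = 1" "s / p + s / q = 1"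
  proof -
    have a: "0 < 1 / p + 1 / q" using pos by (simp add: add_pos_pos)
    then show "0 < s" "1 / s + 1 / r = 1" using conj by (auto simp: s_def)
    have "s / p + s / q = s * (1 / p + 1 / q)" by (simp add: algebra_simps)
    then show "s / p + s / q = 1" using a by (simp add: s_def)
  qed
  have "(\<integral>\<^sup>+x. ennreal (f x powr s * g x powr s) \<partial>M)
      \<le> ennreal (F powr (1 / (p / s)) * G powr (1 / (q / s)))"
    using pos s F G by (intro Holder_powr2) (auto simp: powr_powr)
  also have "\<dots> = ennreal ((F powr (1 / p) * G powr (1 / q)) powr s)"
    using pos s by (simp add: powr_mult powr_powr)
  finally have "(\<integral>\<^sup>+x. ennreal ((f x * g x) powr s) \<partial>M) \<le> ennreal ((F powr (1 / p) * G powr (1 / q)) powr s)"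
    using pos by (simp add: powr_mult)
  then have "(\<integral>\<^sup>+x. ennreal (f x * g x * h x) \<partial>M)
      \<le> ennreal (((F powr (1 / p) * G powr (1 / q)) powr s) powr (1 / s) * H powr (1 / r))"
    using pos s H by (intro Holder_powr2) auto
  then show ?thesis using pos s by (simp add: powr_powr)
qed

section \<open>The Dirichlet norm and the Sobolev bound for test functions\<close>

definition gnorm :: "(real^'n \<Rightarrow> real) \<Rightarrow> real" where
  "gnorm \<phi> = sqrt (\<integral>x. (norm (grad \<phi> x))\<^sup>2 \<partial>lebesgue)"

text \<open>Fundamental theorem of calculus for \<open>\<bar>\<phi>\<bar> powr \<gamma>\<close>
  along the segment from a point outside the support to \<open>x\<close>.\<close>

lemma line_integral_bound:
  fixes \<phi> :: "real^'n \<Rightarrow> real"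
  assumes \<phi>: "test_fun U \<phi>" and \<gamma>: "1 < \<gamma>" and b: "b \<in> Basis"
  shows "ennreal (\<bar>\<phi> x\<bar> powr \<gamma>) \<le>
    (\<integral>\<^sup>+t. ennreal (\<gamma> * \<bar>\<phi> (x + t *\<^sub>R b)\<bar> powr (\<gamma> - 1) * norm (grad \<phi> (x + t *\<^sub>R b))) \<partial>lborel)"
proof -
  obtain K where K: "compact K" "\<And>x. x \<notin> K \<Longrightarrow> \<phi> x = 0" by (rule test_funE[OF \<phi>]) (rule that)
  obtain R where R: "\<And>x. x \<in> K \<Longrightarrow> norm x \<le> R" "0 < R"
    using compact_imp_bounded[OF K(1)] by (auto simp: bounded_pos)
  \<comment> \<open>By the triangle inequality \<open>x - L *\<^sub>R b\<close> has norm at least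
    \<open>R + 1\<close> and so lies outside \<open>K\<close>.\<close>
  define L where "L = norm x + R + 1"
  have L: "0 < L" using R by (simp add: L_def add_nonneg_pos)
  \<comment> \<open>\<open>\<bar>s\<bar> powr \<gamma>\<close> is split into two one-sided powers,
    each differentiable at 0 as well.\<close>
  define P where "P s = max 0 s powr \<gamma> + max 0 (- s) powr \<gamma>" for s
  define Q where "Q s = \<gamma> * max 0 s powr (\<gamma> - 1) - \<gamma> * max 0 (- s) powr (\<gamma> - 1)" for s
  have P_eq: "P s = \<bar>s\<bar> powr \<gamma>" for s by (cases "s \<ge> 0") (auto simp: P_def max_def)
  have Q_eq: "\<bar>Q s\<bar> = \<gamma> * \<bar>s\<bar> powr (\<gamma> - 1)" for s using \<gamma> by (cases "s \<ge> 0") (auto simp: Q_def max_def abs_mult)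
  have PQ: "(P has_real_derivative Q s) (at s)" for s
  proof -
    have "((\<lambda>s. max 0 (- s) powr \<gamma>) has_real_derivative \<gamma> * max 0 (- s) powr (\<gamma> - 1) * (- 1)) (at s)"
      by (rule DERIV_chain2[OF max_powr_has_derivative[OF \<gamma>]]) (auto intro!: derivative_eq_intros)
    from DERIV_add[OF max_powr_has_derivative[OF \<gamma>] this] show ?thesis
      by (simp add: P_def[abs_def] Q_def)
  qed
  have Qc: "continuous_on S Q" for S
    unfolding Q_def[abs_def] using \<gamma>
    by (intro continuous_intros max_powr_continuous continuous_on_compose2[OF max_powr_continuous[of "\<gamma> - 1" UNIV]]) auto
  define l where "l t = x + t *\<^sub>R b" for t
  define v where "v t = P (\<phi> (l t))" for t
  define v' where "v' t = Q (\<phi> (l t)) * (grad \<phi> (l t) \<bullet> b)" for t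
  have lc: "continuous_on S l" for S unfolding l_def by (intro continuous_intros)
  have dv: "(v has_real_derivative v' t) (at t)" for t
  proof -
    have "(l has_derivative (\<lambda>h. h *\<^sub>R b)) (at t)"
      unfolding l_def by (auto intro!: derivative_eq_intros)
    from has_derivative_compose[OF this test_fun_has_derivative[OF \<phi>]]
    have "((\<lambda>t. \<phi> (l t)) has_real_derivative (grad \<phi> (l t) \<bullet> b)) (at t)"
      by (simp add: has_field_derivative_def mult_commute_abs)
    from DERIV_chain2[OF PQ this] show ?thesis by (simp add: v_def[abs_def] v'_def)
  qed
  have v'c: "continuous_on S v'" for S
    unfolding v'_def[abs_def]
    by (intro continuous_intros continuous_on_compose2[OF Qc[of UNIV]]
        continuous_on_compose2[OF test_fun_continuous[OF \<phi>, of UNIV] lc]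
        continuous_on_compose2[OF grad_continuous[OF \<phi>, of UNIV] lc]) auto
  have vL: "v (- L) = 0"
  proof -
    have "L \<le> norm (l (- L)) + norm x"
      using norm_triangle_ineq4[of "l (- L)" x] b L by (simp add: l_def)
    then have "l (- L) \<notin> K" using R(1)[of "l (- L)"] by (auto simp: L_def)
    then show ?thesis using K \<gamma> by (simp add: v_def P_eq)
  qed
  have fi: "has_bochner_integral lborel (\<lambda>t. indicator {- L..0} t *\<^sub>R v' t) (v 0 - v (- L))"
    using L by (intro has_bochner_integral_FTC_Icc) (auto intro!: v'c dv[THEN DERIV_subset] simp: has_real_derivative_iff_has_vector_derivative[symmetric])
  have "ennreal (\<bar>\<phi> x\<bar> powr \<gamma>) = ennreal (norm (\<integral>t. indicator {- L..0} t *\<^sub>R v' t \<partial>lborel))"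
    using has_bochner_integral_integral_eq[OF fi] vL by (simp add: v_def P_eq l_def)
  also have "\<dots> \<le> (\<integral>\<^sup>+t. ennreal (norm (indicator {- L..0} t *\<^sub>R v' t)) \<partial>lborel)"
    by (rule integral_norm_bound_ennreal) (use fi in \<open>auto simp: has_bochner_integral_iff\<close>)
  also have "\<dots> \<le> (\<integral>\<^sup>+t. ennreal (\<gamma> * \<bar>\<phi> (l t)\<bar> powr (\<gamma> - 1) * norm (grad \<phi> (l t))) \<partial>lborel)"
  proof (intro nn_integral_mono ennreal_leI)
    fix t
    have "\<bar>grad \<phi> (l t) \<bullet> b\<bar> \<le> norm (grad \<phi> (l t))"
      using Basis_le_norm[OF b] by simp
    then have "\<bar>v' t\<bar> \<le> \<gamma> * \<bar>\<phi> (l t)\<bar> powr (\<gamma> - 1) * norm (grad \<phi> (l t))"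
      using \<gamma> by (auto simp: v'_def abs_mult Q_eq intro!: mult_left_mono)
    moreover have "norm (indicator {- L..0} t *\<^sub>R v' t) \<le> \<bar>v' t\<bar>" by (auto simp: indicator_def)
    ultimately show "norm (indicator {- L..0} t *\<^sub>R v' t) \<le> \<gamma> * \<bar>\<phi> (l t)\<bar> powr (\<gamma> - 1) * norm (grad \<phi> (l t))"
      by linarith
  qed
  finally show ?thesis by (simp add: l_def)
qed

lemma integrable_test_fun_powr:
  assumes \<phi>: "test_fun U \<phi>" and p: "0 < p"
  shows "integrable lebesgue (\<lambda>x. \<bar>\<phi> x\<bar> powr p)"
proof -
  obtain K where K: "compact K" "\<And>x. x \<notin> K \<Longrightarrow> \<phi> x = 0" by (rule test_funE[OF \<phi>]) (rule that)
  have "integrable lborel (\<lambda>x. \<bar>\<phi> x\<bar> powr p)"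
    using K p test_fun_continuous[OF \<phi>]
    by (intro integrable_continuous_compact_support[of _ K] continuous_on_powr' continuous_intros) auto
  then show ?thesis by (simp add: integrable_completion)
qed

lemma integrable_grad_square:
  assumes \<phi>: "test_fun U \<phi>"
  shows "integrable lebesgue (\<lambda>x. (norm (grad \<phi> x))\<^sup>2)"
proof -
  obtain K where K: "compact K" "\<And>x v. x \<notin> K \<Longrightarrow> frechet_derivative \<phi> (at x) v = 0"
    by (rule test_funE[OF \<phi>]) (rule that)
  have "integrable lborel (\<lambda>x. (norm (grad \<phi> x))\<^sup>2)"
    using K grad_continuous[OF \<phi>]
    by (intro integrable_continuous_compact_support[of _ K] continuous_intros)
       (auto simp: grad_def pderiv_i_def vec_eq_iff)
  then show ?thesis by (simp add: integrable_completion)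
qed

lemma gnorm_nonneg: "0 \<le> gnorm \<phi>"
  by (simp add: gnorm_def)

lemma gnorm_square: "(gnorm \<phi>)\<^sup>2 = (\<integral>x. (norm (grad \<phi> x))\<^sup>2 \<partial>lebesgue)"
  by (simp add: gnorm_def)

lemma nn_integral_grad_square:
  assumes "test_fun U \<phi>"
  shows "(\<integral>\<^sup>+x. ennreal ((norm (grad \<phi> x))\<^sup>2) \<partial>lebesgue) = ennreal ((gnorm \<phi>)\<^sup>2)"
  unfolding gnorm_square using assms by (intro nn_integral_eq_integral integrable_grad_square) auto

text \<open>The grid-lines inequality is applied to \<open>\<bar>\<phi>\<bar> powr \<gamma>\<close>, with \<open>\<gamma>\<close> chosen such that both
  \<open>\<gamma> d / (d - 1)\<close> and \<open>2 (\<gamma> - 1)\<close> equal the Sobolev exponent.\<close>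

theorem Sobolev_inequality:
  fixes \<phi> :: "real^'n \<Rightarrow> real"
  assumes \<phi>: "test_fun U \<phi>" and dim: "CARD('n) \<ge> 3" and d: "d = real CARD('n)"
  shows "(\<integral>x. \<bar>\<phi> x\<bar> powr (2 * d / (d - 2)) \<partial>lebesgue) powr ((d - 2) / (2 * d))
           \<le> 2 * (d - 1) / (d - 2) * gnorm \<phi>"
proof -
  define \<gamma> where "\<gamma> = 2 * (d - 1) / (d - 2)"
  define ps where "ps = 2 * d / (d - 2)"
  define q where "q = d / (d - 1)"
  have d3: "d \<ge> 3" using dim d by simp
  have \<gamma>: "1 < \<gamma>" and ps: "0 < ps" and q: "0 < q" and e: "\<gamma> * q = ps" "(\<gamma> - 1) * 2 = ps"
    using d3 by (auto simp: \<gamma>_def ps_def q_def divide_simps)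
  note [measurable] = test_fun_measurable[OF \<phi>] grad_measurable[OF \<phi>]
  define Y where "Y = (\<integral>x. \<bar>\<phi> x\<bar> powr ps \<partial>lebesgue)"
  have Y0: "0 \<le> Y" by (simp add: Y_def)
  have Y: "(\<integral>\<^sup>+x. ennreal (\<bar>\<phi> x\<bar> powr ps) \<partial>lborel) = ennreal Y"
    unfolding Y_def using integrable_test_fun_powr[OF \<phi> ps]
    by (subst nn_integral_completion[symmetric]) (auto intro!: nn_integral_eq_integral)
  have D: "(\<integral>\<^sup>+x. ennreal ((norm (grad \<phi> x))\<^sup>2) \<partial>lborel) = ennreal ((gnorm \<phi>)\<^sup>2)"
    using nn_integral_grad_square[OF \<phi>] by (simp add: nn_integral_completion)
  let ?F = "\<lambda>x. ennreal (\<gamma> * \<bar>\<phi> x\<bar> powr (\<gamma> - 1) * norm (grad \<phi> x))"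
  have "ennreal Y = (\<integral>\<^sup>+x. epow (ennreal (\<bar>\<phi> x\<bar> powr \<gamma>)) q \<partial>lborel)"
    using q e by (simp add: Y[symmetric] epow_ennreal powr_powr)
  also have "\<dots> \<le> epow (\<integral>\<^sup>+x. ?F x \<partial>lborel) q"
    using nn_integral_grid_lines_lborel[of ?F "\<lambda>x. ennreal (\<bar>\<phi> x\<bar> powr \<gamma>)"] line_integral_bound[OF \<phi> \<gamma>] dim
    by (simp add: q_def d)
  \<comment> \<open>Cauchy-Schwarz: the exponent \<open>2 * (\<gamma> - 1)\<close> is
    \<open>ps\<close>, so \<open>Y\<close> reappears on the right with the power 1/2 and has to be
    divided out.\<close>
  also have "\<dots> \<le> epow (ennreal (\<gamma> * (Y powr (1/2) * gnorm \<phi>))) q"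
  proof (rule epow_mono)
    have "(\<integral>\<^sup>+x. ennreal (\<bar>\<phi> x\<bar> powr (\<gamma> - 1) * norm (grad \<phi> x)) \<partial>lborel)
        \<le> ennreal (Y powr (1/2) * ((gnorm \<phi>)\<^sup>2) powr (1/2))"
      using Y0 Y D e by (intro Holder_powr2) (auto simp: powr_powr powr_numeral)
    also have "((gnorm \<phi>)\<^sup>2) powr (1/2) = gnorm \<phi>" by (simp add: powr_half_sqrt gnorm_nonneg)
    finally have "ennreal \<gamma> * (\<integral>\<^sup>+x. ennreal (\<bar>\<phi> x\<bar> powr (\<gamma> - 1) * norm (grad \<phi> x)) \<partial>lborel)
        \<le> ennreal \<gamma> * ennreal (Y powr (1/2) * gnorm \<phi>)" by (rule mult_left_mono) simp
    also have "\<dots> = ennreal (\<gamma> * (Y powr (1/2) * gnorm \<phi>))" using \<gamma> gnorm_nonneg[of \<phi>] by (intro ennreal_mult[symmetric]) auto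
    also have "ennreal \<gamma> * (\<integral>\<^sup>+x. ennreal (\<bar>\<phi> x\<bar> powr (\<gamma> - 1) * norm (grad \<phi> x)) \<partial>lborel) = (\<integral>\<^sup>+x. ?F x \<partial>lborel)"
      using \<gamma> by (subst nn_integral_cmult[symmetric]) (auto simp: ennreal_mult mult.assoc)
    finally show "(\<integral>\<^sup>+x. ?F x \<partial>lborel) \<le> ennreal (\<gamma> * (Y powr (1/2) * gnorm \<phi>))" .
  qed (use q in simp)
  also have "\<dots> = ennreal ((\<gamma> * (Y powr (1/2) * gnorm \<phi>)) powr q)"
    using \<gamma> q gnorm_nonneg[of \<phi>] by (intro epow_ennreal mult_nonneg_nonneg) auto
  finally have Yle: "Y \<le> (\<gamma> * (Y powr (1/2) * gnorm \<phi>)) powr q"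
    by (simp add: ennreal_le_iff)
  \<comment> \<open>Dividing by the square root of \<open>Y\<close> needs \<open>0 < Y\<close>;
    finiteness is built in, \<open>Y\<close> being the integral of a continuous function with
    compact support.\<close>
  have "Y powr ((d - 2) / (2 * d)) \<le> \<gamma> * gnorm \<phi>"
  proof (cases "Y = 0")
    case True
    then show ?thesis using \<gamma> gnorm_nonneg[of \<phi>] by simp
  next
    case False
    then have Yp: "0 < Y" using Y0 by simp
    have "Y powr (1 / q) \<le> ((\<gamma> * (Y powr (1/2) * gnorm \<phi>)) powr q) powr (1 / q)"
      using Yle Y0 q by (intro powr_mono2) auto
    also have "\<dots> = \<gamma> * gnorm \<phi> * Y powr (1/2)"
      using q \<gamma> gnorm_nonneg[of \<phi>] by (simp add: powr_powr)
    finally have "Y powr (1 / q) / Y powr (1/2) \<le> \<gamma> * gnorm \<phi>"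
      using Yp by (simp add: divide_le_eq)
    moreover have "1 / q - 1/2 = (d - 2) / (2 * d)"
      using d3 by (simp add: q_def divide_simps)
    then have "Y powr (1 / q) / Y powr (1/2) = Y powr ((d - 2) / (2 * d))"
      by (simp only: powr_diff[symmetric])
    ultimately show ?thesis by simp
  qed
  then show ?thesis by (simp add: Y_def ps_def \<gamma>_def)
qed

section \<open>Truncation and level sets\<close>

text \<open>The functions \<open>max 0 (s - k) powr (1 + \<delta>)\<close> are continuously differentiable, and for \<open>\<delta> \<rightarrow> 0\<close> their
  derivatives tend to the indicator of \<open>s > k\<close> at every point; Weierstrass' theorem is applied to
  these derivatives.\<close>

lemma truncation_polynomials:
  fixes k R :: real
  assumes R: "0 < R"
  obtains T T' :: "nat \<Rightarrow> real \<Rightarrow> real" and B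
  where "\<And>n. \<exists>m c. T n = (\<lambda>s. \<Sum>i\<le>m. c i * s ^ Suc i)"
    and "\<And>n s. (T n has_real_derivative T' n s) (at s)"
    and "\<And>n S. continuous_on S (T' n)"
    and "\<And>n s. \<bar>s\<bar> \<le> R \<Longrightarrow> \<bar>T n s\<bar> \<le> B"
    and "\<And>n s. \<bar>s\<bar> \<le> R \<Longrightarrow> \<bar>T' n s\<bar> \<le> B"
    and "\<And>s. \<bar>s\<bar> \<le> R \<Longrightarrow> (\<lambda>n. T n s) \<longlonglongrightarrow> max 0 (s - k) - max 0 (- k)"
    and "\<And>s. \<bar>s\<bar> \<le> R \<Longrightarrow> (\<lambda>n. T' n s) \<longlonglongrightarrow> (if k < s then 1 else 0)"
proof -
  define \<delta> where "\<delta> n = 1 / real (Suc n)" for n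
  have \<delta>: "0 < \<delta> n" "\<delta> n \<le> 1" for n by (auto simp: \<delta>_def)
  have \<delta>0: "\<delta> \<longlonglongrightarrow> 0" unfolding \<delta>_def by (rule LIMSEQ_Suc[OF lim_1_over_n])
  define E where "E n s = max 0 (s - k) powr (1 + \<delta> n)" for n s
  define \<eta> where "\<eta> n s = (1 + \<delta> n) * max 0 (s - k) powr \<delta> n" for n s
  have E\<eta>: "(E n has_real_derivative \<eta> n s) (at s)" for n s
  proof -
    have "((\<lambda>s. max 0 (s - k) powr (1 + \<delta> n)) has_real_derivative
        (1 + \<delta> n) * max 0 (s - k) powr (1 + \<delta> n - 1) * 1) (at s)"
      by (rule DERIV_chain2[OF max_powr_has_derivative]) (use \<delta>[of n] in \<open>auto intro!: derivative_eq_intros\<close>)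
    then show ?thesis by (simp add: E_def[abs_def] \<eta>_def)
  qed
  have \<eta>c: "continuous_on S (\<eta> n)" for n S
    unfolding \<eta>_def[abs_def] using \<delta>[of n]
    by (intro continuous_intros continuous_on_compose2[OF max_powr_continuous[of "\<delta> n" UNIV]]) auto
  \<comment> \<open>All exponents stay between 0 and 2, so \<open>C ^ 2\<close> dominates the powers
    of \<open>max 0 (s - k)\<close> on the interval.\<close>
  define C where "C = 1 + R + \<bar>k\<bar>"
  have C: "1 \<le> C" using R by (simp add: C_def)
  have r: "max 0 (s - k) \<le> C" if "\<bar>s\<bar> \<le> R" for s using that by (auto simp: C_def)
  have pb: "max 0 (s - k) powr p \<le> C ^ 2" if "\<bar>s\<bar> \<le> R" "0 \<le> p" "p \<le> 2" for s p
  proof -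
    have "max 0 (s - k) powr p \<le> C powr p" using r[OF that(1)] that by (intro powr_mono2) auto
    also have "\<dots> \<le> C powr 2" using C that by (intro powr_mono) auto
    finally show ?thesis using C by simp
  qed
  have \<eta>b: "\<bar>\<eta> n s\<bar> \<le> 2 * C ^ 2" and Eb: "\<bar>E n s\<bar> \<le> C ^ 2" if "\<bar>s\<bar> \<le> R" for n s
    using pb[OF that, of "\<delta> n"] pb[OF that, of "1 + \<delta> n"] \<delta>[of n]
    by (auto simp: \<eta>_def E_def abs_mult intro!: mult_mono)
  \<comment> \<open>Approximating the derivative and integrating controls both \<open>T\<close> and
    \<open>T'\<close>; approximating \<open>E\<close> itself would leave the derivatives
    uncontrolled.\<close>
  have "\<exists>a m. \<forall>s\<in>{-R..R}. \<bar>\<eta> n s - (\<Sum>i\<le>m. a i * s ^ i)\<bar> < \<delta> n" for n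
  proof -
    obtain g where g: "real_polynomial_function g" "\<And>s. s \<in> {-R..R} \<Longrightarrow> \<bar>\<eta> n s - g s\<bar> < \<delta> n"
      using Stone_Weierstrass_real_polynomial_function[OF compact_Icc \<eta>c \<delta>(1)] by blast
    from g(1) obtain a m where "g = (\<lambda>s. \<Sum>i\<le>m. a i * s ^ i)"
      unfolding real_polynomial_function_iff_sum by auto
    with g(2) show ?thesis by (intro exI[of _ a] exI[of _ m] ballI) simp
  qed
  then obtain a m where am: "\<And>n s. s \<in> {-R..R} \<Longrightarrow> \<bar>\<eta> n s - (\<Sum>i\<le>m n. a n i * s ^ i)\<bar> < \<delta> n"
    by metis
  \<comment> \<open>The antiderivative without constant term; hence \<open>T n 0 = 0\<close>, and
    the limit is the truncation shifted to vanish at 0.\<close>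
  define T where "T n s = (\<Sum>i\<le>m n. a n i / real (Suc i) * s ^ Suc i)" for n s
  define T' where "T' n s = (\<Sum>i\<le>m n. a n i * s ^ i)" for n s
  have TT': "(T n has_real_derivative T' n s) (at s)" for n s
    unfolding T_def[abs_def] T'_def
    by (rule DERIV_sum) (auto intro!: derivative_eq_intros simp del: power_Suc of_nat_Suc)
  have d1: "\<bar>\<eta> n s - T' n s\<bar> \<le> \<delta> n" if "\<bar>s\<bar> \<le> R" for n s
    using am[of s n] that by (auto simp: T'_def abs_le_iff)
  \<comment> \<open>Mean value inequality: the derivatives of \<open>T n\<close> and
    \<open>E n\<close> differ by at most \<open>\<delta> n\<close>.\<close>
  have d2: "\<bar>(T n s - E n s) - (T n 0 - E n 0)\<bar> \<le> \<delta> n * R" if "\<bar>s\<bar> \<le> R" for n s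
  proof -
    have "norm ((T n s - E n s) - (T n 0 - E n 0)) \<le> \<delta> n * norm (s - 0)"
    proof (rule field_differentiable_bound[of "{-R..R}" "\<lambda>s. T n s - E n s" "\<lambda>s. T' n s - \<eta> n s"])
      fix z assume "z \<in> {-R..R}"
      then show "norm (T' n z - \<eta> n z) \<le> \<delta> n" using d1[of z n] by (auto simp: abs_le_iff)
      show "((\<lambda>s. T n s - E n s) has_field_derivative T' n z - \<eta> n z) (at z within {-R..R})"
        by (rule has_field_derivative_at_within[OF DERIV_diff[OF TT' E\<eta>]])
    qed (use that R in auto)
    also have "\<dots> \<le> \<delta> n * R" using that \<delta>[of n] by (intro mult_left_mono) auto
    finally show ?thesis by simp
  qed
  have T0: "T n 0 = 0" for n by (simp add: T_def)
  have T'lim: "(\<lambda>n. T' n s) \<longlonglongrightarrow> (if k < s then 1 else 0)" if s: "\<bar>s\<bar> \<le> R" for s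
  proof -
    have "(\<lambda>n. \<eta> n s) \<longlonglongrightarrow> (if k < s then 1 else 0)"
    proof (cases "k < s")
      case True
      have "(\<lambda>n. (1 + \<delta> n) * (s - k) powr \<delta> n) \<longlonglongrightarrow> (1 + 0) * (s - k) powr 0"
        using True by (intro tendsto_intros \<delta>0) auto
      then show ?thesis using True by (simp add: \<eta>_def)
    next
      case False
      then show ?thesis by (simp add: \<eta>_def max_def)
    qed
    moreover have "(\<lambda>n. \<eta> n s - T' n s) \<longlonglongrightarrow> 0"
      by (rule Lim_null_comparison[OF _ \<delta>0]) (use d1[OF s] in auto)
    ultimately have "(\<lambda>n. \<eta> n s - (\<eta> n s - T' n s)) \<longlonglongrightarrow> (if k < s then 1 else 0) - 0"
      by (rule tendsto_diff)
    then show ?thesis by simp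
  qed
  have Elim: "(\<lambda>n. E n s) \<longlonglongrightarrow> max 0 (s - k)" for s
  proof (cases "k < s")
    case True
    have "(\<lambda>n. (s - k) powr (1 + \<delta> n)) \<longlonglongrightarrow> (s - k) powr (1 + 0)"
      using True by (intro tendsto_intros \<delta>0) auto
    then show ?thesis using True by (simp add: E_def)
  next
    case False
    then show ?thesis by (simp add: E_def max_def)
  qed
  have Tlim: "(\<lambda>n. T n s) \<longlonglongrightarrow> max 0 (s - k) - max 0 (- k)" if s: "\<bar>s\<bar> \<le> R" for s
  proof -
    have "(\<lambda>n. (T n s - E n s) - (T n 0 - E n 0)) \<longlonglongrightarrow> 0"
    proof (rule Lim_null_comparison)
      show "(\<lambda>n. \<delta> n * R) \<longlonglongrightarrow> 0" using tendsto_mult[OF \<delta>0 tendsto_const[of R]] by simp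
    qed (use d2[OF s] in auto)
    from tendsto_add[OF this tendsto_diff[OF Elim[of s] Elim[of 0]]]
    show ?thesis by (simp add: T0)
  qed
  show ?thesis
  proof (rule that[of T T' "R + 2 * C ^ 2 + 1"])
    show "\<exists>m c. T n = (\<lambda>s. \<Sum>i\<le>m. c i * s ^ Suc i)" for n
      by (intro exI[of _ "m n"] exI[of _ "\<lambda>i. a n i / real (Suc i)"]) (simp add: T_def fun_eq_iff)
    show "continuous_on S (T' n)" for S n
      unfolding T'_def[abs_def] by (intro continuous_intros)
    show "\<bar>T n s\<bar> \<le> R + 2 * C ^ 2 + 1" if "\<bar>s\<bar> \<le> R" for n s
    proof -
      have "\<delta> n * R \<le> 1 * R" using \<delta> R by (intro mult_right_mono) auto
      then show ?thesis using d2[OF that, of n] T0[of n] Eb[OF that, of n] Eb[of 0 n] R by linarith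
    qed
    show "\<bar>T' n s\<bar> \<le> R + 2 * C ^ 2 + 1" if "\<bar>s\<bar> \<le> R" for n s
      using d1[OF that, of n] \<eta>b[OF that, of n] \<delta>[of n] R by linarith
  qed (use TT' T'lim Tlim in auto)
qed

lemma truncation_sequence:
  fixes \<phi> :: "real^'n \<Rightarrow> real"
  assumes \<phi>: "test_fun U \<phi>"
  obtains \<psi> \<tau> :: "nat \<Rightarrow> real^'n \<Rightarrow> real" and B
  where "\<And>n. test_fun U (\<psi> n)" "\<And>n x. grad (\<psi> n) x = \<tau> n x *\<^sub>R grad \<phi> x"
    "\<And>n. \<tau> n \<in> borel_measurable borel"
    "\<And>n x. \<bar>\<psi> n x\<bar> \<le> B" "\<And>n x. \<bar>\<tau> n x\<bar> \<le> B"
    "\<And>x. (\<lambda>n. \<psi> n x) \<longlonglongrightarrow> max 0 (\<phi> x - k) - max 0 (- k)"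
    "\<And>x. (\<lambda>n. \<tau> n x) \<longlonglongrightarrow> (if k < \<phi> x then 1 else 0)"
proof -
  obtain R where R: "0 < R" "\<And>x. \<bar>\<phi> x\<bar> \<le> R" by (rule test_fun_bounded[OF \<phi>]) (rule that)
  obtain T T' B where T: "\<And>n. \<exists>m c. T n = (\<lambda>s. \<Sum>i\<le>m. c i * s ^ Suc i)"
    "\<And>n s. (T n has_real_derivative T' n s) (at s)" "\<And>n S. continuous_on S (T' n)"
    "\<And>n s. \<bar>s\<bar> \<le> R \<Longrightarrow> \<bar>T n s\<bar> \<le> B" "\<And>n s. \<bar>s\<bar> \<le> R \<Longrightarrow> \<bar>T' n s\<bar> \<le> B"
    "\<And>s. \<bar>s\<bar> \<le> R \<Longrightarrow> (\<lambda>n. T n s) \<longlonglongrightarrow> max 0 (s - k) - max 0 (- k)"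
    "\<And>s. \<bar>s\<bar> \<le> R \<Longrightarrow> (\<lambda>n. T' n s) \<longlonglongrightarrow> (if k < s then 1 else 0)"
    by (rule truncation_polynomials[OF R(1)]) (rule that)
  show ?thesis
  proof (rule that[of "\<lambda>n x. T n (\<phi> x)" "\<lambda>n x. T' n (\<phi> x)" B])
    show "test_fun U (\<lambda>x. T n (\<phi> x))" for n
    proof -
      obtain m c where "T n = (\<lambda>s. \<Sum>i\<le>m. c i * s ^ Suc i)" using T(1) by blast
      then show ?thesis using test_fun_poly[OF \<phi>, of c m] by simp
    qed
    show "grad (\<lambda>x. T n (\<phi> x)) x = T' n (\<phi> x) *\<^sub>R grad \<phi> x" for n x
      by (rule grad_compose[OF \<phi> T(2)])
    show "(\<lambda>x. T' n (\<phi> x)) \<in> borel_measurable borel" for n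
      by (intro borel_measurable_continuous_onI continuous_on_compose2[OF T(3) test_fun_continuous[OF \<phi>]]) auto
  qed (use T R in auto)
qed

text \<open>Integration by parts of the truncations against the derivative of \<phi>, in the limit.
  It trades the discontinuous cut-off on the left for a Lipschitz function of \<open>k\<close> on
  the right.\<close>

lemma integral_superlevel_pderiv:
  fixes \<phi> :: "real^'n \<Rightarrow> real"
  assumes \<phi>: "test_fun U \<phi>"
  shows "(\<integral>x. (if k < \<phi> x then (pderiv_i i \<phi> x)\<^sup>2 else 0) \<partial>lborel)
    = - (\<integral>x. (max 0 (\<phi> x - k) - max 0 (- k)) * pderiv_i i (pderiv_i i \<phi>) x \<partial>lborel)"
proof -
  obtain \<psi> \<tau> B where \<psi>: "\<And>n. test_fun U (\<psi> n)" "\<And>n x. grad (\<psi> n) x = \<tau> n x *\<^sub>R grad \<phi> x"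
    "\<And>n. \<tau> n \<in> borel_measurable borel"
    "\<And>n x. \<bar>\<psi> n x\<bar> \<le> B" "\<And>n x. \<bar>\<tau> n x\<bar> \<le> B"
    "\<And>x. (\<lambda>n. \<psi> n x) \<longlonglongrightarrow> max 0 (\<phi> x - k) - max 0 (- k)"
    "\<And>x. (\<lambda>n. \<tau> n x) \<longlonglongrightarrow> (if k < \<phi> x then 1 else 0)"
    by (rule truncation_sequence[OF \<phi>, of k]) (rule that)
  let ?D = "pderiv_i i \<phi>" and ?D2 = "pderiv_i i (pderiv_i i \<phi>)"
  note D = test_fun_pderiv[OF \<phi>, of i] and D2 = test_fun_pderiv[OF test_fun_pderiv[OF \<phi>, of i], of i]
  note [measurable] = test_fun_measurable[OF \<phi>] test_fun_measurable[OF D] test_fun_measurable[OF D2]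
    \<psi>(3) test_fun_measurable[OF \<psi>(1)]
  have gi: "pderiv_i i (\<psi> n) x = \<tau> n x * ?D x" for n x
    using arg_cong[OF \<psi>(2)[of n x], of "\<lambda>v. v $ i"] by (simp add: grad_def)
  have parts: "(\<integral>x. \<psi> n x * ?D2 x \<partial>lborel) = - (\<integral>x. \<tau> n x * (?D x)\<^sup>2 \<partial>lborel)" for n
    using integral_pderiv_by_parts[OF \<psi>(1) D, of n i] by (simp add: gi power2_eq_square mult_ac)
  have lim1: "(\<lambda>n. \<integral>x. \<psi> n x * ?D2 x \<partial>lborel) \<longlonglongrightarrow> (\<integral>x. (max 0 (\<phi> x - k) - max 0 (- k)) * ?D2 x \<partial>lborel)"
  proof (rule integral_dominated_convergence[where w = "\<lambda>x. B * \<bar>?D2 x\<bar>"])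
    show "integrable lborel (\<lambda>x. B * \<bar>?D2 x\<bar>)" using test_fun_integrable[OF D2] by simp
    show "AE x in lborel. norm (\<psi> n x * ?D2 x) \<le> B * \<bar>?D2 x\<bar>" for n
      using \<psi>(4) by (auto simp: abs_mult intro!: mult_right_mono)
  qed (use \<psi>(6) in \<open>auto intro!: tendsto_mult\<close>)
  have lim2: "(\<lambda>n. \<integral>x. \<tau> n x * (?D x)\<^sup>2 \<partial>lborel) \<longlonglongrightarrow> (\<integral>x. (if k < \<phi> x then 1 else 0) * (?D x)\<^sup>2 \<partial>lborel)"
  proof (rule integral_dominated_convergence[where w = "\<lambda>x. B * (?D x)\<^sup>2"])
    show "integrable lborel (\<lambda>x. B * (?D x)\<^sup>2)"
      using test_fun_integrable[OF test_fun_mult[OF D D]] by (simp add: power2_eq_square)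
    show "AE x in lborel. norm (\<tau> n x * (?D x)\<^sup>2) \<le> B * (?D x)\<^sup>2" for n
      using \<psi>(5) by (auto simp: abs_mult intro!: mult_right_mono)
    show "AE x in lborel. (\<lambda>n. \<tau> n x * (?D x)\<^sup>2) \<longlonglongrightarrow> (if k < \<phi> x then 1 else 0) * (?D x)\<^sup>2"
      by (intro AE_I2 tendsto_mult \<psi>(7) tendsto_const)
  qed auto
  have "(\<integral>x. (max 0 (\<phi> x - k) - max 0 (- k)) * ?D2 x \<partial>lborel)
      = - (\<integral>x. (if k < \<phi> x then 1 else 0) * (?D x)\<^sup>2 \<partial>lborel)"
    using LIMSEQ_unique[OF lim1[unfolded parts] tendsto_minus[OF lim2]] .
  moreover have "(if k < \<phi> x then 1 else 0) * (?D x)\<^sup>2 = (if k < \<phi> x then (?D x)\<^sup>2 else 0)" for x by simp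
  ultimately show ?thesis by simp
qed

text \<open>The superlevel energy depends continuously on the level, so no level carries energy.\<close>

lemma AE_level_grad_zero:
  fixes \<phi> :: "real^'n \<Rightarrow> real"
  assumes \<phi>: "test_fun U \<phi>"
  shows "AE x in lebesgue. \<phi> x = k \<longrightarrow> grad \<phi> x = 0"
proof -
  have "AE x in lborel. \<phi> x = k \<longrightarrow> pderiv_i i \<phi> x = 0" for i
  proof -
    let ?D = "pderiv_i i \<phi>" and ?D2 = "pderiv_i i (pderiv_i i \<phi>)"
    note D = test_fun_pderiv[OF \<phi>, of i] and D2 = test_fun_pderiv[OF test_fun_pderiv[OF \<phi>, of i], of i]
    note [measurable] = test_fun_measurable[OF \<phi>] test_fun_measurable[OF D] test_fun_measurable[OF D2]
    have iD: "integrable lborel (\<lambda>x. (?D x)\<^sup>2)"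
      using test_fun_integrable[OF test_fun_mult[OF D D]] by (simp add: power2_eq_square)
    have ik: "integrable lborel (\<lambda>x. if Q x then (?D x)\<^sup>2 else 0)"
      if [measurable]: "Measurable.pred borel Q" for Q
      by (rule Bochner_Integration.integrable_bound[OF iD]) auto
    obtain R where R: "\<And>x. \<bar>\<phi> x\<bar> \<le> R" by (rule test_fun_bounded[OF \<phi>]) (rule that)
    define I2 where "I2 = (\<integral>x. \<bar>?D2 x\<bar> \<partial>lborel)"
    define J where "J = (\<integral>x. (if \<phi> x = k then (?D x)\<^sup>2 else 0) \<partial>lborel)"
    have i2: "integrable lborel (\<lambda>x. (max 0 (\<phi> x - l) - max 0 (- l)) * ?D2 x)" for l
    proof (rule Bochner_Integration.integrable_bound)
      show "integrable lborel (\<lambda>x. R * ?D2 x)" using test_fun_integrable[OF D2] by simp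
      show "AE x in lborel. norm ((max 0 (\<phi> x - l) - max 0 (- l)) * ?D2 x) \<le> norm (R * ?D2 x)"
      proof (rule AE_I2)
        fix x
        have "\<bar>max 0 (\<phi> x - l) - max 0 (- l)\<bar> \<le> \<bar>R\<bar>" using R[of x] by (auto simp: max_def)
        then show "norm ((max 0 (\<phi> x - l) - max 0 (- l)) * ?D2 x) \<le> norm (R * ?D2 x)"
          by (simp add: abs_mult mult_right_mono)
      qed
    qed measurable
    \<comment> \<open>The level set lies between the superlevel sets at \<open>k - e\<close> and
      \<open>k\<close>; the right sides of \<open>integral_superlevel_pderiv\<close> at these two
      levels differ by at most \<open>2 * e * I2\<close>.\<close>
    have key: "J \<le> 2 * e * I2" if e: "0 < e" for e
    proof -
      have "J \<le> (\<integral>x. (if k - e < \<phi> x then (?D x)\<^sup>2 else 0) - (if k < \<phi> x then (?D x)\<^sup>2 else 0) \<partial>lborel)"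
        unfolding J_def using e by (intro integral_mono Bochner_Integration.integrable_diff ik) auto
      also have "\<dots> = (\<integral>x. (if k - e < \<phi> x then (?D x)\<^sup>2 else 0) \<partial>lborel) - (\<integral>x. (if k < \<phi> x then (?D x)\<^sup>2 else 0) \<partial>lborel)"
        by (intro Bochner_Integration.integral_diff ik) auto
      also have "\<dots> = (\<integral>x. (max 0 (\<phi> x - k) - max 0 (- k)) * ?D2 x
          - (max 0 (\<phi> x - (k - e)) - max 0 (- (k - e))) * ?D2 x \<partial>lborel)"
        using i2[of k] i2[of "k - e"] by (simp only: integral_superlevel_pderiv[OF \<phi>] Bochner_Integration.integral_diff)
      also have "\<dots> \<le> (\<integral>x. 2 * e * \<bar>?D2 x\<bar> \<partial>lborel)"
      proof (rule integral_mono)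
        show "integrable lborel (\<lambda>x. (max 0 (\<phi> x - k) - max 0 (- k)) * ?D2 x
          - (max 0 (\<phi> x - (k - e)) - max 0 (- (k - e))) * ?D2 x)"
          using i2[of k] i2[of "k - e"] by (rule Bochner_Integration.integrable_diff)
        show "integrable lborel (\<lambda>x. 2 * e * \<bar>?D2 x\<bar>)" using test_fun_integrable[OF D2] by simp
        fix x
        let ?a = "(max 0 (\<phi> x - k) - max 0 (- k)) - (max 0 (\<phi> x - (k - e)) - max 0 (- (k - e)))"
        have "\<bar>?a\<bar> \<le> 2 * e" using e by (auto simp: max_def)
        then have "\<bar>?a * ?D2 x\<bar> \<le> 2 * e * \<bar>?D2 x\<bar>" by (simp add: abs_mult mult_right_mono)
        then show "(max 0 (\<phi> x - k) - max 0 (- k)) * ?D2 x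
          - (max 0 (\<phi> x - (k - e)) - max 0 (- (k - e))) * ?D2 x \<le> 2 * e * \<bar>?D2 x\<bar>"
          unfolding left_diff_distrib[symmetric] by linarith
      qed
      finally show ?thesis by (simp add: I2_def)
    qed
    have I2: "0 \<le> I2" by (simp add: I2_def)
    have "J \<le> 0"
    proof (rule field_le_epsilon)
      fix e :: real assume e: "0 < e"
      have "J \<le> 2 * (e / (2 * (I2 + 1))) * I2" using I2 e by (intro key) auto
      also have "\<dots> \<le> e" using I2 e by (simp add: field_simps)
      finally show "J \<le> 0 + e" by simp
    qed
    moreover have "0 \<le> J" unfolding J_def by (intro integral_nonneg_AE) auto
    ultimately have "J = 0" by simp
    then have "AE x in lborel. (if \<phi> x = k then (?D x)\<^sup>2 else 0) = 0"
      unfolding J_def by (subst (asm) integral_nonneg_eq_0_iff_AE[OF ik]) auto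
    then show ?thesis by eventually_elim (auto split: if_splits)
  qed
  then have "AE x in lborel. \<forall>i. \<phi> x = k \<longrightarrow> pderiv_i i \<phi> x = 0"
    by (intro AE_all_countable[THEN iffD2] allI)
  then have "AE x in lborel. \<phi> x = k \<longrightarrow> grad \<phi> x = 0"
    by eventually_elim (auto simp: grad_def vec_eq_iff)
  then show ?thesis by (rule AE_completion)
qed

section \<open>Energy of truncations\<close>

text \<open>The squared Dirichlet norm of \<open>max 0 (\<phi> - k)\<close>, written out because
  this truncation is in general not a test function.\<close>

definition superlevel_energy :: "(real^'n \<Rightarrow> real) \<Rightarrow> real \<Rightarrow> real" where
  "superlevel_energy \<phi> k = (\<integral>x. (if k < \<phi> x then (norm (grad \<phi> x))\<^sup>2 else 0) \<partial>lebesgue)"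

text \<open>Leaving out the points with vanishing gradient loses nothing, since the drift acts on
  the gradient, and removes the jumps in \<open>k\<close> that level sets of positive measure could
  cause.\<close>

definition superlevel_drift :: "real \<Rightarrow> (real^'n \<Rightarrow> real^'n) \<Rightarrow> (real^'n \<Rightarrow> real) \<Rightarrow> real \<Rightarrow> real" where
  "superlevel_drift p H \<phi> k =
     (\<integral>x. (if k < \<phi> x \<and> grad \<phi> x \<noteq> 0 then norm (H x) powr p else 0) \<partial>lebesgue)"

lemma test_fun_measurable_lebesgue: "test_fun U f \<Longrightarrow> f \<in> borel_measurable lebesgue"
  by (intro measurable_completion) (simp add: test_fun_measurable)

lemma grad_measurable_lebesgue: "test_fun U f \<Longrightarrow> grad f \<in> borel_measurable lebesgue"
  by (intro measurable_completion) (simp add: grad_measurable)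

lemma integrable_superlevel_energy:
  assumes \<phi>: "test_fun U \<phi>"
  shows "integrable lebesgue (\<lambda>x. if k < \<phi> x then (norm (grad \<phi> x))\<^sup>2 else 0)"
proof -
  note [measurable] = test_fun_measurable_lebesgue[OF \<phi>] grad_measurable_lebesgue[OF \<phi>]
  show ?thesis by (rule Bochner_Integration.integrable_bound[OF integrable_grad_square[OF \<phi>]]) auto
qed

lemma superlevel_energy_nonneg: "0 \<le> superlevel_energy \<phi> k"
  unfolding superlevel_energy_def by (intro integral_nonneg_AE) auto

lemma nn_integral_superlevel_energy:
  assumes \<phi>: "test_fun U \<phi>"
  shows "(\<integral>\<^sup>+x. ennreal (if k < \<phi> x then (norm (grad \<phi> x))\<^sup>2 else 0) \<partial>lebesgue) = ennreal (superlevel_energy \<phi> k)"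
  unfolding superlevel_energy_def
  by (rule nn_integral_eq_integral[OF integrable_superlevel_energy[OF \<phi>]]) auto

text \<open>Both bounds hold for the polynomial truncations, which are test functions, and survive
  dominated convergence; \<open>0 \<le> k\<close> makes their limit
  \<open>max 0 (\<phi> - k)\<close> itself.\<close>

lemma truncation_limits:
  fixes \<phi> :: "real^'n \<Rightarrow> real"
  assumes \<phi>: "test_fun U \<phi>" and k: "0 \<le> k" and U: "open U" "bounded U"
    and W: "integrable lebesgue W" and w: "integrable lebesgue w"
    and N: "\<And>\<psi>. test_fun U \<psi> \<Longrightarrow> \<bar>\<integral>x. W x \<bullet> grad \<psi> x + w x * \<psi> x \<partial>lebesgue\<bar> \<le> N * gnorm \<psi>"
    and dim: "CARD('n) \<ge> 3" and d: "d = real CARD('n)"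
  shows "(\<integral>x. (if k < \<phi> x then W x \<bullet> grad \<phi> x else 0) + w x * max 0 (\<phi> x - k) \<partial>lebesgue)
            \<le> N * sqrt (superlevel_energy \<phi> k)" (is ?A)
    and "(\<integral>x. max 0 (\<phi> x - k) powr (2 * d / (d - 2)) \<partial>lebesgue) powr ((d - 2) / (2 * d))
           \<le> 2 * (d - 1) / (d - 2) * sqrt (superlevel_energy \<phi> k)" (is ?B)
proof -
  obtain \<psi> \<tau> B where \<psi>: "\<And>n. test_fun U (\<psi> n)" "\<And>n x. grad (\<psi> n) x = \<tau> n x *\<^sub>R grad \<phi> x"
    "\<And>n. \<tau> n \<in> borel_measurable borel"
    "\<And>n x. \<bar>\<psi> n x\<bar> \<le> B" "\<And>n x. \<bar>\<tau> n x\<bar> \<le> B"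
    "\<And>x. (\<lambda>n. \<psi> n x) \<longlonglongrightarrow> max 0 (\<phi> x - k) - max 0 (- k)"
    "\<And>x. (\<lambda>n. \<tau> n x) \<longlonglongrightarrow> (if k < \<phi> x then 1 else 0)"
    by (rule truncation_sequence[OF \<phi>, of k]) (rule that)
  have lim\<psi>: "(\<lambda>n. \<psi> n x) \<longlonglongrightarrow> max 0 (\<phi> x - k)" for x using \<psi>(6)[of x] k by simp
  have [measurable]: "\<tau> n \<in> borel_measurable lebesgue" for n
    using \<psi>(3) by (intro measurable_completion) simp
  note [measurable] = test_fun_measurable_lebesgue[OF \<phi>] grad_measurable_lebesgue[OF \<phi>]
    test_fun_measurable_lebesgue[OF \<psi>(1)] borel_measurable_integrable[OF W] borel_measurable_integrable[OF w]
  obtain G where G: "0 < G" "\<And>x. norm (grad \<phi> x) \<le> G" by (rule grad_bounded[OF \<phi>]) (rule that)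
  have B: "0 \<le> B" using \<psi>(4)[of undefined undefined] by linarith
  have gn: "(\<lambda>n. gnorm (\<psi> n)) \<longlonglongrightarrow> sqrt (superlevel_energy \<phi> k)"
    unfolding gnorm_def superlevel_energy_def
  proof (rule tendsto_real_sqrt, rule integral_dominated_convergence[where w = "\<lambda>x. B\<^sup>2 * (norm (grad \<phi> x))\<^sup>2"])
    show "integrable lebesgue (\<lambda>x. B\<^sup>2 * (norm (grad \<phi> x))\<^sup>2)" using integrable_grad_square[OF \<phi>] by simp
    show "AE x in lebesgue. norm ((norm (grad (\<psi> n) x))\<^sup>2) \<le> B\<^sup>2 * (norm (grad \<phi> x))\<^sup>2" for n
    proof (rule AE_I2)
      fix x
      have "norm (grad (\<psi> n) x) \<le> B * norm (grad \<phi> x)" using \<psi>(2,5) by (simp add: mult_right_mono)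
      then have "(norm (grad (\<psi> n) x))\<^sup>2 \<le> (B * norm (grad \<phi> x))\<^sup>2" by (rule power_mono) simp
      then show "norm ((norm (grad (\<psi> n) x))\<^sup>2) \<le> B\<^sup>2 * (norm (grad \<phi> x))\<^sup>2" by (simp add: power_mult_distrib)
    qed
    show "AE x in lebesgue. (\<lambda>n. (norm (grad (\<psi> n) x))\<^sup>2) \<longlonglongrightarrow> (if k < \<phi> x then (norm (grad \<phi> x))\<^sup>2 else 0)"
    proof (rule AE_I2)
      fix x
      have "(\<lambda>n. (norm (\<tau> n x *\<^sub>R grad \<phi> x))\<^sup>2) \<longlonglongrightarrow> (norm ((if k < \<phi> x then 1 else 0 :: real) *\<^sub>R grad \<phi> x))\<^sup>2"
        by (intro tendsto_intros \<psi>(7))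
      then show "(\<lambda>n. (norm (grad (\<psi> n) x))\<^sup>2) \<longlonglongrightarrow> (if k < \<phi> x then (norm (grad \<phi> x))\<^sup>2 else 0)"
        by (simp add: \<psi>(2) split: if_splits)
    qed
  qed (auto intro!: borel_measurable_integrable[OF integrable_grad_square[OF \<psi>(1)]])
  have form: "(\<lambda>n. \<integral>x. W x \<bullet> grad (\<psi> n) x + w x * \<psi> n x \<partial>lebesgue) \<longlonglongrightarrow>
      (\<integral>x. (if k < \<phi> x then W x \<bullet> grad \<phi> x else 0) + w x * max 0 (\<phi> x - k) \<partial>lebesgue)"
  proof (rule integral_dominated_convergence[where w = "\<lambda>x. B * G * norm (W x) + B * norm (w x)"])
    show "integrable lebesgue (\<lambda>x. B * G * norm (W x) + B * norm (w x))" using W w by auto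
    show "AE x in lebesgue. norm (W x \<bullet> grad (\<psi> n) x + w x * \<psi> n x) \<le> B * G * norm (W x) + B * norm (w x)" for n
    proof (rule AE_I2)
      fix x
      have "\<bar>W x \<bullet> grad (\<psi> n) x\<bar> \<le> norm (W x) * norm (grad (\<psi> n) x)" by (rule Cauchy_Schwarz_ineq2)
      also have "\<dots> \<le> norm (W x) * (B * G)" using \<psi>(2,5) G B by (auto intro!: mult_left_mono mult_mono)
      finally have "\<bar>W x \<bullet> grad (\<psi> n) x\<bar> \<le> B * G * norm (W x)" by (simp add: mult_ac)
      moreover have "\<bar>w x * \<psi> n x\<bar> \<le> B * norm (w x)"
        using \<psi>(4)[of n x] by (simp add: abs_mult mult.commute[of B] mult_left_mono)
      ultimately show "norm (W x \<bullet> grad (\<psi> n) x + w x * \<psi> n x) \<le> B * G * norm (W x) + B * norm (w x)"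
        by (simp only: real_norm_def abs_triangle_ineq[THEN order_trans] add_mono)
    qed
    show "AE x in lebesgue. (\<lambda>n. W x \<bullet> grad (\<psi> n) x + w x * \<psi> n x) \<longlonglongrightarrow>
        (if k < \<phi> x then W x \<bullet> grad \<phi> x else 0) + w x * max 0 (\<phi> x - k)"
    proof (rule AE_I2)
      fix x
      have "(\<lambda>n. W x \<bullet> (\<tau> n x *\<^sub>R grad \<phi> x) + w x * \<psi> n x) \<longlonglongrightarrow>
          W x \<bullet> ((if k < \<phi> x then 1 else 0 :: real) *\<^sub>R grad \<phi> x) + w x * max 0 (\<phi> x - k)"
        by (intro tendsto_add tendsto_mult tendsto_inner tendsto_scaleR tendsto_const \<psi>(7) lim\<psi>)
      then show "(\<lambda>n. W x \<bullet> grad (\<psi> n) x + w x * \<psi> n x) \<longlonglongrightarrow>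
        (if k < \<phi> x then W x \<bullet> grad \<phi> x else 0) + w x * max 0 (\<phi> x - k)"
        by (simp add: \<psi>(2) split: if_splits)
    qed
    show "(\<lambda>x. W x \<bullet> grad (\<psi> n) x + w x * \<psi> n x) \<in> borel_measurable lebesgue" for n
      using grad_measurable_lebesgue[OF \<psi>(1)] by measurable
  qed measurable
  show ?A
  proof (rule LIMSEQ_le[OF form tendsto_mult[OF tendsto_const gn]], intro exI allI impI)
    fix n
    show "(\<integral>x. W x \<bullet> grad (\<psi> n) x + w x * \<psi> n x \<partial>lebesgue) \<le> N * gnorm (\<psi> n)"
      using N[OF \<psi>(1)[of n]] by linarith
  qed
  define ps where "ps = 2 * d / (d - 2)"
  have ps: "0 < ps" using dim d by (simp add: ps_def)
  have e: "0 < (d - 2) / (2 * d)" using dim d by simp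
  have "(\<lambda>n. \<integral>x. \<bar>\<psi> n x\<bar> powr ps \<partial>lebesgue) \<longlonglongrightarrow> (\<integral>x. max 0 (\<phi> x - k) powr ps \<partial>lebesgue)"
  proof (rule integral_dominated_convergence[where w = "\<lambda>x. indicator U x * B powr ps"])
    show "integrable lebesgue (\<lambda>x. indicator U x * B powr ps)"
      using lmeasurable_open[OF U(2,1)]
      by (intro integrable_mult_left integrable_real_indicator) (auto simp: fmeasurable_def)
    show "AE x in lebesgue. norm (\<bar>\<psi> n x\<bar> powr ps) \<le> indicator U x * B powr ps" for n
    proof (rule AE_I2)
      fix x
      show "norm (\<bar>\<psi> n x\<bar> powr ps) \<le> indicator U x * B powr ps"
        using test_fun_outside[OF \<psi>(1), of x n] \<psi>(4)[of n x] ps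
        by (cases "x \<in> U") (auto intro!: powr_mono2)
    qed
    show "AE x in lebesgue. (\<lambda>n. \<bar>\<psi> n x\<bar> powr ps) \<longlonglongrightarrow> max 0 (\<phi> x - k) powr ps"
    proof (rule AE_I2)
      fix x
      have "(\<lambda>n. \<bar>\<psi> n x\<bar> powr ps) \<longlonglongrightarrow> \<bar>max 0 (\<phi> x - k)\<bar> powr ps"
        using ps by (intro tendsto_powr' tendsto_rabs lim\<psi> tendsto_const) auto
      then show "(\<lambda>n. \<bar>\<psi> n x\<bar> powr ps) \<longlonglongrightarrow> max 0 (\<phi> x - k) powr ps" by simp
    qed
  qed measurable
  then have lim: "(\<lambda>n. (\<integral>x. \<bar>\<psi> n x\<bar> powr ps \<partial>lebesgue) powr ((d - 2) / (2 * d)))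
      \<longlonglongrightarrow> (\<integral>x. max 0 (\<phi> x - k) powr ps \<partial>lebesgue) powr ((d - 2) / (2 * d))"
    using e by (intro tendsto_powr' tendsto_const) auto
  show ?B
    unfolding ps_def[symmetric]
    using Sobolev_inequality[OF \<psi>(1) dim d]
    by (intro LIMSEQ_le[OF lim tendsto_mult[OF tendsto_const gn]]) (auto simp: ps_def)
qed

lemma integrable_superlevel_drift:
  fixes H :: "real^'n \<Rightarrow> real^'n"
  assumes \<phi>: "test_fun U \<phi>"
    and H: "H \<in> borel_measurable lebesgue" "integrable lebesgue (\<lambda>x. norm (H x) powr p)"
    and Q: "Measurable.pred lebesgue Q"
  shows "integrable lebesgue (\<lambda>x. if Q x \<and> grad \<phi> x \<noteq> 0 then norm (H x) powr p else 0)"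
proof -
  note [measurable] = test_fun_measurable_lebesgue[OF \<phi>] grad_measurable_lebesgue[OF \<phi>] H(1) Q
  show ?thesis by (rule Bochner_Integration.integrable_bound[OF H(2)]) auto
qed

text \<open>Along levels tending to \<open>k\<close> the cut-offs converge except where
  \<open>\<phi> x = k\<close> and the gradient is nonzero, a null set by
  \<open>AE_level_grad_zero\<close>.\<close>

lemma superlevel_drift_continuous:
  fixes H :: "real^'n \<Rightarrow> real^'n"
  assumes \<phi>: "test_fun U \<phi>"
    and H: "H \<in> borel_measurable lebesgue" "integrable lebesgue (\<lambda>x. norm (H x) powr p)"
  shows "continuous_on S (superlevel_drift p H \<phi>)"
proof (intro continuous_at_imp_continuous_on ballI continuous_at_sequentiallyI)
  fix k and s :: "nat \<Rightarrow> real" assume s: "s \<longlonglongrightarrow> k"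
  note [measurable] = test_fun_measurable_lebesgue[OF \<phi>] grad_measurable_lebesgue[OF \<phi>] H(1)
  show "(\<lambda>n. superlevel_drift p H \<phi> (s n)) \<longlonglongrightarrow> superlevel_drift p H \<phi> k"
    unfolding superlevel_drift_def
  proof (rule integral_dominated_convergence[where w = "\<lambda>x. norm (H x) powr p"])
    show "AE x in lebesgue. (\<lambda>n. if s n < \<phi> x \<and> grad \<phi> x \<noteq> 0 then norm (H x) powr p else 0)
        \<longlonglongrightarrow> (if k < \<phi> x \<and> grad \<phi> x \<noteq> 0 then norm (H x) powr p else 0)"
      using AE_level_grad_zero[OF \<phi>, of k]
    proof eventually_elim
      case (elim x)
      consider "grad \<phi> x = 0" | "k < \<phi> x" | "\<phi> x < k" using elim by linarith
      then show ?case
      proof cases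
        case 1
        then show ?thesis by simp
      next
        case 2
        then have "\<forall>\<^sub>F n in sequentially. s n < \<phi> x" using order_tendstoD(2)[OF s] by blast
        then show ?thesis using 2 by (intro tendsto_eventually, elim eventually_mono) auto
      next
        case 3
        then have "\<forall>\<^sub>F n in sequentially. \<phi> x < s n" using order_tendstoD(1)[OF s] by blast
        then show ?thesis using 3 by (intro tendsto_eventually, elim eventually_mono) auto
      qed
    qed
  qed (use H in auto)
qed

text \<open>Testing with the truncation at \<open>k\<close> leaves the drift term, split at
  \<open>k'\<close>. On the strip the drift can be made small but the full energy \<open>z k\<close>
  is paid; above \<open>k'\<close> the drift is only bounded, but the energy is \<open>z k'\<close>,
  which an induction on levels can control beforehand. Hoelder's exponents \<open>d\<close>, 2 and
  \<open>ps\<close> fit both pieces, and Sobolev's inequality turns the factor in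
  \<open>L^ps\<close> into \<open>z k\<close>.\<close>

lemma truncated_energy_estimate:
  fixes \<phi> :: "real^'n \<Rightarrow> real" and H :: "real^'n \<Rightarrow> real^'n"
  assumes \<phi>: "test_fun U \<phi>" and k: "0 \<le> k" "k \<le> k'" and U: "open U" "bounded U"
    and W: "integrable lebesgue W" and w: "integrable lebesgue w"
    and N: "\<And>\<psi>. test_fun U \<psi> \<Longrightarrow> \<bar>\<integral>x. W x \<bullet> grad \<psi> x + w x * \<psi> x \<partial>lebesgue\<bar> \<le> N * gnorm \<psi>"
    and dim: "CARD('n) \<ge> 3" and d: "d = real CARD('n)"
    and H: "H \<in> borel_measurable lebesgue" "integrable lebesgue (\<lambda>x. norm (H x) powr d)"
    and ellip: "AE x in lebesgue. lam * (norm (grad \<phi> x))\<^sup>2 \<le> W x \<bullet> grad \<phi> x"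
    and drift: "AE x in lebesgue. - (norm (H x) * norm (grad \<phi> x) * \<bar>\<phi> x\<bar>) \<le> w x * \<phi> x"
  defines "z \<equiv> \<lambda>k. sqrt (superlevel_energy \<phi> k)" and "S \<equiv> 2 * (d - 1) / (d - 2)"
  shows "lam * (z k)\<^sup>2 \<le> N * z k + S * z k *
     ((superlevel_drift d H \<phi> k - superlevel_drift d H \<phi> k') powr (1 / d) * z k
      + (\<integral>x. norm (H x) powr d \<partial>lebesgue) powr (1 / d) * z k')"
proof -
  let ?h = "superlevel_drift d H \<phi>"
  let ?K = "\<integral>x. norm (H x) powr d \<partial>lebesgue"
  define ps where "ps = 2 * d / (d - 2)"
  define \<psi> where "\<psi> x = max 0 (\<phi> x - k)" for x
  define X where "X = (\<integral>x. \<psi> x powr ps \<partial>lebesgue)"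
  have d3: "d \<ge> 3" using dim d by simp
  have ps: "0 < ps" "1 / ps = (d - 2) / (2 * d)" "1 / d + 1 / 2 + 1 / ps = 1"
    using d3 by (auto simp: ps_def field_simps)
  note [measurable] = test_fun_measurable_lebesgue[OF \<phi>] grad_measurable_lebesgue[OF \<phi>] H(1)
    borel_measurable_integrable[OF W] borel_measurable_integrable[OF w]
  have m\<psi> [measurable]: "\<psi> \<in> borel_measurable lebesgue" unfolding \<psi>_def by measurable
  have \<psi>0: "0 \<le> \<psi> x" "\<psi> x \<le> \<bar>\<phi> x\<bar>" for x using k by (auto simp: \<psi>_def)
  have z0: "0 \<le> z l" "(z l)\<^sup>2 = superlevel_energy \<phi> l" for l
    using superlevel_energy_nonneg by (auto simp: z_def)
  have i\<psi>: "integrable lebesgue (\<lambda>x. \<psi> x powr ps)"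
    using \<psi>0 ps by (intro Bochner_Integration.integrable_bound[OF integrable_test_fun_powr[OF \<phi> ps(1)]])
      (auto intro!: powr_mono2)
  have X: "(\<integral>\<^sup>+x. ennreal (\<psi> x powr ps) \<partial>lebesgue) = ennreal X" "0 \<le> X"
    using i\<psi> by (auto simp: X_def nn_integral_eq_integral)
  have Xz: "X powr (1 / ps) \<le> S * z k"
    using truncation_limits(2)[OF \<phi> k(1) U W w N dim d] by (simp add: X_def \<psi>_def ps(2) S_def z_def) (simp add: ps_def)
  obtain R where R: "0 < R" "\<And>x. \<bar>\<phi> x\<bar> \<le> R" by (rule test_fun_bounded[OF \<phi>]) (rule that)
  obtain G where G: "0 < G" "\<And>x. norm (grad \<phi> x) \<le> G" by (rule grad_bounded[OF \<phi>]) (rule that)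
  \<comment> \<open>Hoelder and Sobolev on one piece: \<open>Q\<close> localises the drift and
    \<open>l\<close> the gradient. It is used for the strip with \<open>l = k\<close> and for the
    region above \<open>k'\<close> with \<open>l = k'\<close>.\<close>
  have piece: "integrable lebesgue (\<lambda>x. (if Q x \<and> grad \<phi> x \<noteq> 0 then norm (H x) else 0) *
          (if l < \<phi> x then norm (grad \<phi> x) else 0) * \<psi> x)"
      "(\<integral>x. (if Q x \<and> grad \<phi> x \<noteq> 0 then norm (H x) else 0) *
          (if l < \<phi> x then norm (grad \<phi> x) else 0) * \<psi> x \<partial>lebesgue)
        \<le> (\<integral>x. (if Q x \<and> grad \<phi> x \<noteq> 0 then norm (H x) powr d else 0) \<partial>lebesgue) powr (1 / d) * z l * (S * z k)"
      if Q [measurable]: "Measurable.pred lebesgue Q" for Q l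
  proof -
    let ?a = "\<lambda>x. if Q x \<and> grad \<phi> x \<noteq> 0 then norm (H x) else 0"
    let ?b = "\<lambda>x. if l < \<phi> x then norm (grad \<phi> x) else 0"
    let ?I = "\<integral>x. (if Q x \<and> grad \<phi> x \<noteq> 0 then norm (H x) powr d else 0) \<partial>lebesgue"
    have I0: "0 \<le> ?I" by (intro integral_nonneg_AE) auto
    have "(\<integral>\<^sup>+x. ennreal (?a x * ?b x * \<psi> x) \<partial>lebesgue)
        \<le> ennreal (?I powr (1 / d) * superlevel_energy \<phi> l powr (1 / 2) * X powr (1 / ps))"
    proof (rule Holder_powr3[where p = d and q = 2 and r = ps])
      have "(\<integral>\<^sup>+x. ennreal (?a x powr d) \<partial>lebesgue)
          = (\<integral>\<^sup>+x. ennreal (if Q x \<and> grad \<phi> x \<noteq> 0 then norm (H x) powr d else 0) \<partial>lebesgue)"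
        by (rule nn_integral_cong) simp
      also have "\<dots> = ennreal ?I"
        by (rule nn_integral_eq_integral[OF integrable_superlevel_drift[OF \<phi> H Q]]) auto
      finally show "(\<integral>\<^sup>+x. ennreal (?a x powr d) \<partial>lebesgue) \<le> ennreal ?I" by simp
      have "(\<integral>\<^sup>+x. ennreal (?b x powr 2) \<partial>lebesgue)
          = (\<integral>\<^sup>+x. ennreal (if l < \<phi> x then (norm (grad \<phi> x))\<^sup>2 else 0) \<partial>lebesgue)"
        by (rule nn_integral_cong) (auto simp: powr_numeral)
      then show "(\<integral>\<^sup>+x. ennreal (?b x powr 2) \<partial>lebesgue) \<le> ennreal (superlevel_energy \<phi> l)"
        by (simp add: nn_integral_superlevel_energy[OF \<phi>])
    qed (use \<psi>0 X I0 ps d3 superlevel_energy_nonneg in auto)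
    also have "\<dots> \<le> ennreal (?I powr (1 / d) * z l * (S * z k))"
      using Xz superlevel_energy_nonneg[of \<phi> l] by (intro ennreal_leI mult_mono) (auto simp: z_def powr_half_sqrt)
    finally have le: "(\<integral>\<^sup>+x. ennreal (?a x * ?b x * \<psi> x) \<partial>lebesgue) \<le> ennreal (?I powr (1 / d) * z l * (S * z k))" .
    show int: "integrable lebesgue (\<lambda>x. ?a x * ?b x * \<psi> x)"
    proof (rule integrableI_bounded)
      have "(\<integral>\<^sup>+x. ennreal (norm (?a x * ?b x * \<psi> x)) \<partial>lebesgue) = (\<integral>\<^sup>+x. ennreal (?a x * ?b x * \<psi> x) \<partial>lebesgue)"
        using \<psi>0 by (intro nn_integral_cong) (auto simp: abs_mult)
      then show "(\<integral>\<^sup>+x. ennreal (norm (?a x * ?b x * \<psi> x)) \<partial>lebesgue) < \<infinity>"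
        using le by (simp add: order.strict_trans1)
    qed measurable
    have "(\<integral>\<^sup>+x. ennreal (?a x * ?b x * \<psi> x) \<partial>lebesgue) = ennreal (\<integral>x. ?a x * ?b x * \<psi> x \<partial>lebesgue)"
      using \<psi>0 by (intro nn_integral_eq_integral[OF int]) auto
    then have "ennreal (\<integral>x. ?a x * ?b x * \<psi> x \<partial>lebesgue) \<le> ennreal (?I powr (1 / d) * z l * (S * z k))"
      using le by simp
    moreover have "0 \<le> ?I powr (1 / d) * z l * (S * z k)"
      using z0 d3 by (intro mult_nonneg_nonneg) (auto simp: S_def)
    ultimately show "(\<integral>x. ?a x * ?b x * \<psi> x \<partial>lebesgue) \<le> ?I powr (1 / d) * z l * (S * z k)"
      by (simp add: ennreal_le_iff)
  qed
  let ?Q1 = "\<lambda>x. k < \<phi> x \<and> \<phi> x \<le> k'" and ?Q2 = "\<lambda>x. k' < \<phi> x"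
  let ?p1 = "\<lambda>x. (if ?Q1 x \<and> grad \<phi> x \<noteq> 0 then norm (H x) else 0) * (if k < \<phi> x then norm (grad \<phi> x) else 0) * \<psi> x"
  let ?p2 = "\<lambda>x. (if ?Q2 x \<and> grad \<phi> x \<noteq> 0 then norm (H x) else 0) * (if k' < \<phi> x then norm (grad \<phi> x) else 0) * \<psi> x"
  have mQ: "Measurable.pred lebesgue ?Q1" "Measurable.pred lebesgue ?Q2" by measurable
  have h1: "(\<integral>x. (if ?Q1 x \<and> grad \<phi> x \<noteq> 0 then norm (H x) powr d else 0) \<partial>lebesgue) = ?h k - ?h k'"
  proof -
    have "(\<integral>x. (if ?Q1 x \<and> grad \<phi> x \<noteq> 0 then norm (H x) powr d else 0) \<partial>lebesgue)
       = (\<integral>x. (if k < \<phi> x \<and> grad \<phi> x \<noteq> 0 then norm (H x) powr d else 0)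
           - (if k' < \<phi> x \<and> grad \<phi> x \<noteq> 0 then norm (H x) powr d else 0) \<partial>lebesgue)"
      using k by (intro Bochner_Integration.integral_cong) auto
    also have "\<dots> = ?h k - ?h k'"
      unfolding superlevel_drift_def
      by (intro Bochner_Integration.integral_diff integrable_superlevel_drift[OF \<phi> H]) measurable
    finally show ?thesis .
  qed
  have h2: "(\<integral>x. (if ?Q2 x \<and> grad \<phi> x \<noteq> 0 then norm (H x) powr d else 0) \<partial>lebesgue) \<le> ?K"
    by (intro integral_mono integrable_superlevel_drift[OF \<phi> H] H mQ) auto
  have iW: "integrable lebesgue (\<lambda>x. if k < \<phi> x then W x \<bullet> grad \<phi> x else 0)"
  proof (rule Bochner_Integration.integrable_bound)
    show "integrable lebesgue (\<lambda>x. G * norm (W x))" using W by simp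
    show "AE x in lebesgue. norm (if k < \<phi> x then W x \<bullet> grad \<phi> x else 0) \<le> norm (G * norm (W x))"
    proof (rule AE_I2)
      fix x
      have "\<bar>W x \<bullet> grad \<phi> x\<bar> \<le> norm (W x) * norm (grad \<phi> x)" by (rule Cauchy_Schwarz_ineq2)
      also have "\<dots> \<le> norm (W x) * G" using G by (intro mult_left_mono) auto
      finally show "norm (if k < \<phi> x then W x \<bullet> grad \<phi> x else 0) \<le> norm (G * norm (W x))"
        using G by (auto simp: mult.commute)
    qed
  qed measurable
  have iw: "integrable lebesgue (\<lambda>x. w x * \<psi> x)"
  proof (rule Bochner_Integration.integrable_bound)
    show "integrable lebesgue (\<lambda>x. R * norm (w x))" using w by simp
    show "AE x in lebesgue. norm (w x * \<psi> x) \<le> norm (R * norm (w x))"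
    proof (rule AE_I2)
      fix x
      have "\<bar>\<psi> x\<bar> \<le> R" using \<psi>0[of x] R(2)[of x] by linarith
      then show "norm (w x * \<psi> x) \<le> norm (R * norm (w x))"
        using R by (simp add: abs_mult mult.commute[of R] mult_left_mono)
    qed
  qed measurable
  have "lam * (z k)\<^sup>2 = (\<integral>x. lam * (if k < \<phi> x then (norm (grad \<phi> x))\<^sup>2 else 0) \<partial>lebesgue)"
    unfolding z0 superlevel_energy_def by simp
  also have "\<dots> \<le> (\<integral>x. (if k < \<phi> x then W x \<bullet> grad \<phi> x else 0) \<partial>lebesgue)"
    using iW integrable_superlevel_energy[OF \<phi>, of k] ellip by (intro integral_mono_AE) (auto elim: eventually_mono)
  also have "\<dots> = (\<integral>x. (if k < \<phi> x then W x \<bullet> grad \<phi> x else 0) + w x * \<psi> x \<partial>lebesgue) - (\<integral>x. w x * \<psi> x \<partial>lebesgue)"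
    using iW iw by simp
  also have "\<dots> \<le> N * z k + (\<integral>x. ?p1 x + ?p2 x \<partial>lebesgue)"
  proof -
    have "(\<integral>x. - (w x * \<psi> x) \<partial>lebesgue) \<le> (\<integral>x. ?p1 x + ?p2 x \<partial>lebesgue)"
    proof (rule integral_mono_AE)
      show "AE x in lebesgue. - (w x * \<psi> x) \<le> ?p1 x + ?p2 x"
        using drift
      proof eventually_elim
        case (elim x)
        show ?case
        \<comment> \<open>The hypothesis controls \<open>w * \<phi>\<close>, but the function tested
          with is the truncation: where \<open>\<phi> x > k \<ge> 0\<close>, division by the
          positive \<open>\<phi> x\<close> and multiplication by \<open>\<psi> x\<close> transfer
          the bound.\<close>
        proof (cases "k < \<phi> x")
          case True
          then have p: "0 < \<phi> x" "0 < \<psi> x" using k by (auto simp: \<psi>_def)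
          have "- (norm (H x) * norm (grad \<phi> x) * \<phi> x) \<le> w x * \<phi> x" using elim p by simp
          then have "(- (norm (H x) * norm (grad \<phi> x))) * \<phi> x \<le> w x * \<phi> x" by simp
          then have "- (norm (H x) * norm (grad \<phi> x)) \<le> w x" using p by (simp only: mult_le_cancel_right_pos)
          then have "(- (norm (H x) * norm (grad \<phi> x))) * \<psi> x \<le> w x * \<psi> x" using p by (intro mult_right_mono) auto
          then show ?thesis using True k by auto
        next
          case False
          then have "\<psi> x = 0" by (simp add: \<psi>_def)
          then show ?thesis by simp
        qed
      qed
    qed (use iw piece(1)[OF mQ(1), of k] piece(1)[OF mQ(2), of k'] in \<open>auto intro!: Bochner_Integration.integrable_add\<close>)
    moreover have "(\<integral>x. (if k < \<phi> x then W x \<bullet> grad \<phi> x else 0) + w x * \<psi> x \<partial>lebesgue) \<le> N * z k"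
      using truncation_limits(1)[OF \<phi> k(1) U W w N dim d] by (simp add: \<psi>_def z_def)
    ultimately show ?thesis by simp
  qed
  also have "(\<integral>x. ?p1 x + ?p2 x \<partial>lebesgue) = (\<integral>x. ?p1 x \<partial>lebesgue) + (\<integral>x. ?p2 x \<partial>lebesgue)"
    using piece(1)[OF mQ(1), of k] piece(1)[OF mQ(2), of k'] by (rule Bochner_Integration.integral_add)
  also have "\<dots> \<le> (?h k - ?h k') powr (1 / d) * z k * (S * z k) + ?K powr (1 / d) * z k' * (S * z k)"
  proof (rule add_mono)
    show "(\<integral>x. ?p1 x \<partial>lebesgue) \<le> (?h k - ?h k') powr (1 / d) * z k * (S * z k)"
      using piece(2)[OF mQ(1), of k] by (simp only: h1)
    have "0 \<le> S * z k" using z0 d3 by (auto simp: S_def)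
    moreover have "0 \<le> (\<integral>x. (if ?Q2 x \<and> grad \<phi> x \<noteq> 0 then norm (H x) powr d else 0) \<partial>lebesgue)"
      by (intro integral_nonneg_AE) auto
    ultimately have "(\<integral>x. (if ?Q2 x \<and> grad \<phi> x \<noteq> 0 then norm (H x) powr d else 0) \<partial>lebesgue) powr (1 / d) * z k' * (S * z k)
        \<le> ?K powr (1 / d) * z k' * (S * z k)"
      using h2 z0 d3 by (intro mult_right_mono powr_mono2) auto
    then show "(\<integral>x. ?p2 x \<partial>lebesgue) \<le> ?K powr (1 / d) * z k' * (S * z k)"
      using piece(2)[OF mQ(2), of k'] by linarith
  qed
  finally show ?thesis by (simp add: algebra_simps)
qed

section \<open>The a priori estimate\<close>

text \<open>One strip leads to \<open>lam / 2 * z \<le> (1 + s * C) * N\<close> with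
  \<open>C\<close> the constant above the strip; solving for \<open>z\<close> gives the second
  summand, and the first keeps the sequence nondecreasing.\<close>

fun level_const :: "real \<Rightarrow> real \<Rightarrow> nat \<Rightarrow> real" where
  "level_const lam s 0 = 1 / lam"
| "level_const lam s (Suc m) = level_const lam s m + 2 / lam * (1 + s * level_const lam s m)"

lemma level_const_nonneg: "0 < lam \<Longrightarrow> 0 \<le> s \<Longrightarrow> 0 \<le> level_const lam s m"
  by (induction m) auto

text \<open>Here \<open>z k\<close> is the energy of \<open>\<phi>\<close> above level \<open>k\<close> and \<open>h k\<close> the mass of the drift there. Every step
  of the induction descends through one strip of drift mass \<open>e\<close>, which the ellipticity absorbs.\<close>

lemma level_induction:
  fixes z h :: "real \<Rightarrow> real"
  assumes step: "\<And>k k'. 0 \<le> k \<Longrightarrow> k \<le> k' \<Longrightarrow>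
      lam * (z k)\<^sup>2 \<le> N * z k + S * z k * ((h k - h k') powr q * z k + K * z k')"
    and z: "\<And>k. 0 \<le> z k" and anti: "\<And>k k'. k \<le> k' \<Longrightarrow> h k' \<le> h k"
    and cont: "continuous_on UNIV h" and R: "\<And>k. R \<le> k \<Longrightarrow> z k = 0" "\<And>k. R \<le> k \<Longrightarrow> h k = 0"
    and pos: "0 < lam" "0 \<le> S" "0 \<le> K" "0 \<le> N" "0 < q" "0 < e"
    and e: "S * e powr q \<le> lam / 2"
    and k: "0 \<le> k" "h k \<le> real m * e"
  shows "z k \<le> level_const lam (S * K) m * N"
  using k
proof (induction m arbitrary: k)
  case 0
  \<comment> \<open>Beyond \<open>R\<close> both \<open>z\<close> and \<open>h\<close> vanish, and
    here \<open>h k = 0\<close> as well, so stepping from \<open>k\<close> to \<open>max k R\<close>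
    removes every drift term.\<close>
  let ?k = "max k R"
  have "h ?k = 0" "h ?k \<le> h k" using R(2)[of ?k] anti[of k ?k] by auto
  then have "h k - h ?k = 0" using 0 by simp
  then have "lam * (z k)\<^sup>2 \<le> N * z k" using step[of k ?k] 0 R(1)[of ?k] by simp
  then have "z k = 0 \<or> lam * z k \<le> N"
    using z[of k] by (auto simp: power2_eq_square mult.assoc[symmetric] mult_le_cancel_right)
  then show ?case using pos by (auto simp: field_simps)
next
  case (Suc m)
  let ?C = "level_const lam (S * K)"
  have C: "0 \<le> ?C m" using pos by (intro level_const_nonneg) auto
  show ?case
  proof (cases "h k \<le> real m * e")
    case True
    then have "z k \<le> ?C m * N" using Suc by blast
    also have "\<dots> \<le> ?C (Suc m) * N" using pos C by (intro mult_right_mono) auto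
    finally show ?thesis .
  next
    case False
    \<comment> \<open>Continuity of \<open>h\<close> gives a level with drift mass exactly
      \<open>m * e\<close> above it; the strip in between carries at most \<open>e\<close>.\<close>
    have "\<exists>k'. k \<le> k' \<and> k' \<le> max k R \<and> h k' = real m * e"
      using False R(2)[of "max k R"] pos
      by (intro IVT2') (auto intro: continuous_on_subset[OF cont])
    then obtain k' where k': "k \<le> k'" "h k' = real m * e" by blast
    have IH: "z k' \<le> ?C m * N" using Suc k' by (intro Suc.IH) auto
    have "h k - h k' \<le> e" using Suc.prems k' by (simp add: algebra_simps)
    then have "(h k - h k') powr q \<le> e powr q" using anti[OF k'(1)] pos by (intro powr_mono2) auto
    then have "(h k - h k') powr q * z k + K * z k' \<le> e powr q * z k + K * (?C m * N)"
      using z[of k] IH pos by (intro add_mono mult_right_mono mult_left_mono) auto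
    then have "S * z k * ((h k - h k') powr q * z k + K * z k') \<le> S * z k * (e powr q * z k + K * (?C m * N))"
      using z[of k] pos by (intro mult_left_mono) auto
    then have "lam * (z k)\<^sup>2 \<le> N * z k + S * z k * (e powr q * z k + K * (?C m * N))"
      using step[OF Suc.prems(1) k'(1)] by linarith
    then have "z k * (lam * z k) \<le> z k * (N + (S * e powr q) * z k + S * K * ?C m * N)"
      by (simp add: power2_eq_square algebra_simps)
    then have "z k = 0 \<or> lam * z k \<le> N + (S * e powr q) * z k + S * K * ?C m * N"
      using z[of k] by (auto simp: mult_le_cancel_left)
    then show ?thesis
    proof
      assume "z k = 0"
      then show ?thesis using pos by (simp only:) (intro mult_nonneg_nonneg level_const_nonneg; simp)
    next
      assume "lam * z k \<le> N + (S * e powr q) * z k + S * K * ?C m * N"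
      moreover have "(S * e powr q) * z k \<le> lam / 2 * z k" using e z[of k] by (rule mult_right_mono)
      ultimately have "lam / 2 * z k \<le> (1 + S * K * ?C m) * N" by (simp add: algebra_simps)
      then have "z k \<le> 2 / lam * (1 + S * K * ?C m) * N" using pos by (simp add: field_simps)
      also have "\<dots> \<le> ?C (Suc m) * N" using C pos by (intro mult_right_mono) auto
      finally show ?thesis .
    qed
  qed
qed

lemma superlevel_drift_antimono:
  fixes H :: "real^'n \<Rightarrow> real^'n"
  assumes \<phi>: "test_fun U \<phi>"
    and H: "H \<in> borel_measurable lebesgue" "integrable lebesgue (\<lambda>x. norm (H x) powr p)" and "k \<le> k'"
  shows "superlevel_drift p H \<phi> k' \<le> superlevel_drift p H \<phi> k"
proof -
  note [measurable] = test_fun_measurable_lebesgue[OF \<phi>]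
  show ?thesis
    unfolding superlevel_drift_def using \<open>k \<le> k'\<close>
    by (intro integral_mono integrable_superlevel_drift[OF \<phi> H]) auto
qed

text \<open>\<open>C\<close> is chosen before \<phi>, \<open>W\<close>, \<open>w\<close> and
  \<open>N\<close>: the strips themselves depend on \<phi>, but their number is fixed by the total
  drift mass \<open>K\<close>.\<close>

theorem apriori_estimate:
  fixes U :: "(real^'n) set" and H :: "real^'n \<Rightarrow> real^'n"
  assumes U: "open U" "bounded U" and dim: "CARD('n) \<ge> 3" and d: "d = real CARD('n)"
    and lam: "0 < lam"
    and H: "H \<in> borel_measurable lebesgue" "integrable lebesgue (\<lambda>x. norm (H x) powr d)"
  shows "\<exists>C\<ge>0. \<forall>\<phi> W w N. test_fun U \<phi> \<longrightarrow> integrable lebesgue W \<longrightarrow> integrable lebesgue w \<longrightarrow> 0 \<le> N \<longrightarrow>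
      (\<forall>\<psi>. test_fun U \<psi> \<longrightarrow> \<bar>\<integral>x. W x \<bullet> grad \<psi> x + w x * \<psi> x \<partial>lebesgue\<bar> \<le> N * gnorm \<psi>) \<longrightarrow>
      (AE x in lebesgue. lam * (norm (grad \<phi> x))\<^sup>2 \<le> W x \<bullet> grad \<phi> x) \<longrightarrow>
      (AE x in lebesgue. - (norm (H x) * norm (grad \<phi> x) * \<bar>\<phi> x\<bar>) \<le> w x * \<phi> x) \<longrightarrow>
      gnorm \<phi> \<le> C * N"
proof -
  define S where "S = 2 * (d - 1) / (d - 2)"
  define K where "K = (\<integral>x. norm (H x) powr d \<partial>lebesgue)"
  have d3: "d \<ge> 3" using dim d by simp
  have S: "0 < S" using d3 by (simp add: S_def)
  \<comment> \<open>Solves \<open>S * e powr (1 / d) = lam / 2\<close>: the strip size that half of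
    the ellipticity can absorb.\<close>
  define e where "e = (lam / (2 * S)) powr d"
  have e: "0 < e" "S * e powr (1 / d) \<le> lam / 2" using lam S d3 by (auto simp: e_def powr_powr)
  obtain m :: nat where "K / e < real m" using reals_Archimedean2 by blast
  then have m: "K \<le> real m * e" using e by (simp add: field_simps)
  define C where "C = level_const lam (S * K powr (1 / d)) m"
  have C: "0 \<le> C" using lam S by (simp add: C_def level_const_nonneg)
  have half: "sqrt (superlevel_energy \<phi> 0) \<le> C * N"
    if \<phi>: "test_fun U \<phi>" and W: "integrable lebesgue W" "integrable lebesgue w" and N: "0 \<le> N"
      "\<And>\<psi>. test_fun U \<psi> \<Longrightarrow> \<bar>\<integral>x. W x \<bullet> grad \<psi> x + w x * \<psi> x \<partial>lebesgue\<bar> \<le> N * gnorm \<psi>"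
      and ae: "AE x in lebesgue. lam * (norm (grad \<phi> x))\<^sup>2 \<le> W x \<bullet> grad \<phi> x"
        "AE x in lebesgue. - (norm (H x) * norm (grad \<phi> x) * \<bar>\<phi> x\<bar>) \<le> w x * \<phi> x"
    for \<phi> W w N
  proof -
    obtain R where R: "0 < R" "\<And>x. \<bar>\<phi> x\<bar> \<le> R" by (rule test_fun_bounded[OF \<phi>]) (rule that)
    have nolevel: "\<not> k < \<phi> x" if "R \<le> k" for k x using R(2)[of x] that by linarith
    show ?thesis
      unfolding C_def
    proof (rule level_induction[where z = "\<lambda>k. sqrt (superlevel_energy \<phi> k)" and h = "superlevel_drift d H \<phi>"
          and q = "1 / d" and e = e and R = R and k = 0])
      fix k k' :: real assume "0 \<le> k" "k \<le> k'"
      then show "lam * (sqrt (superlevel_energy \<phi> k))\<^sup>2 \<le> N * sqrt (superlevel_energy \<phi> k) + S * sqrt (superlevel_energy \<phi> k) *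
         ((superlevel_drift d H \<phi> k - superlevel_drift d H \<phi> k') powr (1 / d) * sqrt (superlevel_energy \<phi> k)
          + K powr (1 / d) * sqrt (superlevel_energy \<phi> k'))"
        unfolding S_def K_def
        by (intro truncated_energy_estimate[OF \<phi> _ _ U W N(2) dim d H ae]) auto
    next
      show "continuous_on UNIV (superlevel_drift d H \<phi>)" by (rule superlevel_drift_continuous[OF \<phi> H])
      show "superlevel_drift d H \<phi> k' \<le> superlevel_drift d H \<phi> k" if "k \<le> k'" for k k'
        by (rule superlevel_drift_antimono[OF \<phi> H that])
      show "sqrt (superlevel_energy \<phi> k) = 0" if "R \<le> k" for k
        using nolevel[OF that] by (simp add: superlevel_energy_def)
      show "superlevel_drift d H \<phi> k = 0" if "R \<le> k" for k
        using nolevel[OF that] by (simp add: superlevel_drift_def)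
      have "superlevel_drift d H \<phi> 0 \<le> K"
        unfolding superlevel_drift_def K_def
        using test_fun_measurable_lebesgue[OF \<phi>]
        by (intro integral_mono integrable_superlevel_drift[OF \<phi> H] H) auto
      then show "superlevel_drift d H \<phi> 0 \<le> real m * e" using m by linarith
    qed (use superlevel_energy_nonneg lam S N(1) d3 e in auto)
  qed
  show ?thesis
  proof (intro exI[of _ "2 * C"] conjI allI impI)
    fix \<phi> w :: "real^'n \<Rightarrow> real" and W :: "real^'n \<Rightarrow> real^'n" and N :: real
    assume \<phi>: "test_fun U \<phi>" and W: "integrable lebesgue W" "integrable lebesgue w" and N0: "0 \<le> N"
      and N': "\<forall>\<psi>. test_fun U \<psi> \<longrightarrow> \<bar>\<integral>x. W x \<bullet> grad \<psi> x + w x * \<psi> x \<partial>lebesgue\<bar> \<le> N * gnorm \<psi>"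
      and ae: "AE x in lebesgue. lam * (norm (grad \<phi> x))\<^sup>2 \<le> W x \<bullet> grad \<phi> x"
        "AE x in lebesgue. - (norm (H x) * norm (grad \<phi> x) * \<bar>\<phi> x\<bar>) \<le> w x * \<phi> x"
    note N = N0 N'[rule_format]
    let ?n = "\<lambda>x. - \<phi> x"
    have n: "test_fun U ?n" using test_fun_scale[OF \<phi>, of "- 1"] by simp
    have gn: "grad ?n x = - grad \<phi> x" for x
      using grad_lin[OF test_fun_zero \<phi>, of "- 1" x] by (simp add: grad_zero)
    have P: "sqrt (superlevel_energy \<phi> 0) \<le> C * N" by (rule half[OF \<phi> W N ae])
    have Q: "sqrt (superlevel_energy ?n 0) \<le> C * N"
    proof (rule half[OF n, of "\<lambda>x. - W x" "\<lambda>x. - w x"])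
      fix \<psi> assume \<psi>: "test_fun U \<psi>"
      have "(\<integral>x. - W x \<bullet> grad \<psi> x + - w x * \<psi> x \<partial>lebesgue) = - (\<integral>x. W x \<bullet> grad \<psi> x + w x * \<psi> x \<partial>lebesgue)"
        by (subst Bochner_Integration.integral_minus[symmetric]) (auto intro!: Bochner_Integration.integral_cong)
      then show "\<bar>\<integral>x. - W x \<bullet> grad \<psi> x + - w x * \<psi> x \<partial>lebesgue\<bar> \<le> N * gnorm \<psi>" using N(2)[OF \<psi>] by simp
    qed (use W N ae in \<open>auto simp: gn\<close>)
    \<comment> \<open>The estimate above level 0 sees only the positive part;
      \<open>- \<phi>\<close> supplies the negative part, and the gradient vanishes almost
      everywhere on the zero set. Hence the factor 2 in the constant.\<close>
    have "(gnorm \<phi>)\<^sup>2 = (\<integral>x. (if 0 < \<phi> x then (norm (grad \<phi> x))\<^sup>2 else 0)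
        + (if 0 < ?n x then (norm (grad ?n x))\<^sup>2 else 0) \<partial>lebesgue)"
      unfolding gnorm_square
    proof (rule integral_cong_AE)
      show "AE x in lebesgue. (norm (grad \<phi> x))\<^sup>2 = (if 0 < \<phi> x then (norm (grad \<phi> x))\<^sup>2 else 0)
        + (if 0 < ?n x then (norm (grad ?n x))\<^sup>2 else 0)"
        using AE_level_grad_zero[OF \<phi>, of 0] by eventually_elim (auto simp: gn)
    next
      show "(\<lambda>x. (norm (grad \<phi> x))\<^sup>2) \<in> borel_measurable lebesgue"
        by (rule borel_measurable_integrable[OF integrable_grad_square[OF \<phi>]])
      show "(\<lambda>x. (if 0 < \<phi> x then (norm (grad \<phi> x))\<^sup>2 else 0)
          + (if 0 < ?n x then (norm (grad ?n x))\<^sup>2 else 0)) \<in> borel_measurable lebesgue"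
        by (rule borel_measurable_add[OF borel_measurable_integrable[OF integrable_superlevel_energy[OF \<phi>]]
              borel_measurable_integrable[OF integrable_superlevel_energy[OF n]]])
    qed
    also have "\<dots> = superlevel_energy \<phi> 0 + superlevel_energy ?n 0"
      unfolding superlevel_energy_def
      by (rule Bochner_Integration.integral_add[OF integrable_superlevel_energy[OF \<phi>] integrable_superlevel_energy[OF n]])
    also have "\<dots> \<le> (C * N)\<^sup>2 + (C * N)\<^sup>2"
      using P Q C N superlevel_energy_nonneg by (intro add_mono) (auto intro: sqrt_le_D)
    also have "\<dots> \<le> (2 * C * N)\<^sup>2"
      using zero_le_power2[of "C * N"] by (simp add: power2_eq_square algebra_simps)
    finally show "gnorm \<phi> \<le> 2 * C * N" by (rule power2_le_imp_le) (use C N in auto)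
  qed (use C in auto)
qed

section \<open>The method of continuity\<close>

text \<open>The single law for \<open>u + r * v\<close> encodes sums and multiples at once. The
  vectors are functions, not equivalence classes, so that test functions can be used
  directly.\<close>

locale semi_inner_space =
  fixes V :: "('a \<Rightarrow> real) set" and a :: "('a \<Rightarrow> real) \<Rightarrow> ('a \<Rightarrow> real) \<Rightarrow> real"
  assumes V_zero: "(\<lambda>_. 0) \<in> V"
    and V_lin: "u \<in> V \<Longrightarrow> v \<in> V \<Longrightarrow> (\<lambda>x. u x + r * v x) \<in> V"
    and a_lin: "u \<in> V \<Longrightarrow> v \<in> V \<Longrightarrow> w \<in> V \<Longrightarrow> a (\<lambda>x. u x + r * v x) w = a u w + r * a v w"
    and a_sym: "u \<in> V \<Longrightarrow> v \<in> V \<Longrightarrow> a u v = a v u"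
    and a_nonneg: "u \<in> V \<Longrightarrow> 0 \<le> a u u"
begin

definition nrm :: "('a \<Rightarrow> real) \<Rightarrow> real" where "nrm u = sqrt (a u u)"

definition functional :: "(('a \<Rightarrow> real) \<Rightarrow> real) \<Rightarrow> real \<Rightarrow> bool" where
  "functional F C \<longleftrightarrow>
     (\<forall>u\<in>V. \<forall>v\<in>V. \<forall>r. F (\<lambda>x. u x + r * v x) = F u + r * F v) \<and> (\<forall>v\<in>V. \<bar>F v\<bar> \<le> C * nrm v)"

text \<open>Density of the image of \<open>u \<mapsto> b u\<close> in the dual space, with the error
  measured in the dual norm.\<close>

definition dense_range :: "(('a \<Rightarrow> real) \<Rightarrow> ('a \<Rightarrow> real) \<Rightarrow> real) \<Rightarrow> bool" where
  "dense_range b \<longleftrightarrow>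
     (\<forall>F C \<epsilon>. functional F C \<longrightarrow> \<epsilon> > 0 \<longrightarrow> (\<exists>u\<in>V. \<forall>v\<in>V. \<bar>b u v - F v\<bar> \<le> \<epsilon> * nrm v))"

lemma nrm_nonneg: "u \<in> V \<Longrightarrow> 0 \<le> nrm u"
  by (simp add: nrm_def a_nonneg)

lemma nrm_square: "u \<in> V \<Longrightarrow> (nrm u)\<^sup>2 = a u u"
  by (simp add: nrm_def a_nonneg)

text \<open>An almost minimiser of the energy \<open>a u u / 2 - F u\<close> almost represents \<open>F\<close>; this is the
  Riesz representation theorem without completeness.\<close>

lemma dense_range_inner: "dense_range a"
  unfolding dense_range_def
proof (intro allI impI)
  fix F C and \<epsilon> :: real assume F: "functional F C" and \<epsilon>: "\<epsilon> > 0"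
  define J where "J u = a u u / 2 - F u" for u
  \<comment> \<open>An error of size \<open>x\<close> in direction \<open>v\<close> lets the energy
    drop by \<open>x\<^sup>2 / (2 * (nrm v)\<^sup>2)\<close>; a gap of
    \<open>\<epsilon>\<^sup>2 / 2\<close> to the infimum therefore forces
    \<open>\<bar>x\<bar> \<le> \<epsilon> * nrm v\<close>.\<close>
  define \<delta> where "\<delta> = \<epsilon>\<^sup>2 / 2"
  have \<delta>: "\<delta> > 0" using \<epsilon> by (simp add: \<delta>_def)
  \<comment> \<open>Completing the square in \<open>nrm u\<close>.\<close>
  have lb: "- (C\<^sup>2 / 2) \<le> J u" if "u \<in> V" for u
  proof -
    have "F u \<le> C * nrm u" using F that by (force simp: functional_def)
    moreover have "0 \<le> (nrm u - C)\<^sup>2" by simp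
    ultimately show ?thesis
      using nrm_square[OF that] by (simp add: J_def power2_eq_square algebra_simps)
  qed
  have bdd: "bdd_below (J ` V)"
    by (rule bdd_belowI[of _ "- (C\<^sup>2 / 2)"]) (use lb in auto)
  have "\<exists>y\<in>J ` V. y < Inf (J ` V) + \<delta>"
    using V_zero \<delta> by (intro cInf_lessD) auto
  then obtain u where u: "u \<in> V" and Ju: "J u < Inf (J ` V) + \<delta>" by auto
  show "\<exists>u\<in>V. \<forall>v\<in>V. \<bar>a u v - F v\<bar> \<le> \<epsilon> * nrm v"
  proof (intro bexI ballI)
    fix v assume v: "v \<in> V"
    let ?x = "a u v - F v"
    have q: "- \<delta> \<le> \<tau> * ?x + \<tau>\<^sup>2 / 2 * (nrm v)\<^sup>2" for \<tau>
    proof -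
      let ?w = "\<lambda>x. u x + \<tau> * v x"
      have w: "?w \<in> V" using u v V_lin by blast
      have "Inf (J ` V) \<le> J ?w" using bdd w by (intro cInf_lower) auto
      then have "J u - \<delta> \<le> J ?w" using Ju by linarith
      moreover have "a ?w ?w = a u u + \<tau> * a u v + \<tau> * (a u v + \<tau> * a v v)"
        using a_lin[OF u v w] a_lin[OF u v u] a_lin[OF u v v] a_sym[OF w u] a_sym[OF w v] a_sym[OF u v]
        by simp
      moreover have "F ?w = F u + \<tau> * F v" using F u v by (simp add: functional_def)
      ultimately show ?thesis
        using nrm_square[OF v] by (simp add: J_def power2_eq_square algebra_simps)
    qed
    show "\<bar>?x\<bar> \<le> \<epsilon> * nrm v"
    proof (cases "nrm v = 0")
      \<comment> \<open>A direction of norm zero leaves a linear function of \<open>\<tau>\<close>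
        that is bounded below, so its slope is zero.\<close>
      case True
      have "?x = 0"
      proof (rule ccontr)
        assume "?x \<noteq> 0"
        then show False using q[of "- (\<delta> + 1) / ?x"] True by simp
      qed
      then show ?thesis by (simp add: True)
    next
      case False
      \<comment> \<open>The minimiser of the quadratic in \<open>q\<close>.\<close>
      let ?\<tau> = "- ?x / (nrm v)\<^sup>2"
      have "?\<tau> * ?x + ?\<tau>\<^sup>2 / 2 * (nrm v)\<^sup>2 = - (?x\<^sup>2 / (nrm v)\<^sup>2 / 2)"
        using False by (simp add: power2_eq_square field_simps)
      then have "- \<delta> \<le> - (?x\<^sup>2 / (nrm v)\<^sup>2 / 2)"
        using q[of ?\<tau>] by simp
      then have "?x\<^sup>2 / (nrm v)\<^sup>2 \<le> \<epsilon>\<^sup>2" by (simp add: \<delta>_def)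
      then have "?x\<^sup>2 \<le> (\<epsilon> * nrm v)\<^sup>2" using False by (simp add: power_mult_distrib divide_simps)
      then show ?thesis using \<epsilon> nrm_nonneg[OF v] by (simp add: abs_le_square_iff[symmetric])
    qed
  qed (rule u)
qed

text \<open>The method of continuity, phrased with dense ranges so that no completion is needed: a
  perturbation of size at most a quarter of the stability constant reduces the residual
  geometrically.\<close>

lemma dense_range_perturb:
  assumes lin1: "\<And>u v w r. u \<in> V \<Longrightarrow> v \<in> V \<Longrightarrow> w \<in> V \<Longrightarrow> b' (\<lambda>x. u x + r * v x) w = b' u w + r * b' v w"
    and lin2: "\<And>u v w r. u \<in> V \<Longrightarrow> v \<in> V \<Longrightarrow> w \<in> V \<Longrightarrow> b' w (\<lambda>x. u x + r * v x) = b' w u + r * b' w v"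
    and dense: "dense_range b"
    and stable: "\<And>u N. u \<in> V \<Longrightarrow> 0 \<le> N \<Longrightarrow> (\<And>v. v \<in> V \<Longrightarrow> \<bar>b u v\<bar> \<le> N * nrm v) \<Longrightarrow> nrm u \<le> \<kappa> * N"
    and close: "\<And>u v. u \<in> V \<Longrightarrow> v \<in> V \<Longrightarrow> \<bar>b' u v - b u v\<bar> \<le> \<theta> * nrm u * nrm v"
    and \<theta>: "0 \<le> \<theta>" "\<theta> * \<kappa> \<le> 1/4"
  shows "dense_range b'"
  unfolding dense_range_def
proof (intro allI impI)
  fix F C0 and \<epsilon> :: real assume F0: "functional F C0" and \<epsilon>: "\<epsilon> > 0"
  define C where "C = \<bar>C0\<bar> + 1"
  have C: "C > 0" by (simp add: C_def)
  have F: "functional F C"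
    unfolding functional_def
  proof (intro conjI ballI)
    fix v assume v: "v \<in> V"
    have "\<bar>F v\<bar> \<le> C0 * nrm v" using F0 v by (simp add: functional_def)
    also have "\<dots> \<le> C * nrm v" using nrm_nonneg[OF v] by (intro mult_right_mono) (auto simp: C_def)
    finally show "\<bar>F v\<bar> \<le> C * nrm v" .
  qed (use F0 in \<open>auto simp: functional_def\<close>)
  have zero: "b' (\<lambda>_. 0) v = 0" if "v \<in> V" for v
    using lin1[OF V_zero V_zero that, of 1] by simp
  have approx: "\<exists>u\<in>V. \<forall>v\<in>V. \<bar>b' u v - F v\<bar> \<le> C * (3/4) ^ n * nrm v" for n
  proof (induction n)
    case 0
    show ?case using F V_zero zero by (intro bexI[of _ "\<lambda>_. 0"]) (auto simp: functional_def)
  next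
    case (Suc n)
    then obtain u where u: "u \<in> V" and ub: "\<And>v. v \<in> V \<Longrightarrow> \<bar>b' u v - F v\<bar> \<le> C * (3/4) ^ n * nrm v"
      by blast
    let ?C = "C * (3/4) ^ n"
    let ?F = "\<lambda>v. F v - b' u v"
    have Cp: "?C > 0" using C by simp
    have "functional ?F ?C"
      unfolding functional_def
    proof (intro conjI ballI allI)
      fix v w r assume "v \<in> V" "w \<in> V"
      then show "?F (\<lambda>x. v x + r * w x) = ?F v + r * ?F w"
        using F lin2[of v w u r] u by (simp add: functional_def algebra_simps)
    next
      fix v assume "v \<in> V"
      then show "\<bar>?F v\<bar> \<le> ?C * nrm v" using ub by (simp add: abs_minus_commute)
    qed
    \<comment> \<open>The residual is solved for the old form up to a quarter of its size. Stability
      bounds the correction by \<kappa> times \<open>5/4\<close> of the residual, the change of form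
      costs at most a quarter of \<open>5/4\<close>, and
      \<open>1/4 + 5/16 \<le> 3/4\<close>.\<close>
    then obtain w where w: "w \<in> V" and wb: "\<And>v. v \<in> V \<Longrightarrow> \<bar>b w v - ?F v\<bar> \<le> (?C / 4) * nrm v"
      using dense Cp unfolding dense_range_def by (meson divide_pos_pos zero_less_numeral)
    have wn: "nrm w \<le> \<kappa> * (5/4 * ?C)"
    proof (rule stable[OF w])
      show "0 \<le> 5/4 * ?C" using Cp by simp
      fix v assume v: "v \<in> V"
      show "\<bar>b w v\<bar> \<le> 5/4 * ?C * nrm v" using wb[OF v] ub[OF v] by (simp add: abs_if split: if_splits)
    qed
    show ?case
    proof (intro bexI ballI)
      fix v assume v: "v \<in> V"
      have "\<theta> * nrm w \<le> \<theta> * (\<kappa> * (5/4 * ?C))" using wn \<theta>(1) by (rule mult_left_mono)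
      also have "\<dots> = (\<theta> * \<kappa>) * (5/4 * ?C)" by simp
      also have "\<dots> \<le> 1/4 * (5/4 * ?C)" using \<theta>(2) Cp by (intro mult_right_mono) auto
      finally have "\<theta> * nrm w * nrm v \<le> 5/16 * ?C * nrm v"
        using nrm_nonneg[OF v] by (intro mult_right_mono) auto
      then have "\<bar>b' w v - b w v\<bar> \<le> 5/16 * (?C * nrm v)" using close[OF w v] by linarith
      moreover have "\<bar>b w v - ?F v\<bar> \<le> 1/4 * (?C * nrm v)" using wb[OF v] by simp
      moreover have "0 \<le> ?C * nrm v" using Cp nrm_nonneg[OF v] by simp
      ultimately have "\<bar>b' u v + b' w v - F v\<bar> \<le> 3/4 * (?C * nrm v)" by linarith
      then show "\<bar>b' (\<lambda>x. u x + 1 * w x) v - F v\<bar> \<le> C * (3/4) ^ Suc n * nrm v"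
        using lin1[OF u w v, of 1] by simp
    qed (use u w V_lin in blast)
  qed
  obtain n where n: "(3/4::real) ^ n < \<epsilon> / C"
    using \<epsilon> C real_arch_pow_inv[of "\<epsilon> / C" "3/4"] by auto
  then have "C * (3/4) ^ n \<le> \<epsilon>" using C by (simp add: field_simps)
  then have "C * (3/4) ^ n * nrm v \<le> \<epsilon> * nrm v" if "v \<in> V" for v
    using nrm_nonneg[OF that] by (rule mult_right_mono)
  then show "\<exists>u\<in>V. \<forall>v\<in>V. \<bar>b' u v - F v\<bar> \<le> \<epsilon> * nrm v"
    using approx[of n] by force
qed

theorem dense_range_continuity:
  assumes lin1: "\<And>u v w r. u \<in> V \<Longrightarrow> v \<in> V \<Longrightarrow> w \<in> V \<Longrightarrow> b (\<lambda>x. u x + r * v x) w = b u w + r * b v w"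
    and lin2: "\<And>u v w r. u \<in> V \<Longrightarrow> v \<in> V \<Longrightarrow> w \<in> V \<Longrightarrow> b w (\<lambda>x. u x + r * v x) = b w u + r * b w v"
    and bounded: "\<And>u v. u \<in> V \<Longrightarrow> v \<in> V \<Longrightarrow> \<bar>b u v - a u v\<bar> \<le> L * nrm u * nrm v"
    and stable: "\<And>t u N. t \<in> {0..1} \<Longrightarrow> u \<in> V \<Longrightarrow> 0 \<le> N \<Longrightarrow>
        (\<And>v. v \<in> V \<Longrightarrow> \<bar>(1 - t) * a u v + t * b u v\<bar> \<le> N * nrm v) \<Longrightarrow> nrm u \<le> \<kappa> * N"
    and pos: "0 \<le> L" "0 \<le> \<kappa>"
  shows "dense_range b"
proof -
  define bt where "bt t u v = (1 - t) * a u v + t * b u v" for t u v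
  \<comment> \<open>Neighbouring parameters \<open>j / M\<close> differ by \<open>1 / M\<close>, so
    the forms differ by at most \<open>L / M\<close>; since \<kappa> is the same for all of them,
    \<open>4 * L * \<kappa> \<le> M\<close> makes every step admissible for
    \<open>dense_range_perturb\<close>.\<close>
  obtain M :: nat where "4 * L * \<kappa> + 1 < real M" using reals_Archimedean2 by blast
  moreover have "0 \<le> 4 * L * \<kappa>" using pos by simp
  ultimately have M: "M > 0" "4 * L * \<kappa> \<le> real M" by (auto intro!: gr0I)
  have a_lin': "a w (\<lambda>x. u x + r * v x) = a w u + r * a w v" if "u \<in> V" "v \<in> V" "w \<in> V" for u v w r
    using that a_lin[of u v w r] a_sym V_lin by metis
  have "dense_range (bt (real j / real M))" if "j \<le> M" for j
    using that
  proof (induction j)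
    case 0
    then show ?case using dense_range_inner by (simp add: bt_def[abs_def])
  next
    case (Suc j)
    show ?case
    proof (rule dense_range_perturb[where b = "bt (real j / real M)" and \<theta> = "L / real M" and \<kappa> = \<kappa>])
      show "dense_range (bt (real j / real M))" using Suc by simp
    next
      fix u v w r assume "u \<in> V" "v \<in> V" "w \<in> V"
      then show "bt (real (Suc j) / real M) (\<lambda>x. u x + r * v x) w =
          bt (real (Suc j) / real M) u w + r * bt (real (Suc j) / real M) v w"
        "bt (real (Suc j) / real M) w (\<lambda>x. u x + r * v x) =
          bt (real (Suc j) / real M) w u + r * bt (real (Suc j) / real M) w v"
        unfolding bt_def by (simp_all only: lin1 lin2 a_lin a_lin') (simp_all add: algebra_simps)
    next
      fix u N assume "u \<in> V" "0 \<le> N" "\<And>v. v \<in> V \<Longrightarrow> \<bar>bt (real j / real M) u v\<bar> \<le> N * nrm v"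
      then show "nrm u \<le> \<kappa> * N"
        using stable[of "real j / real M" u N] Suc.prems M by (simp add: bt_def)
    next
      fix u v assume uv: "u \<in> V" "v \<in> V"
      have "real (Suc j) / real M = real j / real M + 1 / real M" by (simp add: add_divide_distrib)
      then have "bt (real (Suc j) / real M) u v - bt (real j / real M) u v = (b u v - a u v) / real M"
        by (simp only: bt_def) (simp add: algebra_simps diff_divide_distrib)
      then show "\<bar>bt (real (Suc j) / real M) u v - bt (real j / real M) u v\<bar> \<le> L / real M * nrm u * nrm v"
        using bounded[OF uv] M by (simp add: abs_divide divide_right_mono)
    next
      show "0 \<le> L / real M" "L / real M * \<kappa> \<le> 1/4" using pos M by (auto simp: field_simps)
    qed
  qed
  from this[of M] have "dense_range (bt 1)" using M by simp
  then show ?thesis by (simp add: bt_def[abs_def])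
qed

end

section \<open>The bilinear form\<close>

lemma le_one_plus_powr:
  fixes x :: real
  assumes "0 \<le> x" "1 \<le> p"
  shows "x \<le> 1 + x powr p"
proof (cases "x \<le> 1")
  case True
  then show ?thesis by (simp add: add_increasing2)
next
  case False
  then have "x powr 1 \<le> x powr p" using assms by (intro powr_mono) auto
  then show ?thesis using False by simp
qed

lemma norm_matrix_vector_le:
  fixes B :: "real^'n^'n"
  assumes "\<And>i j. \<bar>B $ i $ j\<bar> \<le> M"
  shows "norm (B *v v) \<le> (real CARD('n))\<^sup>2 * M * norm v"
proof -
  have "\<bar>(B *v v) $ i\<bar> \<le> real CARD('n) * (M * norm v)" for i
  proof -
    have "\<bar>(B *v v) $ i\<bar> \<le> (\<Sum>j\<in>UNIV. \<bar>B $ i $ j * v $ j\<bar>)"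
      unfolding matrix_vector_mult_def by simp
    also have "\<dots> \<le> (\<Sum>j\<in>(UNIV :: 'n set). M * norm v)"
      unfolding abs_mult using assms component_le_norm_cart[of v] order_trans[OF abs_ge_zero assms]
      by (intro sum_mono mult_mono) auto
    finally show ?thesis by simp
  qed
  then have "(\<Sum>i\<in>UNIV. \<bar>(B *v v) $ i\<bar>) \<le> (\<Sum>i\<in>(UNIV :: 'n set). real CARD('n) * (M * norm v))"
    by (intro sum_mono)
  also have "\<dots> = (real CARD('n))\<^sup>2 * M * norm v" by (simp add: power2_eq_square mult.assoc)
  finally show ?thesis using norm_le_l1_cart[of "B *v v"] by linarith
qed

lemma integrable_sum3_bound:
  fixes F :: "'a \<Rightarrow> real"
  assumes [measurable]: "F \<in> borel_measurable M" "p \<in> borel_measurable M" "q \<in> borel_measurable M" "r \<in> borel_measurable M"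
    and bound: "AE x in M. \<bar>F x\<bar> \<le> p x + q x + r x" and pos: "\<And>x. 0 \<le> p x" "\<And>x. 0 \<le> q x" "\<And>x. 0 \<le> r x"
    and P: "(\<integral>\<^sup>+x. ennreal (p x) \<partial>M) \<le> ennreal P" and Q: "(\<integral>\<^sup>+x. ennreal (q x) \<partial>M) \<le> ennreal Q"
    and R: "(\<integral>\<^sup>+x. ennreal (r x) \<partial>M) \<le> ennreal R" and pos': "0 \<le> P" "0 \<le> Q" "0 \<le> R"
  shows "integrable M F" "\<bar>\<integral>x. F x \<partial>M\<bar> \<le> P + Q + R"
proof -
  have "(\<integral>\<^sup>+x. ennreal (norm (F x)) \<partial>M) \<le> (\<integral>\<^sup>+x. ennreal (p x + q x + r x) \<partial>M)"
    using bound by (intro nn_integral_mono_AE) (auto intro!: ennreal_leI elim: eventually_mono)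
  also have "\<dots> = (\<integral>\<^sup>+x. ennreal (p x) \<partial>M) + (\<integral>\<^sup>+x. ennreal (q x) \<partial>M) + (\<integral>\<^sup>+x. ennreal (r x) \<partial>M)"
    using pos by (simp add: nn_integral_add)
  also have "\<dots> \<le> ennreal P + ennreal Q + ennreal R" using P Q R by (intro add_mono)
  also have "\<dots> = ennreal (P + Q + R)" using pos' by simp
  finally have le: "(\<integral>\<^sup>+x. ennreal (norm (F x)) \<partial>M) \<le> ennreal (P + Q + R)" .
  show int: "integrable M F"
    by (rule integrableI_bounded) (use le in \<open>auto simp: order.strict_trans1\<close>)
  have "ennreal (norm (\<integral>x. F x \<partial>M)) \<le> ennreal (P + Q + R)"
    using integral_norm_bound_ennreal[OF int] le by (rule order_trans)
  then show "\<bar>\<integral>x. F x \<partial>M\<bar> \<le> P + Q + R" using pos' by (subst (asm) ennreal_le_iff) auto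
qed

lemma inverse_powr_le:
  fixes y s :: real
  assumes "y powr (1 / p) \<le> s" "0 \<le> y" "0 < p"
  shows "y \<le> s powr p"
proof -
  have "(y powr (1 / p)) powr p \<le> s powr p" using assms by (intro powr_mono2) auto
  then show ?thesis using assms by (simp add: powr_powr)
qed

text \<open>The coefficients are defined on the whole space; the final theorem supplies the zero
  extensions of \<open>H\<close> and \<open>c\<close>, which turns integrals over \<open>U\<close>
  into integrals over the space.\<close>

locale drift_diffusion =
  fixes U :: "(real^'n) set" and A :: "real^'n \<Rightarrow> real^'n^'n" and H :: "real^'n \<Rightarrow> real^'n"
    and c :: "real^'n \<Rightarrow> real" and M lam d :: real
  assumes dim: "CARD('n) \<ge> 3" and d: "d = real CARD('n)"
    and U: "open U" "bounded U"
    and H: "H \<in> borel_measurable lebesgue" "integrable lebesgue (\<lambda>x. norm (H x) powr d)"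
    and c: "c \<in> borel_measurable lebesgue" "integrable lebesgue (\<lambda>x. \<bar>c x\<bar> powr (d / 2))"
      "AE x in lebesgue. 0 \<le> c x"
    and A_meas: "\<And>i j. (\<lambda>x. A x $ i $ j) \<in> borel_measurable lebesgue"
    and M: "0 < M" and lam: "0 < lam"
    and ellip: "AE x in lebesgue. \<forall>\<xi>. lam * (norm \<xi>)\<^sup>2 \<le> (A x *v \<xi>) \<bullet> \<xi>"
    and bnd: "AE x in lebesgue. \<forall>i j. \<bar>A x $ i $ j\<bar> \<le> M"
begin

text \<open>The critical Sobolev exponent belonging to square integrable gradients; \<open>S\<close>
  is the constant of \<open>Sobolev_inequality\<close>.\<close>

definition ps :: real where "ps = 2 * d / (d - 2)"
definition S :: real where "S = 2 * (d - 1) / (d - 2)"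

lemma d3: "3 \<le> d" using dim d by simp

text \<open>The last four identities serve Hoelder's inequality for the drift term, the zero-order
  term, the right-hand side and the Poincare inequality, respectively.\<close>

lemma ps: "2 < ps" "1 / ps = (d - 2) / (2 * d)" "1 / d + 1 / 2 + 1 / ps = 1" "1 / (d / 2) + 1 / ps + 1 / ps = 1"
  "1 / (2 * d / (d + 2)) + 1 / ps = 1" "1 / (ps / 2) + 1 / (d / 2) = 1"
  using d3 by (auto simp: ps_def field_simps)

lemma S: "0 < S" using d3 by (simp add: S_def)

lemma A_mult_measurable [measurable]:
  assumes [measurable]: "G \<in> borel_measurable lebesgue"
  shows "(\<lambda>x. A x *v G x) \<in> borel_measurable lebesgue"
proof -
  have G: "(\<lambda>x. G x $ j) \<in> borel_measurable lebesgue" for j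
    using borel_measurable_inner[OF assms borel_measurable_const[of "axis j 1"]] by (simp add: inner_axis)
  have "(\<lambda>x. (A x *v G x) $ i) \<in> borel_measurable lebesgue" for i
    unfolding matrix_vector_mult_def using A_meas G by simp
  then have "(\<lambda>x. (A x *v G x) \<bullet> b) \<in> borel_measurable lebesgue" if "b \<in> Basis" for b
    using that by (auto simp: Basis_vec_def inner_axis)
  then show ?thesis by (subst borel_measurable_euclidean_space) auto
qed

lemma Sobolev_nn:
  assumes \<phi>: "test_fun U \<phi>"
  shows "(\<integral>\<^sup>+x. ennreal (\<bar>\<phi> x\<bar> powr ps) \<partial>lebesgue) \<le> ennreal ((S * gnorm \<phi>) powr ps)"
proof -
  have p: "0 < ps" using ps by simp
  have "(\<integral>x. \<bar>\<phi> x\<bar> powr ps \<partial>lebesgue) powr (1 / ps) \<le> S * gnorm \<phi>"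
    using Sobolev_inequality[OF \<phi> dim d] unfolding ps(2) by (simp add: ps_def S_def)
  then have "(\<integral>x. \<bar>\<phi> x\<bar> powr ps \<partial>lebesgue) \<le> (S * gnorm \<phi>) powr ps"
    using p by (intro inverse_powr_le) auto
  then show ?thesis
    using nn_integral_eq_integral[OF integrable_test_fun_powr[OF \<phi> p]] by (simp add: ennreal_leI)
qed

text \<open>The gradient is a separate argument, so that test functions with \<open>grad\<close> and
  limits with a weak gradient share one form.\<close>

definition integrand :: "(real^'n \<Rightarrow> real) \<Rightarrow> (real^'n \<Rightarrow> real^'n) \<Rightarrow> (real^'n \<Rightarrow> real) \<Rightarrow> real^'n \<Rightarrow> real" where
  "integrand v G \<psi> x = (A x *v G x) \<bullet> grad \<psi> x + (H x \<bullet> G x) * \<psi> x + c x * v x * \<psi> x"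

definition form :: "(real^'n \<Rightarrow> real) \<Rightarrow> (real^'n \<Rightarrow> real^'n) \<Rightarrow> (real^'n \<Rightarrow> real) \<Rightarrow> real" where
  "form v G \<psi> = (\<integral>x. integrand v G \<psi> x \<partial>lebesgue)"

definition C1 :: real where
  "C1 = d\<^sup>2 * M + (\<integral>x. norm (H x) powr d \<partial>lebesgue) powr (1 / d) * S
        + (\<integral>x. \<bar>c x\<bar> powr (d / 2) \<partial>lebesgue) powr (1 / (d / 2)) * S"

lemma C1_nonneg: "0 \<le> C1"
  using M S by (simp add: C1_def)

text \<open>Hoelder's inequality for each of the three terms. The gradient bound \<open>g\<close>
  and the \<open>L^ps\<close> bound \<open>s\<close> are separate because the lemma is also applied
  to differences of a limit and a test function, for which Sobolev's inequality is not directly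
  available.\<close>

lemma form_bound:
  assumes v: "v \<in> borel_measurable lebesgue" and G: "G \<in> borel_measurable lebesgue"
    and gs: "0 \<le> g" "0 \<le> s"
    and Gb: "(\<integral>\<^sup>+x. ennreal ((norm (G x))\<^sup>2) \<partial>lebesgue) \<le> ennreal (g\<^sup>2)"
    and vb: "(\<integral>\<^sup>+x. ennreal (\<bar>v x\<bar> powr ps) \<partial>lebesgue) \<le> ennreal (s powr ps)"
    and \<psi>: "test_fun U \<psi>"
  shows "integrable lebesgue (integrand v G \<psi>)" "\<bar>form v G \<psi>\<bar> \<le> C1 * (g + s) * gnorm \<psi>"
proof -
  note [measurable] = v G H(1) c(1) test_fun_measurable_lebesgue[OF \<psi>] grad_measurable_lebesgue[OF \<psi>]
  let ?KH = "(\<integral>x. norm (H x) powr d \<partial>lebesgue)" and ?Kc = "(\<integral>x. \<bar>c x\<bar> powr (d / 2) \<partial>lebesgue)"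
  define P where "P = d\<^sup>2 * M * g * gnorm \<psi>"
  define Q where "Q = ?KH powr (1 / d) * S * g * gnorm \<psi>"
  define R where "R = ?Kc powr (1 / (d / 2)) * S * s * gnorm \<psi>"
  have p0: "0 < ps" using ps by simp
  have Gb': "(\<integral>\<^sup>+x. ennreal (norm (G x) powr 2) \<partial>lebesgue) \<le> ennreal (g\<^sup>2)"
    using Gb by (simp add: powr_numeral)
  have \<psi>b': "(\<integral>\<^sup>+x. ennreal (norm (grad \<psi> x) powr 2) \<partial>lebesgue) \<le> ennreal ((gnorm \<psi>)\<^sup>2)"
    using nn_integral_grad_square[OF \<psi>] by (simp add: powr_numeral)
  have half: "(y\<^sup>2) powr (1 / 2) = y" if "0 \<le> y" for y :: real using that by (simp add: powr_half_sqrt)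
  have root: "(y powr ps) powr (1 / ps) = y" if "0 \<le> y" for y using that p0 by (simp add: powr_powr)
  have nS: "0 \<le> S * gnorm \<psi>" using S gnorm_nonneg[of \<psi>] by simp
  have pos: "0 \<le> P" "0 \<le> Q" "0 \<le> R"
    using gs S M gnorm_nonneg[of \<psi>] by (auto simp: P_def Q_def R_def)
  have 1: "(\<integral>\<^sup>+x. ennreal (d\<^sup>2 * M * (norm (G x) * norm (grad \<psi> x))) \<partial>lebesgue) \<le> ennreal P"
  proof -
    have "(\<integral>\<^sup>+x. ennreal (norm (G x) * norm (grad \<psi> x)) \<partial>lebesgue)
        \<le> ennreal ((g\<^sup>2) powr (1 / 2) * ((gnorm \<psi>)\<^sup>2) powr (1 / 2))"
      using Gb' \<psi>b' by (intro Holder_powr2) auto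
    then have "ennreal (d\<^sup>2 * M) * (\<integral>\<^sup>+x. ennreal (norm (G x) * norm (grad \<psi> x)) \<partial>lebesgue)
        \<le> ennreal (d\<^sup>2 * M) * ennreal (g * gnorm \<psi>)"
      using gs gnorm_nonneg[of \<psi>] by (intro mult_left_mono) (auto simp: half)
    also have "\<dots> = ennreal P" using M gs gnorm_nonneg[of \<psi>] by (simp add: P_def ennreal_mult[symmetric] mult_ac)
    also have "ennreal (d\<^sup>2 * M) * (\<integral>\<^sup>+x. ennreal (norm (G x) * norm (grad \<psi> x)) \<partial>lebesgue)
       = (\<integral>\<^sup>+x. ennreal (d\<^sup>2 * M * (norm (G x) * norm (grad \<psi> x))) \<partial>lebesgue)"
      using M by (subst nn_integral_cmult[symmetric]) (auto simp: ennreal_mult[symmetric])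
    finally show ?thesis .
  qed
  have 2: "(\<integral>\<^sup>+x. ennreal (norm (H x) * norm (G x) * \<bar>\<psi> x\<bar>) \<partial>lebesgue) \<le> ennreal Q"
  proof -
    have "(\<integral>\<^sup>+x. ennreal (norm (H x) * norm (G x) * \<bar>\<psi> x\<bar>) \<partial>lebesgue)
        \<le> ennreal (?KH powr (1 / d) * (g\<^sup>2) powr (1 / 2) * ((S * gnorm \<psi>) powr ps) powr (1 / ps))"
      using Gb' Sobolev_nn[OF \<psi>] d3 p0 ps nn_integral_eq_integral[OF H(2)]
      by (intro Holder_powr3) auto
    also have "\<dots> = ennreal Q" using gs nS by (simp only: half root) (simp add: Q_def mult_ac)
    finally show ?thesis .
  qed
  have 3: "(\<integral>\<^sup>+x. ennreal (\<bar>c x\<bar> * \<bar>v x\<bar> * \<bar>\<psi> x\<bar>) \<partial>lebesgue) \<le> ennreal R"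
  proof -
    have "(\<integral>\<^sup>+x. ennreal (\<bar>c x\<bar> * \<bar>v x\<bar> * \<bar>\<psi> x\<bar>) \<partial>lebesgue)
        \<le> ennreal (?Kc powr (1 / (d / 2)) * (s powr ps) powr (1 / ps) * ((S * gnorm \<psi>) powr ps) powr (1 / ps))"
      using vb Sobolev_nn[OF \<psi>] d3 p0 ps nn_integral_eq_integral[OF c(2)]
      by (intro Holder_powr3) auto
    also have "\<dots> = ennreal R" using gs nS by (simp only: root) (simp add: R_def mult_ac)
    finally show ?thesis .
  qed
  have bound: "AE x in lebesgue. \<bar>integrand v G \<psi> x\<bar> \<le> d\<^sup>2 * M * (norm (G x) * norm (grad \<psi> x))
      + norm (H x) * norm (G x) * \<bar>\<psi> x\<bar> + \<bar>c x\<bar> * \<bar>v x\<bar> * \<bar>\<psi> x\<bar>"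
    using bnd
  proof eventually_elim
    case (elim x)
    have "\<bar>(A x *v G x) \<bullet> grad \<psi> x\<bar> \<le> norm (A x *v G x) * norm (grad \<psi> x)" by (rule Cauchy_Schwarz_ineq2)
    also have "\<dots> \<le> (d\<^sup>2 * M * norm (G x)) * norm (grad \<psi> x)"
      using norm_matrix_vector_le[of "A x" M "G x"] elim by (intro mult_right_mono) (auto simp: d)
    finally have "\<bar>(A x *v G x) \<bullet> grad \<psi> x\<bar> \<le> d\<^sup>2 * M * (norm (G x) * norm (grad \<psi> x))" by (simp add: mult.assoc)
    moreover have "\<bar>(H x \<bullet> G x) * \<psi> x\<bar> \<le> norm (H x) * norm (G x) * \<bar>\<psi> x\<bar>"
      unfolding abs_mult by (intro mult_right_mono Cauchy_Schwarz_ineq2) auto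
    moreover have "\<bar>c x * v x * \<psi> x\<bar> = \<bar>c x\<bar> * \<bar>v x\<bar> * \<bar>\<psi> x\<bar>" by (simp add: abs_mult)
    ultimately show ?case unfolding integrand_def by linarith
  qed
  have m: "integrand v G \<psi> \<in> borel_measurable lebesgue" unfolding integrand_def[abs_def] by measurable
  have nn: "\<And>x. 0 \<le> d\<^sup>2 * M * (norm (G x) * norm (grad \<psi> x))" using M by simp
  note * = integrable_sum3_bound[OF m _ _ _ bound nn _ _ 1 2 3 pos]
  show "integrable lebesgue (integrand v G \<psi>)" by (rule *) auto
  have "\<bar>form v G \<psi>\<bar> \<le> P + Q + R" unfolding form_def by (rule *) auto
  \<comment> \<open>The cross terms missing from \<open>P + Q + R\<close> are nonnegative; adding
    them makes the bound factor as \<open>C1 * (g + s)\<close>.\<close>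
  also have "\<dots> \<le> C1 * (g + s) * gnorm \<psi>"
  proof -
    have "P + Q + R = (d\<^sup>2 * M * g + ?KH powr (1 / d) * S * g + ?Kc powr (1 / (d / 2)) * S * s) * gnorm \<psi>"
      by (simp add: P_def Q_def R_def algebra_simps)
    moreover have "C1 * (g + s) = (d\<^sup>2 * M * g + ?KH powr (1 / d) * S * g + ?Kc powr (1 / (d / 2)) * S * s)
        + (d\<^sup>2 * M * s + ?KH powr (1 / d) * S * s + ?Kc powr (1 / (d / 2)) * S * g)"
      by (simp add: C1_def algebra_simps)
    moreover have "0 \<le> d\<^sup>2 * M * s + ?KH powr (1 / d) * S * s + ?Kc powr (1 / (d / 2)) * S * g"
      using M S gs by simp
    ultimately show ?thesis using gnorm_nonneg[of \<psi>] by (auto intro!: mult_right_mono)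
  qed
  finally show "\<bar>form v G \<psi>\<bar> \<le> C1 * (g + s) * gnorm \<psi>" .
qed

lemma form_test_fun:
  assumes \<phi>: "test_fun U \<phi>" and \<psi>: "test_fun U \<psi>"
  shows "integrable lebesgue (integrand \<phi> (grad \<phi>) \<psi>)"
    "\<bar>form \<phi> (grad \<phi>) \<psi>\<bar> \<le> C1 * (1 + S) * gnorm \<phi> * gnorm \<psi>"
proof -
  have n: "0 \<le> gnorm \<phi>" "0 \<le> S * gnorm \<phi>" using gnorm_nonneg[of \<phi>] S by auto
  have g: "(\<integral>\<^sup>+x. ennreal ((norm (grad \<phi> x))\<^sup>2) \<partial>lebesgue) \<le> ennreal ((gnorm \<phi>)\<^sup>2)"
    using nn_integral_grad_square[OF \<phi>] by simp
  note * = form_bound[OF test_fun_measurable_lebesgue[OF \<phi>] grad_measurable_lebesgue[OF \<phi>] n g Sobolev_nn[OF \<phi>] \<psi>]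
  show "integrable lebesgue (integrand \<phi> (grad \<phi>) \<psi>)" by (rule *)
  show "\<bar>form \<phi> (grad \<phi>) \<psi>\<bar> \<le> C1 * (1 + S) * gnorm \<phi> * gnorm \<psi>"
    using *(2) by (simp add: algebra_simps)
qed

lemma form_lin1:
  assumes "integrable lebesgue (integrand u G \<psi>)" "integrable lebesgue (integrand v K \<psi>)"
  shows "integrable lebesgue (integrand (\<lambda>x. u x + r * v x) (\<lambda>x. G x + r *\<^sub>R K x) \<psi>)"
    "form (\<lambda>x. u x + r * v x) (\<lambda>x. G x + r *\<^sub>R K x) \<psi> = form u G \<psi> + r * form v K \<psi>"
proof -
  have "integrand (\<lambda>x. u x + r * v x) (\<lambda>x. G x + r *\<^sub>R K x) \<psi> = (\<lambda>x. integrand u G \<psi> x + r * integrand v K \<psi> x)"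
    by (auto simp: integrand_def fun_eq_iff matrix_vector_right_distrib matrix_vector_mult_scaleR
        inner_add_left inner_add_right algebra_simps)
  then show "integrable lebesgue (integrand (\<lambda>x. u x + r * v x) (\<lambda>x. G x + r *\<^sub>R K x) \<psi>)"
    "form (\<lambda>x. u x + r * v x) (\<lambda>x. G x + r *\<^sub>R K x) \<psi> = form u G \<psi> + r * form v K \<psi>"
    using assms by (auto simp: form_def)
qed

lemma form_test_fun_lin1:
  assumes "test_fun U u" "test_fun U v" "test_fun U \<psi>"
  shows "form (\<lambda>x. u x + r * v x) (grad (\<lambda>x. u x + r * v x)) \<psi> = form u (grad u) \<psi> + r * form v (grad v) \<psi>"
proof -
  have "grad (\<lambda>x. u x + r * v x) = (\<lambda>x. grad u x + r *\<^sub>R grad v x)" using grad_lin[OF assms(1,2)] by blast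
  then show ?thesis
    using form_lin1(2)[OF form_test_fun(1)[OF assms(1,3)] form_test_fun(1)[OF assms(2,3)], of r] by simp
qed

lemma form_test_fun_lin2:
  assumes "test_fun U u" "test_fun U v" "test_fun U w"
  shows "form w (grad w) (\<lambda>x. u x + r * v x) = form w (grad w) u + r * form w (grad w) v"
proof -
  have "integrand w (grad w) (\<lambda>x. u x + r * v x) = (\<lambda>x. integrand w (grad w) u x + r * integrand w (grad w) v x)"
    by (auto simp: integrand_def fun_eq_iff grad_lin[OF assms(1,2)] inner_add_right algebra_simps)
  then show ?thesis using form_test_fun(1)[OF assms(3,1)] form_test_fun(1)[OF assms(3,2)] by (simp add: form_def)
qed

section \<open>The Dirichlet inner product and stability along the segment\<close>

definition ip :: "(real^'n \<Rightarrow> real) \<Rightarrow> (real^'n \<Rightarrow> real) \<Rightarrow> real" where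
  "ip \<phi> \<psi> = (\<integral>x. grad \<phi> x \<bullet> grad \<psi> x \<partial>lebesgue)"

lemma integrable_grad_inner:
  assumes "test_fun U \<phi>" "test_fun U \<psi>"
  shows "integrable lebesgue (\<lambda>x. grad \<phi> x \<bullet> grad \<psi> x)"
proof (rule Bochner_Integration.integrable_bound)
  show "integrable lebesgue (\<lambda>x. (norm (grad \<phi> x))\<^sup>2 + (norm (grad \<psi> x))\<^sup>2)"
    using assms by (intro Bochner_Integration.integrable_add integrable_grad_square)
  show "(\<lambda>x. grad \<phi> x \<bullet> grad \<psi> x) \<in> borel_measurable lebesgue"
    using assms by (intro borel_measurable_inner grad_measurable_lebesgue)
  show "AE x in lebesgue. norm (grad \<phi> x \<bullet> grad \<psi> x) \<le> norm ((norm (grad \<phi> x))\<^sup>2 + (norm (grad \<psi> x))\<^sup>2)"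
  proof (rule AE_I2)
    fix x
    have "\<bar>grad \<phi> x \<bullet> grad \<psi> x\<bar> \<le> norm (grad \<phi> x) * norm (grad \<psi> x)" by (rule Cauchy_Schwarz_ineq2)
    also have "\<dots> \<le> (norm (grad \<phi> x))\<^sup>2 + (norm (grad \<psi> x))\<^sup>2"
      using sum_squares_bound[of "norm (grad \<phi> x)" "norm (grad \<psi> x)"]
        mult_nonneg_nonneg[OF norm_ge_zero[of "grad \<phi> x"] norm_ge_zero[of "grad \<psi> x"]] by linarith
    finally show "norm (grad \<phi> x \<bullet> grad \<psi> x) \<le> norm ((norm (grad \<phi> x))\<^sup>2 + (norm (grad \<psi> x))\<^sup>2)" by simp
  qed
qed

sublocale V: semi_inner_space "{\<phi>. test_fun U \<phi>}" ip
proof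
  fix u v w :: "real^'n \<Rightarrow> real" and r :: real
  assume u: "u \<in> {\<phi>. test_fun U \<phi>}" and v: "v \<in> {\<phi>. test_fun U \<phi>}"
  show "ip u v = ip v u" by (simp add: ip_def inner_commute)
  show "(\<lambda>x. u x + r * v x) \<in> {\<phi>. test_fun U \<phi>}" using u v by (simp add: test_fun_lin)
  assume w: "w \<in> {\<phi>. test_fun U \<phi>}"
  show "ip (\<lambda>x. u x + r * v x) w = ip u w + r * ip v w"
    using u v w integrable_grad_inner[of u w] integrable_grad_inner[of v w]
    by (simp add: ip_def grad_lin[of U] inner_add_left)
qed (auto simp: test_fun_zero ip_def)

lemma nrm_eq: "V.nrm \<phi> = gnorm \<phi>"
  by (simp add: V.nrm_def ip_def gnorm_def power2_norm_eq_inner)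

lemma ip_bound:
  assumes "test_fun U \<phi>" "test_fun U \<psi>"
  shows "\<bar>ip \<phi> \<psi>\<bar> \<le> gnorm \<phi> * gnorm \<psi>"
proof -
  note [measurable] = grad_measurable_lebesgue[OF assms(1)] grad_measurable_lebesgue[OF assms(2)]
  have "ennreal (norm (ip \<phi> \<psi>)) \<le> (\<integral>\<^sup>+x. ennreal (norm (grad \<phi> x \<bullet> grad \<psi> x)) \<partial>lebesgue)"
    unfolding ip_def by (rule integral_norm_bound_ennreal[OF integrable_grad_inner[OF assms]])
  also have "\<dots> \<le> (\<integral>\<^sup>+x. ennreal (norm (grad \<phi> x) * norm (grad \<psi> x)) \<partial>lebesgue)"
    by (intro nn_integral_mono ennreal_leI) (simp add: Cauchy_Schwarz_ineq2)
  also have "\<dots> \<le> ennreal (((gnorm \<phi>)\<^sup>2) powr (1 / 2) * ((gnorm \<psi>)\<^sup>2) powr (1 / 2))"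
    using nn_integral_grad_square[OF assms(1)] nn_integral_grad_square[OF assms(2)]
    by (intro Holder_powr2) (auto simp: powr_numeral)
  also have "\<dots> = ennreal (gnorm \<phi> * gnorm \<psi>)" by (simp add: powr_half_sqrt gnorm_nonneg)
  finally show ?thesis by (simp add: ennreal_le_iff gnorm_nonneg)
qed

lemma integrable_on_U:
  fixes F :: "real^'n \<Rightarrow> 'b::{banach, second_countable_topology}"
  assumes [measurable]: "F \<in> borel_measurable lebesgue" and "integrable lebesgue g"
    and bound: "AE x in lebesgue. norm (F x) \<le> indicator U x * K + g x"
  shows "integrable lebesgue F"
proof (rule Bochner_Integration.integrable_bound)
  have "integrable lebesgue (\<lambda>x. indicator U x * K)"
    using lmeasurable_open[OF U(2,1)]
    by (intro integrable_mult_left integrable_real_indicator) (auto simp: fmeasurable_def)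
  then show "integrable lebesgue (\<lambda>x. indicator U x * K + g x)" using assms by simp
  show "AE x in lebesgue. norm (F x) \<le> norm (indicator U x * K + g x)"
    using bound by eventually_elim simp
qed measurable

text \<open>The form at \<open>t\<close> is written with the fields \<open>W\<close> and
  \<open>w\<close> of \<open>apriori_estimate\<close>: \<open>W\<close> interpolates between the
  gradient and the diffusion flux, and \<open>w\<close> is \<open>t\<close> times the lower-order
  terms. The factor \<open>t \<le> 1\<close> can only weaken the drift.\<close>

lemma stability:
  "\<exists>\<kappa>\<ge>0. \<forall>t u N. t \<in> {0..1} \<longrightarrow> test_fun U u \<longrightarrow> 0 \<le> N \<longrightarrow>
     (\<forall>v. test_fun U v \<longrightarrow> \<bar>(1 - t) * ip u v + t * form u (grad u) v\<bar> \<le> N * gnorm v) \<longrightarrow> gnorm u \<le> \<kappa> * N"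
proof -
  define l where "l = min 1 lam"
  have l: "0 < l" "l \<le> 1" "l \<le> lam" using lam by (auto simp: l_def)
  from apriori_estimate[OF U dim d l(1) H]
  obtain \<kappa> where \<kappa>: "0 \<le> \<kappa>"
    "\<forall>\<phi> W w N. test_fun U \<phi> \<longrightarrow> integrable lebesgue W \<longrightarrow> integrable lebesgue w \<longrightarrow> 0 \<le> N \<longrightarrow>
      (\<forall>\<psi>. test_fun U \<psi> \<longrightarrow> \<bar>\<integral>x. W x \<bullet> grad \<psi> x + w x * \<psi> x \<partial>lebesgue\<bar> \<le> N * gnorm \<psi>) \<longrightarrow>
      (AE x in lebesgue. l * (norm (grad \<phi> x))\<^sup>2 \<le> W x \<bullet> grad \<phi> x) \<longrightarrow>
      (AE x in lebesgue. - (norm (H x) * norm (grad \<phi> x) * \<bar>\<phi> x\<bar>) \<le> w x * \<phi> x) \<longrightarrow>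
      gnorm \<phi> \<le> \<kappa> * N"
    by (elim exE conjE) (rule that)
  show ?thesis
  proof (intro exI[of _ \<kappa>] conjI allI impI)
    show "0 \<le> \<kappa>" by (rule \<kappa>(1))
    fix t N :: real and u :: "real^'n \<Rightarrow> real"
    assume t: "t \<in> {0..1}" and u: "test_fun U u" and N: "0 \<le> N"
      "\<forall>v. test_fun U v \<longrightarrow> \<bar>(1 - t) * ip u v + t * form u (grad u) v\<bar> \<le> N * gnorm v"
    note [measurable] = test_fun_measurable_lebesgue[OF u] grad_measurable_lebesgue[OF u] H(1) c(1)
    obtain R where R: "0 < R" "\<And>x. \<bar>u x\<bar> \<le> R" by (rule test_fun_bounded[OF u]) (rule that)
    obtain G where G: "0 < G" "\<And>x. norm (grad u x) \<le> G" by (rule grad_bounded[OF u]) (rule that)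
    define W where "W x = (1 - t) *\<^sub>R grad u x + t *\<^sub>R (A x *v grad u x)" for x
    define w where "w x = t * (H x \<bullet> grad u x) + t * (c x * u x)" for x
    have mW: "W \<in> borel_measurable lebesgue" unfolding W_def by measurable
    have mw: "w \<in> borel_measurable lebesgue" unfolding w_def by measurable
    have iW: "integrable lebesgue W"
    proof (rule integrable_on_U[OF mW integrable_zero, of "G + d\<^sup>2 * M * G"])
      show "AE x in lebesgue. norm (W x) \<le> indicator U x * (G + d\<^sup>2 * M * G) + 0"
        using bnd
      proof eventually_elim
        case (elim x)
        show ?case
        proof (cases "x \<in> U")
          case True
          have "norm (A x *v grad u x) \<le> d\<^sup>2 * M * norm (grad u x)"
            using norm_matrix_vector_le[of "A x" M "grad u x"] elim by (auto simp: d)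
          also have "\<dots> \<le> d\<^sup>2 * M * G" using G M by (intro mult_left_mono) auto
          finally have a: "norm (A x *v grad u x) \<le> d\<^sup>2 * M * G" .
          have "norm (W x) \<le> (1 - t) * norm (grad u x) + t * norm (A x *v grad u x)"
            unfolding W_def using t by (intro norm_triangle_le) auto
          also have "\<dots> \<le> 1 * G + 1 * (d\<^sup>2 * M * G)"
            using t G a by (intro add_mono mult_mono) auto
          finally show ?thesis using True by simp
        next
          case False
          then show ?thesis by (simp add: W_def grad_outside[OF u])
        qed
      qed
    qed
    have iw: "integrable lebesgue w"
    \<comment> \<open>On the bounded set \<open>U\<close> the inequality
      \<open>y \<le> 1 + y powr p\<close> reduces first powers of the coefficients to the powers
      known to be integrable.\<close>
    proof (rule integrable_on_U[OF mw, of "\<lambda>x. G * norm (H x) powr d + R * \<bar>c x\<bar> powr (d / 2)" "G + R"])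
      show "integrable lebesgue (\<lambda>x. G * norm (H x) powr d + R * \<bar>c x\<bar> powr (d / 2))"
        using H(2) c(2) by simp
      show "AE x in lebesgue. norm (w x) \<le> indicator U x * (G + R) + (G * norm (H x) powr d + R * \<bar>c x\<bar> powr (d / 2))"
      proof (rule AE_I2)
        fix x
        show "norm (w x) \<le> indicator U x * (G + R) + (G * norm (H x) powr d + R * \<bar>c x\<bar> powr (d / 2))"
        proof (cases "x \<in> U")
          case True
          have "\<bar>H x \<bullet> grad u x\<bar> \<le> norm (H x) * norm (grad u x)" by (rule Cauchy_Schwarz_ineq2)
          also have "\<dots> \<le> (1 + norm (H x) powr d) * G"
            using G d3 le_one_plus_powr[of "norm (H x)" d] by (intro mult_mono) (auto simp: add_nonneg_nonneg)
          finally have 1: "\<bar>H x \<bullet> grad u x\<bar> \<le> (1 + norm (H x) powr d) * G" .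
          have 2: "\<bar>c x * u x\<bar> \<le> (1 + \<bar>c x\<bar> powr (d / 2)) * R"
            unfolding abs_mult using R d3 le_one_plus_powr[of "\<bar>c x\<bar>" "d / 2"] by (intro mult_mono) (auto simp: add_nonneg_nonneg)
          have "\<bar>w x\<bar> \<le> t * \<bar>H x \<bullet> grad u x\<bar> + t * \<bar>c x * u x\<bar>"
            unfolding w_def using t by (intro order_trans[OF abs_triangle_ineq]) (simp add: abs_mult)
          also have "\<dots> \<le> 1 * ((1 + norm (H x) powr d) * G) + 1 * ((1 + \<bar>c x\<bar> powr (d / 2)) * R)"
            using t 1 2 by (intro add_mono mult_mono) auto
          finally show ?thesis using True by (simp add: algebra_simps)
        next
          case False
          then show ?thesis using G R by (simp add: w_def grad_outside[OF u] test_fun_outside[OF u])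
        qed
      qed
    qed
    show "gnorm u \<le> \<kappa> * N"
    proof (rule \<kappa>(2)[rule_format, OF u iW iw N(1)])
      fix \<psi> assume \<psi>: "test_fun U \<psi>"
      have "(\<integral>x. W x \<bullet> grad \<psi> x + w x * \<psi> x \<partial>lebesgue)
          = (\<integral>x. (1 - t) * (grad u x \<bullet> grad \<psi> x) + t * integrand u (grad u) \<psi> x \<partial>lebesgue)"
        by (intro Bochner_Integration.integral_cong)
          (auto simp: W_def w_def integrand_def inner_add_left inner_scaleR_left algebra_simps)
      also have "\<dots> = (1 - t) * ip u \<psi> + t * form u (grad u) \<psi>"
        using integrable_grad_inner[OF u \<psi>] form_test_fun(1)[OF u \<psi>] by (simp add: ip_def form_def)
      finally show "\<bar>\<integral>x. W x \<bullet> grad \<psi> x + w x * \<psi> x \<partial>lebesgue\<bar> \<le> N * gnorm \<psi>"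
        using N(2) \<psi> by simp
    next
      show "AE x in lebesgue. l * (norm (grad u x))\<^sup>2 \<le> W x \<bullet> grad u x"
        using ellip
      proof eventually_elim
        case (elim x)
        let ?n = "(norm (grad u x))\<^sup>2"
        have "l * ?n \<le> 1 * ?n" "l * ?n \<le> lam * ?n" using l by (intro mult_right_mono; simp)+
        then have "l * ?n \<le> ?n" "l * ?n \<le> (A x *v grad u x) \<bullet> grad u x" using elim by (auto intro: order_trans)
        then have "(1 - t) * (l * ?n) + t * (l * ?n) \<le> (1 - t) * ?n + t * ((A x *v grad u x) \<bullet> grad u x)"
          using t by (intro add_mono mult_left_mono) auto
        then show ?case by (simp add: W_def inner_add_left power2_norm_eq_inner[symmetric] algebra_simps)
      qed
      show "AE x in lebesgue. - (norm (H x) * norm (grad u x) * \<bar>u x\<bar>) \<le> w x * u x"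
        using c(3)
      proof eventually_elim
        case (elim x)
        have "\<bar>(H x \<bullet> grad u x) * u x\<bar> \<le> norm (H x) * norm (grad u x) * \<bar>u x\<bar>"
          unfolding abs_mult by (intro mult_right_mono Cauchy_Schwarz_ineq2) auto
        then have "t * \<bar>(H x \<bullet> grad u x) * u x\<bar> \<le> 1 * (norm (H x) * norm (grad u x) * \<bar>u x\<bar>)"
          using t by (intro mult_mono) auto
        moreover have "- (t * \<bar>(H x \<bullet> grad u x) * u x\<bar>) \<le> t * ((H x \<bullet> grad u x) * u x)"
          using t by (metis abs_ge_minus_self atLeastAtMost_iff minus_le_iff mult_left_mono mult_minus_right)
        \<comment> \<open>The sign of \<open>c\<close> enters here: the zero-order term is discarded
          and leaves no trace in \<kappa>.\<close>
        moreover have "0 \<le> t * (c x * (u x * u x))" using t elim by simp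
        moreover have "w x * u x = t * ((H x \<bullet> grad u x) * u x) + t * (c x * (u x * u x))"
          by (simp add: w_def algebra_simps)
        ultimately show ?case by linarith
      qed
    qed
  qed
qed

lemma dense_range_form: "V.dense_range (\<lambda>\<phi>. form \<phi> (grad \<phi>))"
proof -
  from stability obtain \<kappa> where \<kappa>: "0 \<le> \<kappa>"
    "\<forall>t u N. t \<in> {0..1} \<longrightarrow> test_fun U u \<longrightarrow> 0 \<le> N \<longrightarrow>
     (\<forall>v. test_fun U v \<longrightarrow> \<bar>(1 - t) * ip u v + t * form u (grad u) v\<bar> \<le> N * gnorm v) \<longrightarrow> gnorm u \<le> \<kappa> * N"
    by (elim exE conjE) (rule that)
  show ?thesis
  proof (rule V.dense_range_continuity[where L = "C1 * (1 + S) + 1" and \<kappa> = \<kappa>])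
    fix u v assume "u \<in> {\<phi>. test_fun U \<phi>}" "v \<in> {\<phi>. test_fun U \<phi>}"
    then have "\<bar>form u (grad u) v\<bar> \<le> C1 * (1 + S) * gnorm u * gnorm v" "\<bar>ip u v\<bar> \<le> gnorm u * gnorm v"
      using form_test_fun(2) ip_bound by auto
    then show "\<bar>form u (grad u) v - ip u v\<bar> \<le> (C1 * (1 + S) + 1) * V.nrm u * V.nrm v"
      unfolding nrm_eq by (simp add: algebra_simps)
  next
    fix t N :: real and u
    assume t: "t \<in> {0..1}" and u: "u \<in> {\<phi>. test_fun U \<phi>}" and N: "0 \<le> N"
      and le: "\<And>v. v \<in> {\<phi>. test_fun U \<phi>} \<Longrightarrow> \<bar>(1 - t) * ip u v + t * form u (grad u) v\<bar> \<le> N * V.nrm v"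
    have "gnorm u \<le> \<kappa> * N"
      by (rule \<kappa>(2)[rule_format, OF t _ N]) (use u le in \<open>simp_all add: nrm_eq\<close>)
    then show "V.nrm u \<le> \<kappa> * N" by (simp add: nrm_eq)
  next
    show "0 \<le> C1 * (1 + S) + 1" using C1_nonneg S by simp
  qed (simp_all add: \<kappa>(1) form_test_fun_lin1 form_test_fun_lin2)
qed

end

section \<open>Approximation, uniqueness and existence\<close>

lemma nn_integral_Fatou_le:
  fixes F :: "nat \<Rightarrow> 'a \<Rightarrow> ennreal"
  assumes [measurable]: "\<And>m. F m \<in> borel_measurable M"
    and lim: "AE x in M. (\<lambda>m. F m x) \<longlonglongrightarrow> g x"
    and le: "\<forall>\<^sub>F m in sequentially. (\<integral>\<^sup>+x. F m x \<partial>M) \<le> b"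
  shows "(\<integral>\<^sup>+x. g x \<partial>M) \<le> b"
proof -
  have "AE x in M. g x = liminf (\<lambda>m. F m x)"
    using lim by eventually_elim (metis lim_imp_Liminf trivial_limit_sequentially)
  then have "(\<integral>\<^sup>+x. g x \<partial>M) = (\<integral>\<^sup>+x. liminf (\<lambda>m. F m x) \<partial>M)" by (rule nn_integral_cong_AE)
  also have "\<dots> \<le> liminf (\<lambda>m. \<integral>\<^sup>+x. F m x \<partial>M)" by (rule nn_integral_liminf) measurable
  also have "\<dots> \<le> liminf (\<lambda>m. b)" using le by (rule Liminf_mono)
  also have "\<dots> = b" by (simp add: Liminf_const)
  finally show ?thesis .
qed

text \<open>The geometric rate makes the increments summable in \<open>L^1\<close> over the set
  \<open>U\<close> of finite measure, so the sequence converges almost everywhere; Fatou's lemma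
  then carries the Cauchy bounds over to the limit with the same constants.\<close>

lemma L2_complete:
  fixes f :: "nat \<Rightarrow> 'a \<Rightarrow> 'b::euclidean_space"
  assumes meas [measurable]: "\<And>n. f n \<in> borel_measurable M"
    and U: "U \<in> sets M" "emeasure M U < \<infinity>" and zero: "\<And>n x. x \<notin> U \<Longrightarrow> f n x = 0" and C: "0 \<le> C"
    and bound: "\<And>m n. n \<le> m \<Longrightarrow> (\<integral>\<^sup>+x. ennreal ((norm (f m x - f n x))\<^sup>2) \<partial>M) \<le> ennreal (C * (1/4) ^ n)"
  obtains g where "g \<in> borel_measurable M" "\<And>x. x \<notin> U \<Longrightarrow> g x = 0"
    "\<And>n. (\<integral>\<^sup>+x. ennreal ((norm (g x - f n x))\<^sup>2) \<partial>M) \<le> ennreal (C * (1/4) ^ n)"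
proof -
  define D where "D n x = norm (f (Suc n) x - f n x)" for n x
  have [measurable]: "D n \<in> borel_measurable M" for n unfolding D_def by measurable
  note [measurable] = U(1)
  define mU where "mU = measure M U"
  have mU: "emeasure M U = ennreal mU" "0 \<le> mU" using U by (auto simp: mU_def emeasure_eq_ennreal_measure)
  \<comment> \<open>Young's inequality with weight \<open>2 ^ n\<close> balances the measure of
    \<open>U\<close> against the squared increment, whose integral is of order
    \<open>(1/4) ^ n\<close>: both contributions become of order \<open>(1/2) ^ n\<close>.\<close>
  have Dle: "ennreal (D n x) \<le> ennreal ((1/2) ^ n) * indicator U x + ennreal (2 ^ n) * ennreal ((D n x)\<^sup>2)" for n x
  proof (cases "x \<in> U")
    case True
    let ?a = "(1/2::real) ^ n" and ?b = "2 ^ n * D n x"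
    have "D n x = ?a * ?b" by (simp add: power_one_over)
    also have "\<dots> \<le> ?a * (1 + ?b\<^sup>2)"
    proof (intro mult_left_mono)
      have "2 * ?b \<le> 1 + ?b\<^sup>2" using sum_squares_bound[of 1 ?b] by simp
      moreover have "0 \<le> ?b" by (simp add: D_def)
      ultimately show "?b \<le> 1 + ?b\<^sup>2" by linarith
    qed simp
    also have "\<dots> = ?a + 2 ^ n * (D n x)\<^sup>2" by (simp add: algebra_simps power2_eq_square power_one_over)
    finally have "ennreal (D n x) \<le> ennreal (?a + 2 ^ n * (D n x)\<^sup>2)" by (rule ennreal_leI)
    then show ?thesis using True by (simp add: ennreal_plus[symmetric] ennreal_mult[symmetric] del: ennreal_plus)
  next
    case False
    then show ?thesis by (simp add: D_def zero)
  qed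
  have "(\<integral>\<^sup>+x. ennreal (D n x) \<partial>M) \<le> ennreal ((mU + C) * (1/2) ^ n)" for n
  proof -
    have "(\<integral>\<^sup>+x. ennreal (D n x) \<partial>M) \<le> (\<integral>\<^sup>+x. ennreal ((1/2) ^ n) * indicator U x + ennreal (2 ^ n) * ennreal ((D n x)\<^sup>2) \<partial>M)"
      by (intro nn_integral_mono Dle)
    also have "\<dots> = ennreal ((1/2) ^ n) * emeasure M U + ennreal (2 ^ n) * (\<integral>\<^sup>+x. ennreal ((D n x)\<^sup>2) \<partial>M)"
      by (simp add: nn_integral_add nn_integral_cmult)
    also have "\<dots> \<le> ennreal ((1/2) ^ n) * ennreal mU + ennreal (2 ^ n) * ennreal (C * (1/4) ^ n)"
      using bound[of n "Suc n"] by (intro add_mono mult_left_mono) (auto simp: D_def mU)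
    also have "\<dots> = ennreal ((1/2) ^ n * mU + 2 ^ n * (C * (1/4) ^ n))"
      using mU C by (simp add: ennreal_mult)
    also have "2 ^ n * (C * (1/4) ^ n) = C * (1/2::real) ^ n"
      by (simp add: power_mult_distrib[symmetric])
    finally show ?thesis by (simp add: algebra_simps)
  qed
  then have "(\<Sum>n. \<integral>\<^sup>+x. ennreal (D n x) \<partial>M) \<le> (\<Sum>n. ennreal ((mU + C) * (1/2) ^ n))"
    by (intro suminf_le) auto
  also have "\<dots> < \<infinity>"
    using mU C by (subst suminf_ennreal2) (auto intro!: summable_mult summable_geometric)
  finally have "(\<integral>\<^sup>+x. (\<Sum>n. ennreal (D n x)) \<partial>M) \<noteq> \<infinity>"
    by (subst nn_integral_suminf) auto
  then have "AE x in M. (\<Sum>n. ennreal (D n x)) \<noteq> \<infinity>"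
    by (intro nn_integral_PInf_AE) auto
  then have conv: "AE x in M. convergent (\<lambda>n. f n x)"
  proof eventually_elim
    case (elim x)
    then have "summable (\<lambda>n. D n x)" by (intro summable_suminf_not_top) (auto simp: D_def)
    then have "summable (\<lambda>n. f (Suc n) x - f n x)" unfolding D_def by (rule summable_norm_cancel)
    then have "convergent (\<lambda>n. \<Sum>i<n. f (Suc i) x - f i x)" by (simp add: summable_iff_convergent)
    moreover have "(\<Sum>i<n. f (Suc i) x - f i x) = f n x - f 0 x" for n
      by (rule sum_lessThan_telescope)
    ultimately have "convergent (\<lambda>n. f n x - f 0 x)" by simp
    from convergent_add[OF this convergent_const[of "f 0 x"]] show ?case by simp
  qed
  define g where "g x = lim (\<lambda>n. f n x)" for x
  have [measurable]: "g \<in> borel_measurable M" unfolding g_def by measurable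
  have lim: "AE x in M. (\<lambda>n. f n x) \<longlonglongrightarrow> g x"
    using conv by eventually_elim (simp add: g_def convergent_LIMSEQ_iff)
  show ?thesis
  proof (rule that[of g])
    show "g x = 0" if "x \<notin> U" for x using zero[OF that] by (simp add: g_def)
    fix n
    show "(\<integral>\<^sup>+x. ennreal ((norm (g x - f n x))\<^sup>2) \<partial>M) \<le> ennreal (C * (1/4) ^ n)"
    proof (rule nn_integral_Fatou_le)
      show "AE x in M. (\<lambda>m. ennreal ((norm (f m x - f n x))\<^sup>2)) \<longlonglongrightarrow> ennreal ((norm (g x - f n x))\<^sup>2)"
        using lim by eventually_elim (intro tendsto_intros)
      show "\<forall>\<^sub>F m in sequentially. (\<integral>\<^sup>+x. ennreal ((norm (f m x - f n x))\<^sup>2) \<partial>M) \<le> ennreal (C * (1/4) ^ n)"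
        using bound by (intro eventually_sequentiallyI[of n]) auto
    qed measurable
  qed measurable
qed

lemma L2_AE_subseq:
  fixes u :: "'a \<Rightarrow> real"
  assumes [measurable]: "u \<in> borel_measurable M" "\<And>n. \<phi> n \<in> borel_measurable M"
    and lim: "(\<lambda>n. \<integral>\<^sup>+x. ennreal ((u x - \<phi> n x)\<^sup>2) \<partial>M) \<longlonglongrightarrow> 0"
  obtains r :: "nat \<Rightarrow> nat" where "strict_mono r" "AE x in M. (\<lambda>n. \<phi> (r n) x) \<longlonglongrightarrow> u x"
proof -
  have "\<forall>\<^sub>F n in sequentially. (\<integral>\<^sup>+x. ennreal ((u x - \<phi> n x)\<^sup>2) \<partial>M) < 1"
    using order_tendstoD(2)[OF lim, of 1] by simp
  \<comment> \<open>Discarding the initial terms makes all squares integrable, as the subsequence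
    theorem for \<open>L^1\<close> requires.\<close>
  then obtain n0 where n0: "\<And>n. n0 \<le> n \<Longrightarrow> (\<integral>\<^sup>+x. ennreal ((u x - \<phi> n x)\<^sup>2) \<partial>M) < 1"
    by (auto simp: eventually_sequentially)
  define v where "v n x = (u x - \<phi> (n + n0) x)\<^sup>2" for n x
  have fin: "(\<integral>\<^sup>+x. ennreal (v n x) \<partial>M) < 1" for n using n0[of "n + n0"] by (simp add: v_def)
  have int: "integrable M (v n)" for n
  proof (rule integrableI_bounded)
    show "v n \<in> borel_measurable M" unfolding v_def by measurable
    have "(\<integral>\<^sup>+x. ennreal (norm (v n x)) \<partial>M) = (\<integral>\<^sup>+x. ennreal (v n x) \<partial>M)"
      by (intro nn_integral_cong) (simp add: v_def)
    then show "(\<integral>\<^sup>+x. ennreal (norm (v n x)) \<partial>M) < \<infinity>" using fin[of n] by (simp add: order.strict_trans)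
  qed
  have "(\<lambda>n. \<integral>\<^sup>+x. ennreal (v n x) \<partial>M) \<longlonglongrightarrow> 0"
    using LIMSEQ_ignore_initial_segment[OF lim, of n0] by (simp add: v_def)
  then have "(\<lambda>n. enn2real (\<integral>\<^sup>+x. ennreal (v n x) \<partial>M)) \<longlonglongrightarrow> enn2real 0"
    by (intro tendsto_enn2real) auto
  moreover have "enn2real (\<integral>\<^sup>+x. ennreal (v n x) \<partial>M) = (\<integral>x. norm (v n x) \<partial>M)" for n
    using int[of n] by (subst integral_eq_nn_integral) (auto simp: v_def intro!: arg_cong[where f = enn2real] nn_integral_cong)
  ultimately have "(\<lambda>n. \<integral>x. norm (v n x) \<partial>M) \<longlonglongrightarrow> 0" by simp
  then obtain s where s: "strict_mono s" "AE x in M. (\<lambda>n. v (s n) x) \<longlonglongrightarrow> 0"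
    using tendsto_L1_AE_subseq[of M v] int by blast
  show ?thesis
  proof (rule that[of "\<lambda>n. s n + n0"])
    show "strict_mono (\<lambda>n. s n + n0)" using s(1) by (simp add: strict_mono_def)
    show "AE x in M. (\<lambda>n. \<phi> (s n + n0) x) \<longlonglongrightarrow> u x"
      using s(2)
    proof eventually_elim
      case (elim x)
      have "(\<lambda>n. sqrt (v (s n) x)) \<longlonglongrightarrow> 0" using tendsto_real_sqrt[OF elim] by simp
      then have "(\<lambda>n. \<bar>u x - \<phi> (s n + n0) x\<bar>) \<longlonglongrightarrow> 0" by (simp add: v_def)
      then have "(\<lambda>n. u x - \<phi> (s n + n0) x) \<longlonglongrightarrow> 0" by (simp add: tendsto_rabs_zero_iff)
      from tendsto_diff[OF tendsto_const[of "u x"] this] show ?case by simp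
    qed
  qed
qed

lemma nn_integral_square_triangle:
  fixes a b g :: "'a \<Rightarrow> 'b::euclidean_space"
  assumes [measurable]: "a \<in> borel_measurable M" "b \<in> borel_measurable M" "g \<in> borel_measurable M"
    and A: "(\<integral>\<^sup>+x. ennreal ((norm (a x - g x))\<^sup>2) \<partial>M) \<le> ennreal p"
    and B: "(\<integral>\<^sup>+x. ennreal ((norm (g x - b x))\<^sup>2) \<partial>M) \<le> ennreal q" and pq: "0 \<le> p" "0 \<le> q"
  shows "(\<integral>\<^sup>+x. ennreal ((norm (a x - b x))\<^sup>2) \<partial>M) \<le> ennreal (2 * p + 2 * q)"
proof -
  have "(\<integral>\<^sup>+x. ennreal ((norm (a x - b x))\<^sup>2) \<partial>M)
      \<le> (\<integral>\<^sup>+x. 2 * ennreal ((norm (a x - g x))\<^sup>2) + 2 * ennreal ((norm (g x - b x))\<^sup>2) \<partial>M)"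
  proof (intro nn_integral_mono)
    fix x
    have "norm (a x - b x) \<le> norm (a x - g x) + norm (g x - b x)"
      using norm_triangle_ineq[of "a x - g x" "g x - b x"] by simp
    then have "(norm (a x - b x))\<^sup>2 \<le> (norm (a x - g x) + norm (g x - b x))\<^sup>2" by (rule power_mono) simp
    also have "\<dots> \<le> 2 * (norm (a x - g x))\<^sup>2 + 2 * (norm (g x - b x))\<^sup>2"
      using sum_squares_bound[of "norm (a x - g x)" "norm (g x - b x)"] by (simp add: power2_sum)
    finally have "ennreal ((norm (a x - b x))\<^sup>2) \<le> ennreal (2 * (norm (a x - g x))\<^sup>2 + 2 * (norm (g x - b x))\<^sup>2)"
      by (rule ennreal_leI)
    also have "\<dots> = 2 * ennreal ((norm (a x - g x))\<^sup>2) + 2 * ennreal ((norm (g x - b x))\<^sup>2)"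
      by (simp add: ennreal_mult)
    finally show "ennreal ((norm (a x - b x))\<^sup>2)
        \<le> 2 * ennreal ((norm (a x - g x))\<^sup>2) + 2 * ennreal ((norm (g x - b x))\<^sup>2)" .
  qed
  also have "\<dots> = 2 * (\<integral>\<^sup>+x. ennreal ((norm (a x - g x))\<^sup>2) \<partial>M) + 2 * (\<integral>\<^sup>+x. ennreal ((norm (g x - b x))\<^sup>2) \<partial>M)"
    by (simp add: nn_integral_add nn_integral_cmult)
  also have "\<dots> \<le> 2 * ennreal p + 2 * ennreal q" using A B by (intro add_mono mult_left_mono) auto
  also have "\<dots> = ennreal (2 * p + 2 * q)" using pq by (simp add: ennreal_mult)
  finally show ?thesis .
qed

text \<open>Cauchy-Schwarz; integrability of the limit product is a by-product, obtained by adding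
  an integrable term to an integrable difference.\<close>

lemma L2_tendsto_integral:
  fixes v :: "'a \<Rightarrow> real"
  assumes [measurable]: "v \<in> borel_measurable M" "\<And>k. w k \<in> borel_measurable M" "\<theta> \<in> borel_measurable M"
    and X: "(\<integral>\<^sup>+x. ennreal ((\<theta> x)\<^sup>2) \<partial>M) \<le> ennreal X" "0 \<le> X"
    and lim: "(\<lambda>k. \<integral>\<^sup>+x. ennreal ((v x - w k x)\<^sup>2) \<partial>M) \<longlonglongrightarrow> 0"
    and int: "\<And>k. integrable M (\<lambda>x. w k x * \<theta> x)"
  shows "(\<lambda>k. \<integral>x. w k x * \<theta> x \<partial>M) \<longlonglongrightarrow> (\<integral>x. v x * \<theta> x \<partial>M)"
proof (rule LIMSEQ_I)
  fix e :: real assume e: "0 < e"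
  define \<delta> where "\<delta> = (e / (2 * (sqrt X + 1)))\<^sup>2"
  have sX: "0 < sqrt X + 1" using X by (intro add_nonneg_pos) auto
  have \<delta>: "0 < \<delta>" unfolding \<delta>_def using e sX by (intro zero_less_power divide_pos_pos) auto
  have "\<forall>\<^sub>F k in sequentially. (\<integral>\<^sup>+x. ennreal ((v x - w k x)\<^sup>2) \<partial>M) < ennreal \<delta>"
    using order_tendstoD(2)[OF lim, of "ennreal \<delta>"] \<delta> by simp
  then obtain k0 where k0: "\<And>k. k0 \<le> k \<Longrightarrow> (\<integral>\<^sup>+x. ennreal ((v x - w k x)\<^sup>2) \<partial>M) < ennreal \<delta>"
    by (auto simp: eventually_sequentially)
  show "\<exists>k0. \<forall>k\<ge>k0. norm ((\<integral>x. w k x * \<theta> x \<partial>M) - (\<integral>x. v x * \<theta> x \<partial>M)) < e"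
  proof (intro exI allI impI)
    fix k assume k: "k0 \<le> k"
    have "(\<integral>\<^sup>+x. ennreal (\<bar>v x - w k x\<bar> * \<bar>\<theta> x\<bar>) \<partial>M) \<le> ennreal (\<delta> powr (1 / 2) * X powr (1 / 2))"
      using X \<delta> k0[OF k] by (intro Holder_powr2) (auto simp: powr_numeral)
    also have "\<delta> powr (1 / 2) * X powr (1 / 2) = e / (2 * (sqrt X + 1)) * sqrt X"
      using e X by (simp add: \<delta>_def powr_half_sqrt real_sqrt_divide)
    finally have le: "(\<integral>\<^sup>+x. ennreal (norm ((v x - w k x) * \<theta> x)) \<partial>M) \<le> ennreal (e / (2 * (sqrt X + 1)) * sqrt X)"
      by (simp add: abs_mult)
    have i: "integrable M (\<lambda>x. (v x - w k x) * \<theta> x)"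
      by (rule integrableI_bounded) (use le in \<open>auto simp: order.strict_trans1\<close>)
    have "integrable M (\<lambda>x. (v x - w k x) * \<theta> x + w k x * \<theta> x)"
      using i int by (rule Bochner_Integration.integrable_add)
    then have iv: "integrable M (\<lambda>x. v x * \<theta> x)" by (simp add: algebra_simps)
    have "(\<integral>x. (v x - w k x) * \<theta> x \<partial>M) = (\<integral>x. v x * \<theta> x \<partial>M) - (\<integral>x. w k x * \<theta> x \<partial>M)"
      using iv int by (simp add: left_diff_distrib)
    moreover have "ennreal (norm (\<integral>x. (v x - w k x) * \<theta> x \<partial>M)) \<le> ennreal (e / (2 * (sqrt X + 1)) * sqrt X)"
      using integral_norm_bound_ennreal[OF i] le by (rule order_trans)
    moreover have p: "0 \<le> e / (2 * (sqrt X + 1)) * sqrt X" using e X by simp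
    moreover have "e / (2 * (sqrt X + 1)) * sqrt X < e"
      using e X by (simp add: divide_less_eq add_nonneg_pos)
    ultimately show "norm ((\<integral>x. w k x * \<theta> x \<partial>M) - (\<integral>x. v x * \<theta> x \<partial>M)) < e"
      by (simp add: abs_minus_commute)
  qed
qed

section \<open>From test functions to their limits\<close>

context drift_diffusion
begin

text \<open>On a bounded set this follows from Sobolev's inequality by Hoelder's inequality for the
  square and the indicator of \<open>U\<close>.\<close>

lemma Poincare_nn:
  assumes \<phi>: "test_fun U \<phi>"
  shows "(\<integral>\<^sup>+x. ennreal ((\<phi> x)\<^sup>2) \<partial>lebesgue) \<le> ennreal ((measure lebesgue U powr (1 / d) * S * gnorm \<phi>)\<^sup>2)"
proof -
  note [measurable] = test_fun_measurable_lebesgue[OF \<phi>]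
  have Um: "U \<in> lmeasurable" by (rule lmeasurable_open[OF U(2,1)])
  then have [measurable]: "U \<in> sets lebesgue" by auto
  let ?g = "S * gnorm \<phi>"
  have g: "0 \<le> ?g" using S gnorm_nonneg[of \<phi>] by simp
  have p: "0 < ps" "0 < d" using ps d3 by auto
  have "(\<integral>\<^sup>+x. ennreal ((\<phi> x)\<^sup>2 * indicator U x) \<partial>lebesgue)
      \<le> ennreal ((?g powr ps) powr (1 / (ps / 2)) * (measure lebesgue U) powr (1 / (d / 2)))"
  proof (rule Holder_powr2)
    have "((\<phi> x)\<^sup>2) powr (ps / 2) = \<bar>\<phi> x\<bar> powr ps" for x
    proof -
      have "((\<phi> x)\<^sup>2) powr (ps / 2) = (\<bar>\<phi> x\<bar> powr 2) powr (ps / 2)" by (simp add: powr_numeral)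
      then show ?thesis by (simp only: powr_powr) simp
    qed
    then show "(\<integral>\<^sup>+x. ennreal (((\<phi> x)\<^sup>2) powr (ps / 2)) \<partial>lebesgue) \<le> ennreal (?g powr ps)"
      using Sobolev_nn[OF \<phi>] by simp
    have "indicator U x powr (d / 2) = (indicator U x :: real)" for x by (simp add: indicator_def)
    then show "(\<integral>\<^sup>+x. ennreal (indicator U x powr (d / 2)) \<partial>lebesgue) \<le> ennreal (measure lebesgue U)"
      using Um by (simp add: ennreal_indicator emeasure_eq_measure2)
  qed (use p ps in auto)
  also have "(?g powr ps) powr (1 / (ps / 2)) = ?g\<^sup>2" using p g by (simp add: powr_powr powr_numeral)
  also have "(measure lebesgue U) powr (1 / (d / 2)) = ((measure lebesgue U) powr (1 / d))\<^sup>2"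
    by (subst powr_numeral[symmetric]) (auto simp: powr_powr)
  also have "(\<integral>\<^sup>+x. ennreal ((\<phi> x)\<^sup>2 * indicator U x) \<partial>lebesgue) = (\<integral>\<^sup>+x. ennreal ((\<phi> x)\<^sup>2) \<partial>lebesgue)"
    using test_fun_outside[OF \<phi>] by (intro nn_integral_cong) (auto split: split_indicator)
  finally show ?thesis by (simp add: power_mult_distrib mult_ac)
qed

text \<open>Membership in the closure of the test functions, phrased on the whole space: the
  integrals are not restricted to \<open>U\<close>, so \<open>u\<close> and \<open>G\<close> must
  vanish almost everywhere outside it.\<close>

definition approximates :: "(nat \<Rightarrow> real^'n \<Rightarrow> real) \<Rightarrow> (real^'n \<Rightarrow> real) \<Rightarrow> (real^'n \<Rightarrow> real^'n) \<Rightarrow> bool" where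
  "approximates \<phi> u G \<longleftrightarrow> (\<forall>k. test_fun U (\<phi> k)) \<and> u \<in> borel_measurable lebesgue \<and> G \<in> borel_measurable lebesgue \<and>
     ((\<lambda>k. \<integral>\<^sup>+x. ennreal ((u x - \<phi> k x)\<^sup>2) \<partial>lebesgue) \<longlonglongrightarrow> 0) \<and>
     ((\<lambda>k. \<integral>\<^sup>+x. ennreal ((norm (G x - grad (\<phi> k) x))\<^sup>2) \<partial>lebesgue) \<longlonglongrightarrow> 0)"

lemma test_fun_diff: "test_fun U f \<Longrightarrow> test_fun U g \<Longrightarrow> test_fun U (\<lambda>x. f x - g x)"
  using test_fun_lin[of U f g "- 1"] by simp

lemma grad_diff: "test_fun U f \<Longrightarrow> test_fun U g \<Longrightarrow> grad (\<lambda>x. f x - g x) x = grad f x - grad g x"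
  using grad_lin[of U f g "- 1" x] by simp

text \<open>The approximation is uniform in the test function, relative to its norm. Convergence in
  L2 gives no bound in \<open>L^ps\<close> for the zero-order term; that bound comes from Sobolev's
  inequality for differences of approximants, carried to \<open>u\<close> by Fatou's lemma along an
  almost everywhere convergent subsequence.\<close>

lemma form_approx:
  assumes ap: "approximates \<phi> u G" and \<epsilon>: "0 < \<epsilon>"
  shows "\<forall>\<^sub>F k in sequentially. \<forall>\<psi>. test_fun U \<psi> \<longrightarrow> \<bar>form u G \<psi> - form (\<phi> k) (grad (\<phi> k)) \<psi>\<bar> \<le> \<epsilon> * gnorm \<psi>"
proof -
  have \<phi>: "\<And>k. test_fun U (\<phi> k)" and m [measurable]: "u \<in> borel_measurable lebesgue" "G \<in> borel_measurable lebesgue"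
    and lu: "(\<lambda>k. \<integral>\<^sup>+x. ennreal ((u x - \<phi> k x)\<^sup>2) \<partial>lebesgue) \<longlonglongrightarrow> 0"
    and lG: "(\<lambda>k. \<integral>\<^sup>+x. ennreal ((norm (G x - grad (\<phi> k) x))\<^sup>2) \<partial>lebesgue) \<longlonglongrightarrow> 0"
    using ap by (auto simp: approximates_def)
  note [measurable] = test_fun_measurable_lebesgue[OF \<phi>] grad_measurable_lebesgue[OF \<phi>]
  have p0: "0 < ps" using ps by simp
  \<comment> \<open>\<open>form_bound\<close> will be used with gradient bound
    \<open>\<delta>\<close> and \<open>L^ps\<close> bound \<open>S * (2 * \<delta>)\<close>, since
    two approximants whose gradients are within \<open>\<delta>\<close> of \<open>G\<close> are
    within \<open>2 * \<delta>\<close> of each other.\<close>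
  define \<delta> where "\<delta> = \<epsilon> / (C1 * (1 + 2 * S) + 1)"
  have den: "0 < C1 * (1 + 2 * S) + 1" using C1_nonneg S by (simp add: add_nonneg_pos)
  have \<delta>: "0 < \<delta>" "C1 * (\<delta> + S * (2 * \<delta>)) \<le> \<epsilon>"
  proof -
    show "0 < \<delta>" using \<epsilon> den by (simp add: \<delta>_def)
    have "C1 * (\<delta> + S * (2 * \<delta>)) = (C1 * (1 + 2 * S)) * \<delta>" by (simp add: algebra_simps)
    also have "\<dots> \<le> (C1 * (1 + 2 * S) + 1) * \<delta>" using \<open>0 < \<delta>\<close> by (simp add: mult_right_mono)
    also have "\<dots> = \<epsilon>" using den by (simp add: \<delta>_def)
    finally show "C1 * (\<delta> + S * (2 * \<delta>)) \<le> \<epsilon>" .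
  qed
  have "\<forall>\<^sub>F k in sequentially. (\<integral>\<^sup>+x. ennreal ((norm (G x - grad (\<phi> k) x))\<^sup>2) \<partial>lebesgue) < ennreal (\<delta>\<^sup>2)"
    using order_tendstoD(2)[OF lG, of "ennreal (\<delta>\<^sup>2)"] \<delta> by simp
  then obtain k0 where k0: "\<And>k. k0 \<le> k \<Longrightarrow> (\<integral>\<^sup>+x. ennreal ((norm (G x - grad (\<phi> k) x))\<^sup>2) \<partial>lebesgue) < ennreal (\<delta>\<^sup>2)"
    by (auto simp: eventually_sequentially)
  have gd: "gnorm (\<lambda>x. \<phi> m x - \<phi> k x) \<le> 2 * \<delta>" if "k0 \<le> m" "k0 \<le> k" for m k
  proof -
    have "ennreal ((gnorm (\<lambda>x. \<phi> m x - \<phi> k x))\<^sup>2) = (\<integral>\<^sup>+x. ennreal ((norm (grad (\<phi> m) x - grad (\<phi> k) x))\<^sup>2) \<partial>lebesgue)"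
      using nn_integral_grad_square[OF test_fun_diff[OF \<phi> \<phi>], of m k] by (simp add: grad_diff[OF \<phi> \<phi>])
    also have "\<dots> \<le> ennreal (2 * \<delta>\<^sup>2 + 2 * \<delta>\<^sup>2)"
      using k0[OF that(1)] k0[OF that(2)]
      by (intro nn_integral_square_triangle[where g = G]) (auto simp: norm_minus_commute)
    finally have "(gnorm (\<lambda>x. \<phi> m x - \<phi> k x))\<^sup>2 \<le> (2 * \<delta>)\<^sup>2" by (simp add: power_mult_distrib)
    then show ?thesis by (rule power2_le_imp_le) (use \<delta> in simp)
  qed
  obtain r where r: "strict_mono r" "AE x in lebesgue. (\<lambda>n. \<phi> (r n) x) \<longlonglongrightarrow> u x"
    by (rule L2_AE_subseq[OF m(1) test_fun_measurable_lebesgue[OF \<phi>] lu]) (rule that)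
  have ub: "(\<integral>\<^sup>+x. ennreal (\<bar>u x - \<phi> k x\<bar> powr ps) \<partial>lebesgue) \<le> ennreal ((S * (2 * \<delta>)) powr ps)" if k: "k0 \<le> k" for k
  proof (rule nn_integral_Fatou_le[where F = "\<lambda>n x. ennreal (\<bar>\<phi> (r n) x - \<phi> k x\<bar> powr ps)"])
    show "AE x in lebesgue. (\<lambda>n. ennreal (\<bar>\<phi> (r n) x - \<phi> k x\<bar> powr ps)) \<longlonglongrightarrow> ennreal (\<bar>u x - \<phi> k x\<bar> powr ps)"
      using r(2)
    proof eventually_elim
      case (elim x)
      have "(\<lambda>n. \<bar>\<phi> (r n) x - \<phi> k x\<bar> powr ps) \<longlonglongrightarrow> \<bar>u x - \<phi> k x\<bar> powr ps"
        using p0 by (intro tendsto_powr' tendsto_rabs tendsto_diff elim tendsto_const) auto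
      then show ?case by (rule tendsto_ennrealI)
    qed
    show "\<forall>\<^sub>F n in sequentially. (\<integral>\<^sup>+x. ennreal (\<bar>\<phi> (r n) x - \<phi> k x\<bar> powr ps) \<partial>lebesgue) \<le> ennreal ((S * (2 * \<delta>)) powr ps)"
    proof (rule eventually_sequentiallyI[of k0])
      fix n assume "k0 \<le> n"
      then have n: "k0 \<le> r n" using seq_suble[OF r(1), of n] by linarith
      have "(S * gnorm (\<lambda>x. \<phi> (r n) x - \<phi> k x)) powr ps \<le> (S * (2 * \<delta>)) powr ps"
        using gd[OF n k] S gnorm_nonneg[of "\<lambda>x. \<phi> (r n) x - \<phi> k x"] p0 by (intro powr_mono2 mult_left_mono) auto
      then show "(\<integral>\<^sup>+x. ennreal (\<bar>\<phi> (r n) x - \<phi> k x\<bar> powr ps) \<partial>lebesgue) \<le> ennreal ((S * (2 * \<delta>)) powr ps)"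
        using Sobolev_nn[OF test_fun_diff[OF \<phi> \<phi>], of "r n" k] by (meson ennreal_leI order_trans)
    qed
  qed measurable
  show ?thesis
  proof (rule eventually_sequentiallyI[of k0], intro allI impI)
    fix k \<psi> assume k: "k0 \<le> k" and \<psi>: "test_fun U \<psi>"
    let ?v = "\<lambda>x. u x - \<phi> k x" and ?K = "\<lambda>x. G x - grad (\<phi> k) x"
    have b: "integrable lebesgue (integrand ?v ?K \<psi>)" "\<bar>form ?v ?K \<psi>\<bar> \<le> C1 * (\<delta> + S * (2 * \<delta>)) * gnorm \<psi>"
      using \<delta> S k0[OF k] form_bound[of ?v ?K \<delta> "S * (2 * \<delta>)" \<psi>, OF _ _ _ _ _ ub[OF k] \<psi>]
      by (simp_all add: less_imp_le)
    have "form u G \<psi> = form (\<phi> k) (grad (\<phi> k)) \<psi> + form ?v ?K \<psi>"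
      using form_lin1(2)[OF form_test_fun(1)[OF \<phi> \<psi>] b(1), of k 1] by simp
    moreover have "C1 * (\<delta> + S * (2 * \<delta>)) * gnorm \<psi> \<le> \<epsilon> * gnorm \<psi>"
      using \<delta>(2) gnorm_nonneg by (rule mult_right_mono)
    ultimately show "\<bar>form u G \<psi> - form (\<phi> k) (grad (\<phi> k)) \<psi>\<bar> \<le> \<epsilon> * gnorm \<psi>" using b(2) by simp
  qed
qed

text \<open>Integration by parts for the approximants, with both sides converging by
  \<open>L2_tendsto_integral\<close>.\<close>

lemma weak_gradient_approx:
  assumes ap: "approximates \<phi> u G" and \<psi>: "test_fun U \<psi>"
  shows "(\<integral>x. u x * pderiv_i i \<psi> x \<partial>lebesgue) = - (\<integral>x. G x $ i * \<psi> x \<partial>lebesgue)"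
proof -
  have \<phi>: "\<And>k. test_fun U (\<phi> k)" and m [measurable]: "u \<in> borel_measurable lebesgue" "G \<in> borel_measurable lebesgue"
    and lu: "(\<lambda>k. \<integral>\<^sup>+x. ennreal ((u x - \<phi> k x)\<^sup>2) \<partial>lebesgue) \<longlonglongrightarrow> 0"
    and lG: "(\<lambda>k. \<integral>\<^sup>+x. ennreal ((norm (G x - grad (\<phi> k) x))\<^sup>2) \<partial>lebesgue) \<longlonglongrightarrow> 0"
    using ap by (auto simp: approximates_def)
  have tm: "f \<in> borel_measurable borel" if "test_fun U f" for f using that by (rule test_fun_measurable)
  have sq: "(\<integral>\<^sup>+x. ennreal ((\<theta> x)\<^sup>2) \<partial>lebesgue) \<le> ennreal (\<integral>x. (\<theta> x)\<^sup>2 \<partial>lebesgue)" if "test_fun U \<theta>" for \<theta>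
    using test_fun_integrable[OF test_fun_mult[OF that that]]
    by (subst nn_integral_eq_integral) (auto simp: power2_eq_square integrable_completion tm[OF that] tm[OF test_fun_mult[OF that that]])
  have int: "integrable lebesgue (\<lambda>x. f x * g x)" if "test_fun U f" "test_fun U g" for f g
    using test_fun_integrable[OF test_fun_mult[OF that]] tm[OF test_fun_mult[OF that]] by (simp add: integrable_completion)
  have D: "test_fun U (pderiv_i i \<psi>)" "\<And>k. test_fun U (pderiv_i i (\<phi> k))"
    using \<psi> \<phi> by (auto intro: test_fun_pderiv)
  have 1: "(\<lambda>k. \<integral>x. \<phi> k x * pderiv_i i \<psi> x \<partial>lebesgue) \<longlonglongrightarrow> (\<integral>x. u x * pderiv_i i \<psi> x \<partial>lebesgue)"
    by (rule L2_tendsto_integral[OF m(1) test_fun_measurable_lebesgue[OF \<phi>] test_fun_measurable_lebesgue[OF D(1)]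
          sq[OF D(1)] _ lu int[OF \<phi> D(1)]]) simp
  have Gi: "(\<lambda>x. G x $ i) \<in> borel_measurable lebesgue"
    using borel_measurable_inner[OF m(2) borel_measurable_const[of "axis i 1"]] by (simp add: inner_axis)
  have lGi: "(\<lambda>k. \<integral>\<^sup>+x. ennreal ((G x $ i - pderiv_i i (\<phi> k) x)\<^sup>2) \<partial>lebesgue) \<longlonglongrightarrow> 0"
  proof (rule tendsto_sandwich[OF _ _ tendsto_const lG])
    show "\<forall>\<^sub>F k in sequentially. (\<integral>\<^sup>+x. ennreal ((G x $ i - pderiv_i i (\<phi> k) x)\<^sup>2) \<partial>lebesgue)
        \<le> (\<integral>\<^sup>+x. ennreal ((norm (G x - grad (\<phi> k) x))\<^sup>2) \<partial>lebesgue)"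
    proof (intro always_eventually allI nn_integral_mono ennreal_leI)
      fix k x
      have "\<bar>(G x - grad (\<phi> k) x) $ i\<bar> \<le> norm (G x - grad (\<phi> k) x)" by (rule component_le_norm_cart)
      then show "(G x $ i - pderiv_i i (\<phi> k) x)\<^sup>2 \<le> (norm (G x - grad (\<phi> k) x))\<^sup>2"
        by (intro abs_le_square_iff[THEN iffD1]) (simp add: grad_def)
    qed
  qed simp
  have 2: "(\<lambda>k. \<integral>x. pderiv_i i (\<phi> k) x * \<psi> x \<partial>lebesgue) \<longlonglongrightarrow> (\<integral>x. G x $ i * \<psi> x \<partial>lebesgue)"
    by (rule L2_tendsto_integral[OF Gi test_fun_measurable_lebesgue[OF D(2)] test_fun_measurable_lebesgue[OF \<psi>]
          sq[OF \<psi>] _ lGi int[OF D(2) \<psi>]]) simp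
  have "(\<integral>x. \<phi> k x * pderiv_i i \<psi> x \<partial>lebesgue) = - (\<integral>x. pderiv_i i (\<phi> k) x * \<psi> x \<partial>lebesgue)" for k
    using integral_pderiv_by_parts[OF \<phi>[of k] \<psi>, of i]
      tm[OF test_fun_mult[OF \<phi> D(1)], of k] tm[OF test_fun_mult[OF D(2) \<psi>], of k]
    by (simp add: integral_completion)
  then show ?thesis using LIMSEQ_unique[OF 1] tendsto_minus[OF 2] by simp
qed

text \<open>The difference of two approximants is a test function whose form is small in the dual
  norm, because both solutions produce the same functional \<open>F\<close>. Stability at
  \<open>t = 1\<close> and Poincare's inequality make it small in L2.\<close>

lemma uniqueness:
  assumes 1: "approximates \<phi>1 u1 G1" "\<And>\<psi>. test_fun U \<psi> \<Longrightarrow> form u1 G1 \<psi> = F \<psi>"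
    and 2: "approximates \<phi>2 u2 G2" "\<And>\<psi>. test_fun U \<psi> \<Longrightarrow> form u2 G2 \<psi> = F \<psi>"
  shows "AE x in lebesgue. u1 x = u2 x"
proof -
  from stability obtain \<kappa> where \<kappa>: "0 \<le> \<kappa>"
    "\<forall>t u N. t \<in> {0..1} \<longrightarrow> test_fun U u \<longrightarrow> 0 \<le> N \<longrightarrow>
     (\<forall>v. test_fun U v \<longrightarrow> \<bar>(1 - t) * ip u v + t * form u (grad u) v\<bar> \<le> N * gnorm v) \<longrightarrow> gnorm u \<le> \<kappa> * N"
    by (elim exE conjE) (rule that)
  have \<phi>: "\<And>k. test_fun U (\<phi>1 k)" "\<And>k. test_fun U (\<phi>2 k)"
    and m [measurable]: "u1 \<in> borel_measurable lebesgue" "u2 \<in> borel_measurable lebesgue"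
    and lu: "(\<lambda>k. \<integral>\<^sup>+x. ennreal ((u1 x - \<phi>1 k x)\<^sup>2) \<partial>lebesgue) \<longlonglongrightarrow> 0"
      "(\<lambda>k. \<integral>\<^sup>+x. ennreal ((u2 x - \<phi>2 k x)\<^sup>2) \<partial>lebesgue) \<longlonglongrightarrow> 0"
    using 1 2 by (auto simp: approximates_def)
  note [measurable] = test_fun_measurable_lebesgue[OF \<phi>(1)] test_fun_measurable_lebesgue[OF \<phi>(2)]
  let ?P = "measure lebesgue U powr (1 / d) * S"
  have P: "0 \<le> ?P" using S by simp
  have key: "(\<integral>\<^sup>+x. ennreal ((norm (u1 x - u2 x))\<^sup>2) \<partial>lebesgue) \<le> ennreal e" if e: "0 < e" for e
  proof -
    \<comment> \<open>Chosen so that the Poincare constant times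
      \<open>\<kappa> * (2 * \<delta>)\<close> is at most \<open>sqrt (e / 16)\<close>; two triangle
      inequalities for squares then add up to \<open>3 / 4 * e\<close>.\<close>
    define \<delta> where "\<delta> = sqrt (e / 16) / (?P * \<kappa> * 2 + 1)"
    have den: "0 < ?P * \<kappa> * 2 + 1" using P \<kappa>(1) by (simp add: add_nonneg_pos)
    have \<delta>: "0 < \<delta>" using e den by (simp add: \<delta>_def)
    have "\<forall>\<^sub>F k in sequentially. (\<integral>\<^sup>+x. ennreal ((u1 x - \<phi>1 k x)\<^sup>2) \<partial>lebesgue) < ennreal (e / 16)"
      "\<forall>\<^sub>F k in sequentially. (\<integral>\<^sup>+x. ennreal ((u2 x - \<phi>2 k x)\<^sup>2) \<partial>lebesgue) < ennreal (e / 8)"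
      using order_tendstoD(2)[OF lu(1), of "ennreal (e / 16)"] order_tendstoD(2)[OF lu(2), of "ennreal (e / 8)"] e by auto
    then have "\<forall>\<^sub>F k in sequentially. (\<integral>\<^sup>+x. ennreal ((u1 x - \<phi>1 k x)\<^sup>2) \<partial>lebesgue) < ennreal (e / 16) \<and>
       (\<integral>\<^sup>+x. ennreal ((u2 x - \<phi>2 k x)\<^sup>2) \<partial>lebesgue) < ennreal (e / 8) \<and>
       (\<forall>\<psi>. test_fun U \<psi> \<longrightarrow> \<bar>form u1 G1 \<psi> - form (\<phi>1 k) (grad (\<phi>1 k)) \<psi>\<bar> \<le> \<delta> * gnorm \<psi>) \<and>
       (\<forall>\<psi>. test_fun U \<psi> \<longrightarrow> \<bar>form u2 G2 \<psi> - form (\<phi>2 k) (grad (\<phi>2 k)) \<psi>\<bar> \<le> \<delta> * gnorm \<psi>)"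
      using form_approx[OF 1(1) \<delta>] form_approx[OF 2(1) \<delta>] by eventually_elim blast
    then obtain k where k: "(\<integral>\<^sup>+x. ennreal ((u1 x - \<phi>1 k x)\<^sup>2) \<partial>lebesgue) < ennreal (e / 16)"
       "(\<integral>\<^sup>+x. ennreal ((u2 x - \<phi>2 k x)\<^sup>2) \<partial>lebesgue) < ennreal (e / 8)"
       "\<And>\<psi>. test_fun U \<psi> \<Longrightarrow> \<bar>form u1 G1 \<psi> - form (\<phi>1 k) (grad (\<phi>1 k)) \<psi>\<bar> \<le> \<delta> * gnorm \<psi>"
       "\<And>\<psi>. test_fun U \<psi> \<Longrightarrow> \<bar>form u2 G2 \<psi> - form (\<phi>2 k) (grad (\<phi>2 k)) \<psi>\<bar> \<le> \<delta> * gnorm \<psi>"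
      unfolding eventually_sequentially by blast
    let ?v = "\<lambda>x. \<phi>1 k x + - 1 * \<phi>2 k x"
    have v: "test_fun U ?v" by (rule test_fun_lin[OF \<phi>])
    have "gnorm ?v \<le> \<kappa> * (2 * \<delta>)"
    proof (rule \<kappa>(2)[rule_format, of 1])
      fix \<psi> assume \<psi>: "test_fun U \<psi>"
      have "form ?v (grad ?v) \<psi> = form (\<phi>1 k) (grad (\<phi>1 k)) \<psi> + - 1 * form (\<phi>2 k) (grad (\<phi>2 k)) \<psi>"
        by (rule form_test_fun_lin1[OF \<phi> \<psi>])
      then have "\<bar>form ?v (grad ?v) \<psi>\<bar> \<le> 2 * (\<delta> * gnorm \<psi>)"
        using k(3)[OF \<psi>] k(4)[OF \<psi>] 1(2)[OF \<psi>] 2(2)[OF \<psi>] by linarith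
      then show "\<bar>(1 - 1) * ip ?v \<psi> + 1 * form ?v (grad ?v) \<psi>\<bar> \<le> 2 * \<delta> * gnorm \<psi>"
        by simp
    qed (use v \<delta> in auto)
    then have "?P * gnorm ?v \<le> ?P * (\<kappa> * (2 * \<delta>))" using P by (rule mult_left_mono)
    also have "\<dots> = (?P * \<kappa> * 2) * \<delta>" by simp
    also have "\<dots> \<le> (?P * \<kappa> * 2 + 1) * \<delta>" using \<delta> by (intro mult_right_mono) auto
    also have "\<dots> = sqrt (e / 16)" using den by (simp add: \<delta>_def)
    finally have "(?P * gnorm ?v)\<^sup>2 \<le> (sqrt (e / 16))\<^sup>2"
      using P gnorm_nonneg[of ?v] by (intro power_mono) auto
    then have "ennreal ((?P * gnorm ?v)\<^sup>2) \<le> ennreal (e / 16)" using e by (intro ennreal_leI) simp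
    then have "(\<integral>\<^sup>+x. ennreal ((?v x)\<^sup>2) \<partial>lebesgue) \<le> ennreal (e / 16)"
      using Poincare_nn[OF v] by (rule order_trans[rotated])
    then have "(\<integral>\<^sup>+x. ennreal ((norm (\<phi>1 k x - \<phi>2 k x))\<^sup>2) \<partial>lebesgue) \<le> ennreal (e / 16)" by simp
    moreover have "(\<integral>\<^sup>+x. ennreal ((norm (u1 x - \<phi>1 k x))\<^sup>2) \<partial>lebesgue) \<le> ennreal (e / 16)"
      using k(1) by simp
    ultimately have "(\<integral>\<^sup>+x. ennreal ((norm (u1 x - \<phi>2 k x))\<^sup>2) \<partial>lebesgue) \<le> ennreal (2 * (e / 16) + 2 * (e / 16))"
      using e by (intro nn_integral_square_triangle[where g = "\<phi>1 k"]) auto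
    moreover have "(\<integral>\<^sup>+x. ennreal ((norm (\<phi>2 k x - u2 x))\<^sup>2) \<partial>lebesgue) \<le> ennreal (e / 8)"
      using k(2) by (simp add: power2_commute[of "\<phi>2 k _"])
    ultimately have "(\<integral>\<^sup>+x. ennreal ((norm (u1 x - u2 x))\<^sup>2) \<partial>lebesgue) \<le> ennreal (2 * (2 * (e / 16) + 2 * (e / 16)) + 2 * (e / 8))"
      using e by (intro nn_integral_square_triangle[where g = "\<phi>2 k" and p = "2 * (e / 16) + 2 * (e / 16)" and q = "e / 8"]) auto
    also have "2 * (2 * (e / 16) + 2 * (e / 16)) + 2 * (e / 8) = 3 / 4 * e" by simp
    also have "ennreal (3 / 4 * e) \<le> ennreal e" using e by (intro ennreal_leI) simp
    finally show ?thesis .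
  qed
  have "(\<integral>\<^sup>+x. ennreal ((norm (u1 x - u2 x))\<^sup>2) \<partial>lebesgue) \<le> 0"
    by (rule ennreal_le_epsilon) (use key in auto)
  then have "AE x in lebesgue. ennreal ((norm (u1 x - u2 x))\<^sup>2) = 0"
    by (subst (asm) le_zero_eq, subst (asm) nn_integral_0_iff_AE) auto
  then show ?thesis by eventually_elim simp
qed

lemma existence:
  assumes f: "f \<in> borel_measurable lebesgue" "integrable lebesgue (\<lambda>x. \<bar>f x\<bar> powr (2 * d / (d + 2)))"
  obtains \<phi> u G where "approximates \<phi> u G" "\<And>x. x \<notin> U \<Longrightarrow> u x = 0" "\<And>x. x \<notin> U \<Longrightarrow> G x = 0"
    "\<And>\<psi>. test_fun U \<psi> \<Longrightarrow> form u G \<psi> = (\<integral>x. f x * \<psi> x \<partial>lebesgue)"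
proof -
  from stability obtain \<kappa> where \<kappa>: "0 \<le> \<kappa>"
    "\<forall>t u N. t \<in> {0..1} \<longrightarrow> test_fun U u \<longrightarrow> 0 \<le> N \<longrightarrow>
     (\<forall>v. test_fun U v \<longrightarrow> \<bar>(1 - t) * ip u v + t * form u (grad u) v\<bar> \<le> N * gnorm v) \<longrightarrow> gnorm u \<le> \<kappa> * N"
    by (elim exE conjE) (rule that)
  define F where "F \<psi> = (\<integral>x. f x * \<psi> x \<partial>lebesgue)" for \<psi>
  let ?q = "2 * d / (d + 2)"
  let ?Kf = "(\<integral>x. \<bar>f x\<bar> powr ?q \<partial>lebesgue) powr (1 / ?q)"
  have p0: "0 < ps" "0 < ?q" using ps d3 by auto
  \<comment> \<open>The exponent of \<open>f\<close> is conjugate to \<open>ps\<close>, so Sobolev's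
    inequality makes \<open>F\<close> bounded in the Dirichlet norm.\<close>
  have Fb: "integrable lebesgue (\<lambda>x. f x * \<psi> x)" "\<bar>F \<psi>\<bar> \<le> ?Kf * S * gnorm \<psi>" if \<psi>: "test_fun U \<psi>" for \<psi>
  proof -
    note [measurable] = f(1) test_fun_measurable_lebesgue[OF \<psi>]
    have nS: "0 \<le> S * gnorm \<psi>" using S gnorm_nonneg[of \<psi>] by simp
    have "(\<integral>\<^sup>+x. ennreal (\<bar>f x\<bar> * \<bar>\<psi> x\<bar>) \<partial>lebesgue) \<le> ennreal (?Kf * ((S * gnorm \<psi>) powr ps) powr (1 / ps))"
      using Sobolev_nn[OF \<psi>] p0 ps nn_integral_eq_integral[OF f(2)] by (intro Holder_powr2) auto
    also have "((S * gnorm \<psi>) powr ps) powr (1 / ps) = S * gnorm \<psi>" using nS p0 by (simp add: powr_powr)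
    finally have le: "(\<integral>\<^sup>+x. ennreal (norm (f x * \<psi> x)) \<partial>lebesgue) \<le> ennreal (?Kf * (S * gnorm \<psi>))"
      by (simp add: abs_mult)
    show i: "integrable lebesgue (\<lambda>x. f x * \<psi> x)"
      by (rule integrableI_bounded) (use le in \<open>auto simp: order.strict_trans1\<close>)
    have "ennreal (norm (F \<psi>)) \<le> ennreal (?Kf * (S * gnorm \<psi>))"
      unfolding F_def using integral_norm_bound_ennreal[OF i] le by (rule order_trans)
    moreover have "0 \<le> ?Kf * (S * gnorm \<psi>)" using nS by simp
    ultimately show "\<bar>F \<psi>\<bar> \<le> ?Kf * S * gnorm \<psi>" by (simp add: ennreal_le_iff mult.assoc)
  qed
  have "V.functional F (?Kf * S)"
    unfolding V.functional_def nrm_eq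
  proof (intro conjI ballI allI)
    fix u v r assume "u \<in> {\<phi>. test_fun U \<phi>}" "v \<in> {\<phi>. test_fun U \<phi>}"
    then have "integrable lebesgue (\<lambda>x. f x * u x)" "integrable lebesgue (\<lambda>x. f x * v x)" using Fb(1) by auto
    moreover have "(\<lambda>x. f x * (u x + r * v x)) = (\<lambda>x. f x * u x + r * (f x * v x))" by (auto simp: algebra_simps)
    ultimately show "F (\<lambda>x. u x + r * v x) = F u + r * F v" by (simp add: F_def)
  qed (use Fb(2) in auto)
  \<comment> \<open>Residuals \<open>(1/2) ^ n\<close> give squared distances of order
    \<open>(1/4) ^ n\<close>, the rate that \<open>L2_complete\<close> asks for.\<close>
  then have "\<exists>\<phi>. test_fun U \<phi> \<and> (\<forall>v. test_fun U v \<longrightarrow> \<bar>form \<phi> (grad \<phi>) v - F v\<bar> \<le> (1/2) ^ n * gnorm v)" for n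
    using dense_range_form unfolding V.dense_range_def nrm_eq
    by (elim allE[of _ F] allE[of _ "?Kf * S"] allE[of _ "(1/2) ^ n"]) auto
  then obtain \<phi> where \<phi>: "\<And>n. test_fun U (\<phi> n)"
    and \<phi>F: "\<And>n v. test_fun U v \<Longrightarrow> \<bar>form (\<phi> n) (grad (\<phi> n)) v - F v\<bar> \<le> (1/2) ^ n * gnorm v"
    by metis
  have gd: "gnorm (\<lambda>x. \<phi> m x + - 1 * \<phi> n x) \<le> \<kappa> * (2 * (1/2) ^ n)" if "n \<le> m" for m n
  proof (rule \<kappa>(2)[rule_format, of 1])
    fix \<psi> assume \<psi>: "test_fun U \<psi>"
    have "(1/2::real) ^ m \<le> (1/2) ^ n" using that by (intro power_decreasing) auto
    then have "(1/2::real) ^ m * gnorm \<psi> \<le> (1/2) ^ n * gnorm \<psi>" using gnorm_nonneg by (rule mult_right_mono)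
    moreover have "form (\<lambda>x. \<phi> m x + - 1 * \<phi> n x) (grad (\<lambda>x. \<phi> m x + - 1 * \<phi> n x)) \<psi>
        = form (\<phi> m) (grad (\<phi> m)) \<psi> + - 1 * form (\<phi> n) (grad (\<phi> n)) \<psi>"
      by (rule form_test_fun_lin1[OF \<phi> \<phi> \<psi>])
    ultimately have "\<bar>form (\<lambda>x. \<phi> m x + - 1 * \<phi> n x) (grad (\<lambda>x. \<phi> m x + - 1 * \<phi> n x)) \<psi>\<bar>
        \<le> 2 * ((1/2) ^ n * gnorm \<psi>)"
      using \<phi>F[OF \<psi>, of m] \<phi>F[OF \<psi>, of n] by linarith
    then show "\<bar>(1 - 1) * ip (\<lambda>x. \<phi> m x + - 1 * \<phi> n x) \<psi> + 1 * form (\<lambda>x. \<phi> m x + - 1 * \<phi> n x) (grad (\<lambda>x. \<phi> m x + - 1 * \<phi> n x)) \<psi>\<bar>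
        \<le> 2 * (1/2) ^ n * gnorm \<psi>"
      by simp
  qed (use test_fun_lin[OF \<phi>[of m] \<phi>[of n], of "- 1"] in auto)
  have gd2: "(gnorm (\<lambda>x. \<phi> m x - \<phi> n x))\<^sup>2 \<le> 4 * \<kappa>\<^sup>2 * (1/4) ^ n" if "n \<le> m" for m n
  proof -
    have "(gnorm (\<lambda>x. \<phi> m x - \<phi> n x))\<^sup>2 \<le> (\<kappa> * (2 * (1/2) ^ n))\<^sup>2"
      using gd[OF that] gnorm_nonneg by (intro power_mono) auto
    also have "\<dots> = 4 * \<kappa>\<^sup>2 * (1/4) ^ n"
    proof -
      have "((1/2::real) ^ n)\<^sup>2 = (1/4) ^ n" by (simp add: power2_eq_square power_mult_distrib[symmetric])
      then show ?thesis by (simp add: power_mult_distrib)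
    qed
    finally show ?thesis .
  qed
  let ?P = "measure lebesgue U powr (1 / d) * S"
  have Um: "U \<in> sets lebesgue" "emeasure lebesgue U < \<infinity>"
    using lmeasurable_open[OF U(2,1)] by (auto simp: fmeasurable_def)
  have null: "(\<lambda>n. ennreal (C * (1/4) ^ n)) \<longlonglongrightarrow> 0" for C :: real
  proof -
    have "(\<lambda>n. C * (1/4) ^ n) \<longlonglongrightarrow> C * 0" by (intro tendsto_mult tendsto_const LIMSEQ_power_zero) auto
    then show ?thesis using tendsto_ennrealI by fastforce
  qed
  have bG: "(\<integral>\<^sup>+x. ennreal ((norm (grad (\<phi> m) x - grad (\<phi> n) x))\<^sup>2) \<partial>lebesgue) \<le> ennreal (4 * \<kappa>\<^sup>2 * (1/4) ^ n)"
    if "n \<le> m" for m n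
    using nn_integral_grad_square[OF test_fun_diff[OF \<phi> \<phi>], of m n] gd2[OF that]
    by (simp add: grad_diff[OF \<phi> \<phi>] ennreal_leI)
  obtain G where G: "G \<in> borel_measurable lebesgue" "\<And>x. x \<notin> U \<Longrightarrow> G x = 0"
    "\<And>n. (\<integral>\<^sup>+x. ennreal ((norm (G x - grad (\<phi> n) x))\<^sup>2) \<partial>lebesgue) \<le> ennreal (4 * \<kappa>\<^sup>2 * (1/4) ^ n)"
    by (rule L2_complete[of "\<lambda>n. grad (\<phi> n)", OF grad_measurable_lebesgue[OF \<phi>] Um grad_outside[OF \<phi>] _ bG])
       (auto intro: that)
  have bu: "(\<integral>\<^sup>+x. ennreal ((norm (\<phi> m x - \<phi> n x))\<^sup>2) \<partial>lebesgue) \<le> ennreal ((?P\<^sup>2 * (4 * \<kappa>\<^sup>2)) * (1/4) ^ n)"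
    if "n \<le> m" for m n
  proof -
    have "(?P * gnorm (\<lambda>x. \<phi> m x - \<phi> n x))\<^sup>2 \<le> ?P\<^sup>2 * (4 * \<kappa>\<^sup>2 * (1/4) ^ n)"
      unfolding power_mult_distrib[of ?P] using gd2[OF that] by (rule mult_left_mono) simp
    then show ?thesis
      using Poincare_nn[OF test_fun_diff[OF \<phi> \<phi>], of m n] by (simp add: mult.assoc) (meson ennreal_leI order_trans)
  qed
  obtain u where u: "u \<in> borel_measurable lebesgue" "\<And>x. x \<notin> U \<Longrightarrow> u x = 0"
    "\<And>n. (\<integral>\<^sup>+x. ennreal ((norm (u x - \<phi> n x))\<^sup>2) \<partial>lebesgue) \<le> ennreal ((?P\<^sup>2 * (4 * \<kappa>\<^sup>2)) * (1/4) ^ n)"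
    by (rule L2_complete[of \<phi>, OF test_fun_measurable_lebesgue[OF \<phi>] Um test_fun_outside[OF \<phi>] _ bu])
       (auto intro: that)
  have ap: "approximates \<phi> u G"
    unfolding approximates_def
  proof (intro conjI allI \<phi> u(1) G(1))
    show "(\<lambda>k. \<integral>\<^sup>+x. ennreal ((u x - \<phi> k x)\<^sup>2) \<partial>lebesgue) \<longlonglongrightarrow> 0"
      by (rule tendsto_sandwich[OF _ _ tendsto_const null[of "?P\<^sup>2 * (4 * \<kappa>\<^sup>2)"]]) (use u(3) in simp_all)
    show "(\<lambda>k. \<integral>\<^sup>+x. ennreal ((norm (G x - grad (\<phi> k) x))\<^sup>2) \<partial>lebesgue) \<longlonglongrightarrow> 0"
      by (rule tendsto_sandwich[OF _ _ tendsto_const null[of "4 * \<kappa>\<^sup>2"]]) (use G(3) in simp_all)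
  qed
  show ?thesis
  proof (rule that[OF ap u(2) G(2)])
    fix \<psi> assume \<psi>: "test_fun U \<psi>"
    have small: "\<bar>form u G \<psi> - F \<psi>\<bar> \<le> e" if e: "0 < e" for e
    proof -
      define \<delta> where "\<delta> = e / (2 * (gnorm \<psi> + 1))"
      have \<delta>: "0 < \<delta>" "2 * (\<delta> * gnorm \<psi>) \<le> e"
        using e gnorm_nonneg[of \<psi>] by (auto simp: \<delta>_def field_simps add_nonneg_pos)
      have "(\<lambda>n. (1/2::real) ^ n) \<longlonglongrightarrow> 0" by (intro LIMSEQ_power_zero) auto
      then have "\<forall>\<^sub>F n in sequentially. (1/2::real) ^ n < \<delta>" using \<delta>(1) by (rule order_tendstoD)
      then have "\<forall>\<^sub>F n in sequentially. (1/2::real) ^ n < \<delta> \<and> \<bar>form u G \<psi> - form (\<phi> n) (grad (\<phi> n)) \<psi>\<bar> \<le> \<delta> * gnorm \<psi>"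
        using form_approx[OF ap \<delta>(1)] by eventually_elim (use \<psi> in auto)
      then obtain n where n: "(1/2::real) ^ n < \<delta>" "\<bar>form u G \<psi> - form (\<phi> n) (grad (\<phi> n)) \<psi>\<bar> \<le> \<delta> * gnorm \<psi>"
        unfolding eventually_sequentially by blast
      have "(1/2::real) ^ n * gnorm \<psi> \<le> \<delta> * gnorm \<psi>" using n(1) gnorm_nonneg by (intro mult_right_mono) auto
      then show ?thesis using n(2) \<phi>F[OF \<psi>, of n] \<delta>(2) by linarith
    qed
    have "\<bar>form u G \<psi> - F \<psi>\<bar> \<le> 0" by (rule field_le_epsilon) (simp add: small)
    then show "form u G \<psi> = (\<integral>x. f x * \<psi> x \<partial>lebesgue)" by (simp add: F_def)
  qed
qed

end

section \<open>Translation to the Sobolev space of the statement\<close>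

lemma Lp_on_extend:
  fixes f :: "real^'n \<Rightarrow> 'b::euclidean_space"
  assumes "Lp_on p U f"
  shows "(\<lambda>x. indicator U x *\<^sub>R f x) \<in> borel_measurable lebesgue"
    "integrable lebesgue (\<lambda>x. norm (indicator U x *\<^sub>R f x) powr p)"
proof -
  show m [measurable]: "(\<lambda>x. indicator U x *\<^sub>R f x) \<in> borel_measurable lebesgue"
    using assms by (simp add: Lp_on_def set_borel_measurable_def)
  have "(\<integral>\<^sup>+x. ennreal (norm (norm (indicator U x *\<^sub>R f x) powr p)) \<partial>lebesgue)
      = (\<integral>\<^sup>+x\<in>U. ennreal (norm (f x) powr p) \<partial>lebesgue)"
    by (intro nn_integral_cong) (simp split: split_indicator)
  then show "integrable lebesgue (\<lambda>x. norm (indicator U x *\<^sub>R f x) powr p)"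
    using assms by (intro integrableI_bounded) (measurable, simp add: Lp_on_def)
qed

context drift_diffusion
begin

lemma approximates_imp_H120_grad:
  assumes ap: "approximates \<phi> u G" and zero: "\<And>x. x \<notin> U \<Longrightarrow> u x = 0" "\<And>x. x \<notin> U \<Longrightarrow> G x = 0"
  shows "H120_grad U u G"
proof -
  have \<phi>: "\<And>k. test_fun U (\<phi> k)" and m [measurable]: "u \<in> borel_measurable lebesgue" "G \<in> borel_measurable lebesgue"
    and lu: "(\<lambda>k. \<integral>\<^sup>+x. ennreal ((u x - \<phi> k x)\<^sup>2) \<partial>lebesgue) \<longlonglongrightarrow> 0"
    and lG: "(\<lambda>k. \<integral>\<^sup>+x. ennreal ((norm (G x - grad (\<phi> k) x))\<^sup>2) \<partial>lebesgue) \<longlonglongrightarrow> 0"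
    using ap by (auto simp: approximates_def)
  have Um [measurable]: "U \<in> sets lebesgue" using lmeasurable_open[OF U(2,1)] by auto
  \<comment> \<open>Some approximant lies at squared distance below 1 and has finite norm itself;
    the triangle inequality bounds \<open>v\<close>.\<close>
  have L2: "Lp_on 2 U v"
    if v [measurable]: "v \<in> borel_measurable lebesgue" and w: "\<And>k. w k \<in> borel_measurable lebesgue"
      and lim: "(\<lambda>k. \<integral>\<^sup>+x. ennreal ((norm (v x - w k x))\<^sup>2) \<partial>lebesgue) \<longlonglongrightarrow> 0"
      and fin: "\<And>k. \<exists>b\<ge>0. (\<integral>\<^sup>+x. ennreal ((norm (w k x))\<^sup>2) \<partial>lebesgue) \<le> ennreal b"
    for v :: "real^'n \<Rightarrow> 'b::euclidean_space" and w :: "nat \<Rightarrow> real^'n \<Rightarrow> 'b"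
  proof -
    have "\<forall>\<^sub>F k in sequentially. (\<integral>\<^sup>+x. ennreal ((norm (v x - w k x))\<^sup>2) \<partial>lebesgue) < 1"
      using order_tendstoD(2)[OF lim, of 1] by simp
    then obtain k where k: "(\<integral>\<^sup>+x. ennreal ((norm (v x - w k x))\<^sup>2) \<partial>lebesgue) < 1"
      unfolding eventually_sequentially by blast
    obtain b where b: "0 \<le> b" "(\<integral>\<^sup>+x. ennreal ((norm (w k x))\<^sup>2) \<partial>lebesgue) \<le> ennreal b" using fin by blast
    have "(\<integral>\<^sup>+x. ennreal ((norm (v x - 0))\<^sup>2) \<partial>lebesgue) \<le> ennreal (2 * 1 + 2 * b)"
      using k b w by (intro nn_integral_square_triangle[where g = "w k"]) (auto simp: less_imp_le)
    then have fin: "(\<integral>\<^sup>+x. ennreal ((norm (v x))\<^sup>2) \<partial>lebesgue) < \<infinity>" by (simp add: order.strict_trans1)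
    have "(\<integral>\<^sup>+x\<in>U. ennreal (norm (v x) powr 2) \<partial>lebesgue) \<le> (\<integral>\<^sup>+x. ennreal ((norm (v x))\<^sup>2) \<partial>lebesgue)"
      by (intro nn_integral_mono) (auto simp: powr_numeral split: split_indicator)
    then show ?thesis using fin by (auto simp: Lp_on_def set_borel_measurable_def)
  qed
  have "Lp_on 2 U u"
    using lu Poincare_nn[OF \<phi>]
    by (intro L2[OF m(1) test_fun_measurable_lebesgue[OF \<phi>]]) (auto intro!: exI zero_le_power2)
  moreover have "Lp_on 2 U G"
    using lG nn_integral_grad_square[OF \<phi>]
    by (intro L2[OF m(2) grad_measurable_lebesgue[OF \<phi>]]) (auto intro!: exI[of _ "(gnorm (\<phi> _))\<^sup>2"])
  moreover have "is_weak_grad U u G"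
    unfolding is_weak_grad_def
  proof (intro allI impI)
    fix \<psi> i assume \<psi>: "test_fun U \<psi>"
    have "(LINT x:U|lebesgue. u x * pderiv_i i \<psi> x) = (\<integral>x. u x * pderiv_i i \<psi> x \<partial>lebesgue)"
      unfolding set_lebesgue_integral_def using zero
      by (intro Bochner_Integration.integral_cong) (auto split: split_indicator)
    moreover have "(LINT x:U|lebesgue. G x $ i * \<psi> x) = (\<integral>x. G x $ i * \<psi> x \<partial>lebesgue)"
      unfolding set_lebesgue_integral_def using zero
      by (intro Bochner_Integration.integral_cong) (auto split: split_indicator)
    ultimately show "(LINT x:U|lebesgue. u x * pderiv_i i \<psi> x) = - (LINT x:U|lebesgue. G x $ i * \<psi> x)"
      using weak_gradient_approx[OF ap \<psi>, of i] by simp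
  qed
  moreover have "(\<integral>\<^sup>+x\<in>U. ennreal ((u x - \<phi> k x)\<^sup>2) \<partial>lebesgue) = (\<integral>\<^sup>+x. ennreal ((u x - \<phi> k x)\<^sup>2) \<partial>lebesgue)" for k
    using zero test_fun_outside[OF \<phi>] by (intro nn_integral_cong) (auto split: split_indicator)
  moreover have "(\<integral>\<^sup>+x\<in>U. ennreal ((norm (G x - grad (\<phi> k) x))\<^sup>2) \<partial>lebesgue) = (\<integral>\<^sup>+x. ennreal ((norm (G x - grad (\<phi> k) x))\<^sup>2) \<partial>lebesgue)" for k
    using zero grad_outside[OF \<phi>] by (intro nn_integral_cong) (auto split: split_indicator)
  ultimately show ?thesis
    unfolding H120_grad_def H12_grad_def using \<phi> lu lG by (intro conjI exI[of _ \<phi>]) auto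
qed

text \<open>Membership constrains \<open>u\<close> and \<open>G\<close> only on \<open>U\<close>,
  whereas \<open>approximates\<close> looks at the whole space; hence the extensions by
  zero.\<close>

lemma H120_grad_imp_approximates:
  assumes "H120_grad U u G"
  obtains \<phi> where "approximates \<phi> (\<lambda>x. indicator U x *\<^sub>R u x) (\<lambda>x. indicator U x *\<^sub>R G x)"
proof -
  obtain \<phi> where \<phi>: "\<And>k. test_fun U (\<phi> k)"
    and lu: "(\<lambda>k. \<integral>\<^sup>+ x \<in> U. ennreal ((u x - \<phi> k x)\<^sup>2) \<partial>lebesgue) \<longlonglongrightarrow> 0"
    and lG: "(\<lambda>k. \<integral>\<^sup>+ x \<in> U. ennreal ((norm (G x - grad (\<phi> k) x))\<^sup>2) \<partial>lebesgue) \<longlonglongrightarrow> 0"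
    using assms unfolding H120_grad_def by blast
  have "(\<integral>\<^sup>+x\<in>U. ennreal ((u x - \<phi> k x)\<^sup>2) \<partial>lebesgue) = (\<integral>\<^sup>+x. ennreal ((indicator U x *\<^sub>R u x - \<phi> k x)\<^sup>2) \<partial>lebesgue)" for k
    using test_fun_outside[OF \<phi>] by (intro nn_integral_cong) (auto split: split_indicator)
  moreover have "(\<integral>\<^sup>+x\<in>U. ennreal ((norm (G x - grad (\<phi> k) x))\<^sup>2) \<partial>lebesgue)
      = (\<integral>\<^sup>+x. ennreal ((norm (indicator U x *\<^sub>R G x - grad (\<phi> k) x))\<^sup>2) \<partial>lebesgue)" for k
    using grad_outside[OF \<phi>] by (intro nn_integral_cong) (auto split: split_indicator)
  moreover have "(\<lambda>x. indicator U x *\<^sub>R u x) \<in> borel_measurable lebesgue"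
    "(\<lambda>x. indicator U x *\<^sub>R G x) \<in> borel_measurable lebesgue"
    using assms by (auto simp only: H120_grad_def H12_grad_def intro!: Lp_on_extend(1))
  ultimately have "approximates \<phi> (\<lambda>x. indicator U x *\<^sub>R u x) (\<lambda>x. indicator U x *\<^sub>R G x)"
    using \<phi> lu lG unfolding approximates_def by simp
  then show ?thesis by (rule that)
qed

end

theorem mainTheorem4:
  fixes U :: "(real^'n) set"
    and A :: "real^'n \<Rightarrow> real^'n^'n"
    and H :: "real^'n \<Rightarrow> real^'n"
    and c f :: "real^'n \<Rightarrow> real"
    and M lam :: real
  assumes dim: "CARD('n) \<ge> 3"
    and U: "open U" "bounded U"
    and H: "Lp_on (real CARD('n)) U H"
    and c: "Lp_on (real CARD('n) / 2) U c" "AE x in lebesgue. x \<in> U \<longrightarrow> c x \<ge> 0"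
    and A_meas: "\<And>i j. (\<lambda>x. A x $ i $ j) \<in> borel_measurable lebesgue"
    and M: "M > 0" and lam: "lam > 0"
    and ellip: "AE x in lebesgue. \<forall>\<xi>. (A x *v \<xi>) \<bullet> \<xi> \<ge> lam * (norm \<xi>)\<^sup>2"
    and bnd: "AE x in lebesgue. \<forall>i j. \<bar>A x $ i $ j\<bar> \<le> M"
    and f: "Lp_on (2 * real CARD('n) / (real CARD('n) + 2)) U f"
  shows "(\<exists>u G. H120_grad U u G \<and> weak_eqn U A H c f u G) \<and>
         (\<forall>u1 G1 u2 G2. H120_grad U u1 G1 \<and> weak_eqn U A H c f u1 G1 \<and>
                        H120_grad U u2 G2 \<and> weak_eqn U A H c f u2 G2 \<longrightarrow>
                        (AE x in lebesgue. x \<in> U \<longrightarrow> u1 x = u2 x))"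
proof -
  let ?H = "\<lambda>x. indicator U x *\<^sub>R H x" and ?c = "\<lambda>x. indicator U x *\<^sub>R c x" and ?f = "\<lambda>x. indicator U x *\<^sub>R f x"
  have c0: "AE x in lebesgue. 0 \<le> ?c x"
    using c(2) by eventually_elim (simp split: split_indicator)
  interpret drift_diffusion U A ?H ?c M lam "real CARD('n)"
    using dim U Lp_on_extend[OF H] Lp_on_extend[OF c(1)] c0 A_meas M lam ellip bnd
    by unfold_locales simp_all
  have fm: "?f \<in> borel_measurable lebesgue"
    "integrable lebesgue (\<lambda>x. \<bar>?f x\<bar> powr (2 * real CARD('n) / (real CARD('n) + 2)))"
    using Lp_on_extend[OF f] by simp_all
  \<comment> \<open>The test function and its gradient vanish outside \<open>U\<close>, so extending
    \<open>u\<close>, \<open>G\<close>, the lower-order coefficients and \<open>f\<close> by zero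
    changes neither side of the equation.\<close>
  have eqn: "weak_eqn U A H c f u G \<longleftrightarrow>
      (\<forall>\<psi>. test_fun U \<psi> \<longrightarrow> form (\<lambda>x. indicator U x *\<^sub>R u x) (\<lambda>x. indicator U x *\<^sub>R G x) \<psi> = (\<integral>x. ?f x * \<psi> x \<partial>lebesgue))"
    for u G
  proof -
    have "(LINT x:U|lebesgue. (A x *v G x) \<bullet> grad \<psi> x + (H x \<bullet> G x) * \<psi> x + c x * u x * \<psi> x)
        = form (\<lambda>x. indicator U x *\<^sub>R u x) (\<lambda>x. indicator U x *\<^sub>R G x) \<psi>" if "test_fun U \<psi>" for \<psi>
      unfolding set_lebesgue_integral_def form_def integrand_def
      by (intro Bochner_Integration.integral_cong)
        (simp_all add: grad_outside[OF that] test_fun_outside[OF that] split: split_indicator)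
    moreover have "(LINT x:U|lebesgue. f x * \<psi> x) = (\<integral>x. ?f x * \<psi> x \<partial>lebesgue)" for \<psi>
      unfolding set_lebesgue_integral_def
      by (intro Bochner_Integration.integral_cong) (simp_all split: split_indicator)
    ultimately show ?thesis unfolding weak_eqn_def by auto
  qed
  have "\<exists>u G. H120_grad U u G \<and> weak_eqn U A H c f u G"
  proof -
    obtain \<phi> u G where ap: "approximates \<phi> u G" and zero: "\<And>x. x \<notin> U \<Longrightarrow> u x = 0" "\<And>x. x \<notin> U \<Longrightarrow> G x = 0"
      and sol: "\<And>\<psi>. test_fun U \<psi> \<Longrightarrow> form u G \<psi> = (\<integral>x. ?f x * \<psi> x \<partial>lebesgue)"
      by (rule existence[OF fm]) (rule that)
    have "(\<lambda>x. indicator U x *\<^sub>R u x) = u" "(\<lambda>x. indicator U x *\<^sub>R G x) = G"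
      using zero by (auto simp: fun_eq_iff split: split_indicator)
    then have "weak_eqn U A H c f u G" using sol by (simp add: eqn)
    then show ?thesis using approximates_imp_H120_grad[OF ap zero] by blast
  qed
  moreover have "AE x in lebesgue. x \<in> U \<longrightarrow> u1 x = u2 x"
    if sol: "H120_grad U u1 G1" "weak_eqn U A H c f u1 G1" "H120_grad U u2 G2" "weak_eqn U A H c f u2 G2"
    for u1 G1 u2 G2
  proof -
    obtain \<phi>1 where 1: "approximates \<phi>1 (\<lambda>x. indicator U x *\<^sub>R u1 x) (\<lambda>x. indicator U x *\<^sub>R G1 x)"
      by (rule H120_grad_imp_approximates[OF sol(1)]) (rule that)
    obtain \<phi>2 where 2: "approximates \<phi>2 (\<lambda>x. indicator U x *\<^sub>R u2 x) (\<lambda>x. indicator U x *\<^sub>R G2 x)"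
      by (rule H120_grad_imp_approximates[OF sol(3)]) (rule that)
    have "AE x in lebesgue. indicator U x *\<^sub>R u1 x = indicator U x *\<^sub>R u2 x"
      using sol(2,4) unfolding eqn by (intro uniqueness[OF 1 _ 2]) auto
    then show ?thesis by eventually_elim (simp split: split_indicator_asm)
  qed
  ultimately show ?thesis by blast
qed

end
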